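(* Let $f\in L^1(D)$, $h\in H_b$, and $c\in\mathbb{R}$. Then the Schwarz boundary value problem $$\frac{\partial w}{\partial\bar z}=f \ \text{ in } D,\qquad \operatorname{Re} w_b=\operatorname{Re} h_b,\qquad \operatorname{Im} w(0)=c$$ is solved by the function given, for $z=re^{i\theta}\in D$, by $$w(z)=ic-I+\frac{1}{2\pi}\langle h_b,P_r(\theta-\cdot)\rangle-\frac{1}{2\pi}\iint_{|\zeta|<1}\left(\frac{f(\zeta)}{\zeta}\,\frac{\zeta+z}{\zeta-z}+\frac{\overline{f(\zeta)}}{\overline{\zeta}}\,\frac{1+z\overline{\zeta}}{1-z\overline{\zeta}}\right)d\xi\,d\eta,$$ where $\zeta=\xi+i\eta$, $$P_r(\theta)=\frac{1-r^2}{1-2r\cos\theta+r^2},\qquad I=\frac{i}{2\pi}\langle\operatorname{Im}h_b,1\rangle.$$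
   Context: $D$ is the open unit disk in $\mathbb{C}$, $\partial D$ is the unit circle, $H(D)$ is the space of holomorphic functions on $D$, and $\mathcal{D}'(\partial D)$ is the space of distributions on $\partial D$. Functions $\varphi\in C^\infty(\partial D)$ are identified with smooth $2\pi$-periodic functions of $\theta$. The equation $\partial w/\partial\bar z=f$ is understood in the weak (distributional) sense. Boundary value in the sense of distributions: a function $g$ on $D$ has a boundary value in the sense of distributions, denoted $g_b\in\mathcal{D}'(\partial D)$, if for every $\varphi\in C^\infty(\partial D)$ the limit $$\langle g_b,\varphi\rangle:=\lim_{r\nearrow1}\int_0^{2\pi}g(re^{i\theta})\,\varphi(\theta)\,d\theta$$ exists. $H_b$ is the set of functions in $H(D)$ that have a boundary value in the sense of distributions. For a distribution $u$, $\operatorname{Re}u$ and $\operatorname{Im}u$ are the real-valued distributions with $u=\operatorname{Re}u+i\operatorname{Im}u$, i.e. $\langle\operatorname{Re}u,\varphi\rangle=\operatorname{Re}\langle u,\varphi\rangle$ and $\langle\operatorname{Im}u,\varphi\rangle=\operatorname{Im}\langle u,\varphi\rangle$ for real-valued test functions $\varphi$.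
   Formalization: Added: the double integral converges absolutely for almost every z in D (for f=iζ|ζ|^{-5/2} in L^1 it diverges at every z≠0). The boundary limit of w is over r outside a null set of radii, the same for all test functions, since w can be undefined on whole circles. *)

theory Defs
  imports "HOL-Complex_Analysis.Complex_Analysis"
begin

abbreviation unit_disk :: "complex set"
  where "unit_disk \<equiv> ball 0 1"

text \<open>
  The class \<open>C\<^sup>\<infinity>\<close>: the largest set of everywhere differentiable functions that is closed
  under taking directional derivatives.
\<close>

coinductive smooth :: "('a::euclidean_space \<Rightarrow> 'b::real_normed_vector) \<Rightarrow> bool"
  where smoothI:
    "(\<And>x. g differentiable (at x)) \<Longrightarrow>
     (\<And>v. smooth (\<lambda>x. frechet_derivative g (at x) v)) \<Longrightarrow> smooth g"

subsection \<open>The inhomogeneous Cauchy-Riemann equation in the weak sense\<close>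

definition disk_tests :: "(complex \<Rightarrow> complex) set"
  where "disk_tests = {\<phi>. smooth \<phi> \<and> (\<exists>K. compact K \<and> K \<subseteq> unit_disk \<and> (\<forall>z. z \<notin> K \<longrightarrow> \<phi> z = 0))}"

definition dbar :: "(complex \<Rightarrow> complex) \<Rightarrow> complex \<Rightarrow> complex"
  where "dbar \<phi> z =
    (frechet_derivative \<phi> (at z) 1 + \<i> * frechet_derivative \<phi> (at z) \<i>) / 2"

definition weak_dbar_eq :: "(complex \<Rightarrow> complex) \<Rightarrow> (complex \<Rightarrow> complex) \<Rightarrow> bool"
  where "weak_dbar_eq w f \<longleftrightarrow>
    (\<forall>K. compact K \<and> K \<subseteq> unit_disk \<longrightarrow> set_integrable lebesgue K w) \<and>
    (\<forall>\<phi>\<in>disk_tests.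
      (LINT z:unit_disk|lebesgue. w z * dbar \<phi> z) = - (LINT z:unit_disk|lebesgue. f z * \<phi> z))"

subsection \<open>Distributional boundary values\<close>

definition circle_tests :: "(real \<Rightarrow> complex) set"
  where "circle_tests = {\<phi>. smooth \<phi> \<and> (\<forall>t. \<phi> (t + 2 * pi) = \<phi> t)}"

definition circle_pairing :: "(complex \<Rightarrow> complex) \<Rightarrow> (real \<Rightarrow> complex) \<Rightarrow> real \<Rightarrow> complex"
  where "circle_pairing g \<phi> r =
    (LINT \<theta>:{0..2*pi}|lebesgue. g (complex_of_real r * cis \<theta>) * \<phi> \<theta>)"

text \<open>
  In the next two definitions \<open>N\<close> is a set of excluded radii. For \<open>N = {}\<close> they are the boundary
  value of a function that is defined everywhere on the disk, with \<open>r\<close> tending to 1 through all of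
  \<open>(0,1)\<close>. A function that is only defined almost everywhere (such as a solution of the weak
  equation with merely integrable right-hand side) need not have a trace on every circle; for it
  \<open>N\<close> is a null set of radii. The set \<open>N\<close> does not depend on the test function.
\<close>

definition has_boundary_value :: "real set \<Rightarrow> (complex \<Rightarrow> complex) \<Rightarrow> bool"
  where "has_boundary_value N g \<longleftrightarrow>
    (\<forall>r\<in>{0<..<1} - N. set_integrable lebesgue {0..2*pi} (\<lambda>\<theta>. g (complex_of_real r * cis \<theta>))) \<and>
    (\<forall>\<phi>\<in>circle_tests. \<exists>L. (circle_pairing g \<phi> \<longlongrightarrow> L) (at 1 within {0<..<1} - N))"

definition boundary_value :: "real set \<Rightarrow> (complex \<Rightarrow> complex) \<Rightarrow> (real \<Rightarrow> complex) \<Rightarrow> complex"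
  where "boundary_value N g \<phi> = Lim (at 1 within {0<..<1} - N) (circle_pairing g \<phi>)"

definition H_b :: "(complex \<Rightarrow> complex) set"
  where "H_b = {h. h holomorphic_on unit_disk \<and> has_boundary_value {} h}"

text \<open>
  Real and imaginary part of a distribution \<open>u\<close>, determined by
  \<open>\<langle>Re u, \<phi>\<rangle> = Re \<langle>u, \<phi>\<rangle>\<close> and \<open>\<langle>Im u, \<phi>\<rangle> = Im \<langle>u, \<phi>\<rangle>\<close> for real \<open>\<phi>\<close> and extended complex-linearly.
\<close>

definition Re_distr :: "((real \<Rightarrow> complex) \<Rightarrow> complex) \<Rightarrow> (real \<Rightarrow> complex) \<Rightarrow> complex"
  where "Re_distr u \<phi> =
    complex_of_real (Re (u (\<lambda>t. complex_of_real (Re (\<phi> t))))) +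
    \<i> * complex_of_real (Re (u (\<lambda>t. complex_of_real (Im (\<phi> t)))))"

definition Im_distr :: "((real \<Rightarrow> complex) \<Rightarrow> complex) \<Rightarrow> (real \<Rightarrow> complex) \<Rightarrow> complex"
  where "Im_distr u \<phi> =
    complex_of_real (Im (u (\<lambda>t. complex_of_real (Re (\<phi> t))))) +
    \<i> * complex_of_real (Im (u (\<lambda>t. complex_of_real (Im (\<phi> t)))))"

subsection \<open>The solution formula\<close>

definition poisson :: "real \<Rightarrow> real \<Rightarrow> real"
  where "poisson r \<theta> = (1 - r\<^sup>2) / (1 - 2 * r * cos \<theta> + r\<^sup>2)"

definition schwarz_integrand :: "(complex \<Rightarrow> complex) \<Rightarrow> complex \<Rightarrow> complex \<Rightarrow> complex"
  where "schwarz_integrand f z \<zeta> =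
    f \<zeta> / \<zeta> * ((\<zeta> + z) / (\<zeta> - z)) + cnj (f \<zeta>) / cnj \<zeta> * ((1 + z * cnj \<zeta>) / (1 - z * cnj \<zeta>))"

definition schwarz_solution ::
    "(complex \<Rightarrow> complex) \<Rightarrow> (complex \<Rightarrow> complex) \<Rightarrow> real \<Rightarrow> complex \<Rightarrow> complex"
  where "schwarz_solution f h c z =
    \<i> * complex_of_real c
    - \<i> / complex_of_real (2 * pi) * Im_distr (boundary_value {} h) (\<lambda>_. 1)
    + 1 / complex_of_real (2 * pi) *
        boundary_value {} h (\<lambda>t. complex_of_real (poisson (cmod z) (Arg z - t)))
    - 1 / complex_of_real (2 * pi) * (LINT \<zeta>:unit_disk|lebesgue. schwarz_integrand f z \<zeta>)"

text \<open>
  Integrability of \<open>f\<close> alone does not make the integral in the formula converge: off \<open>\<zeta> = 0\<close> the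
  integrand is locally integrable for almost every \<open>z\<close>, but near \<open>\<zeta> = 0\<close> it behaves for \<open>z \<noteq> 0\<close>
  like \<open>-2\<i> Im (f \<zeta> / \<zeta>)\<close>, which for \<open>f \<zeta> = \<i> \<zeta> |\<zeta>|\<^sup>-\<^sup>5\<^sup>/\<^sup>2\<close> is not integrable. The following predicate
  says that the formula defines \<open>w\<close> almost everywhere. Convergence at every \<open>z\<close> would be too much
  to ask, since the singularity \<open>1/(\<zeta> - z)\<close> is integrable against \<open>f\<close> only for almost every \<open>z\<close>.
\<close>

definition schwarz_formula_defined :: "(complex \<Rightarrow> complex) \<Rightarrow> bool"
  where "schwarz_formula_defined f \<longleftrightarrow>
    (AE z in lebesgue. z \<in> unit_disk \<longrightarrow> set_integrable lebesgue unit_disk (schwarz_integrand f z))"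

end

theory Submission
  imports Defs
begin

text \<open>
  Off \<open>\<zeta> = 0\<close> and \<open>\<zeta> = z\<close> the integrand of the solution formula is
  \<open>-2\<i> Im (f/\<zeta>) + 2 f/(\<zeta> - z) + 2 z cnj f/(1 - z cnj \<zeta>)\<close>. The first term is free of \<open>z\<close>, and the
  Poisson integral of \<open>h\<^sub>b\<close> is \<open>h\<close>, so almost everywhere \<open>w\<close> is \<open>h\<close> plus an imaginary constant, minus
  \<open>1/\<pi>\<close> times the Cauchy transform \<open>\<integral> f/(\<zeta> - z)\<close> and its reflected companion
  \<open>\<integral> z cnj f/(1 - z cnj \<zeta>)\<close>. By the Cauchy-Pompeiu formula the Cauchy transform supplies the
  right-hand side of the differential equation, while the companion is holomorphic. Paired with a
  real test function on the unit circle, the two potentials are complex conjugates of each other up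
  to sign, so that their sum contributes nothing to the real part of the boundary value. The limit
  \<open>r \<rightarrow> 1\<close> is taken by dominated convergence, since \<open>\<integral> \<phi>(\<theta>)/(\<zeta> - r cis \<theta>) d\<theta>\<close> is bounded
  uniformly in \<open>\<zeta>\<close> and \<open>r\<close>; the radii for which Fubini fails form a null set.
\<close>

section \<open>Integrals over the complex plane\<close>

text \<open>The obstacle: \<open>f\<close> is merely integrable, so its Cauchy transform exists only
  almost everywhere, and no almost-everywhere statement in the plane says anything on a single
  circle, which is a null set. Hence the formula for \<open>w\<close> is kept pointwise, at every
  point where the Cauchy integral converges; Tonelli in radius and angle shows that for almost every
  radius this covers almost every angle. That step involves no test function, so neither do the
  excluded radii. No polar change of variables is made: the Cauchy kernel is bounded by products of
  two inverse square roots, one in each real variable. The cancellation of real parts comes from one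
  kernel seen from two sides: on radius \<open>r\<close> the Cauchy part uses
  \<open>circle_kernel\<close> at \<open>r\<close>, the reflected part uses it at
  \<open>1/r\<close>, and for fixed \<zeta> in the open disk both tend to its value at radius 1. For
  Fubini, \<open>f\<close> is replaced by a Borel function that vanishes off the disk. The value at
  0 is treated apart, since the Cauchy integral may diverge there.\<close>

lemma measurable_Complex [measurable (raw)]:
  assumes "f \<in> borel_measurable M" "g \<in> borel_measurable M"
  shows "(\<lambda>x. Complex (f x) (g x)) \<in> borel_measurable M"
  using assms by (simp add: Complex_eq)

lemma borel_measurable_cnj [measurable (raw)]:
  assumes "f \<in> borel_measurable M"
  shows "(\<lambda>x. cnj (f x)) \<in> borel_measurable M"
  by (rule measurable_compose[OF assms]) (intro borel_measurable_continuous_onI continuous_intros)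

lemma borel_measurable_cis [measurable (raw)]:
  assumes "f \<in> borel_measurable M"
  shows "(\<lambda>x. cis (f x)) \<in> borel_measurable M"
  by (rule measurable_compose[OF assms]) (intro borel_measurable_continuous_onI continuous_intros)

text \<open>Lebesgue measure is determined by its values on boxes, and the preimage of a box under
  \<open>Complex\<close> is a product of intervals. This is the source of Tonelli and Fubini in
  Cartesian coordinates.\<close>

lemma lborel_complex_eq:
  "(lborel :: complex measure) = distr (lborel \<Otimes>\<^sub>M lborel) borel (\<lambda>(x, y). Complex x y)"
proof (rule lborel_eqI)
  fix l u :: complex
  assume le: "\<And>b. b \<in> Basis \<Longrightarrow> l \<bullet> b \<le> u \<bullet> b"
  have "(\<lambda>(x, y). Complex x y) -` box l u \<inter> space (lborel \<Otimes>\<^sub>M lborel) =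
      {Re l<..<Re u} \<times> {Im l<..<Im u}"
    by (auto simp: box_complex_eq space_pair_measure)
  moreover have "Re l \<le> Re u" "Im l \<le> Im u"
    using le[of 1] le[of \<i>] by (auto simp: Basis_complex_def)
  ultimately show "emeasure (distr (lborel \<Otimes>\<^sub>M lborel) borel (\<lambda>(x, y). Complex x y)) (box l u) =
      (\<Prod>b\<in>Basis. (u - l) \<bullet> b)"
    by (subst emeasure_distr)
      (auto simp: lborel.emeasure_pair_measure_Times Basis_complex_def ennreal_mult'
            simp del: Times_Int_Times)
qed simp

lemma nn_integral_lborel_complex:
  assumes [measurable]: "f \<in> borel_measurable (borel :: complex measure)"
  shows "(\<integral>\<^sup>+z. f z \<partial>lborel) = (\<integral>\<^sup>+x. (\<integral>\<^sup>+y. f (Complex x y) \<partial>lborel) \<partial>lborel)"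
  by (subst lborel_complex_eq, subst nn_integral_distr)
    (auto simp: split_beta lborel.nn_integral_fst[symmetric])

lemma integrable_lborel_complex:
  fixes f :: "complex \<Rightarrow> 'a::{banach, second_countable_topology}"
  assumes f: "integrable lborel f"
  shows "integrable (lborel \<Otimes>\<^sub>M lborel) (\<lambda>(x, y). f (Complex x y))"
proof -
  have [measurable]: "f \<in> borel_measurable borel"
    using f by auto
  show ?thesis
    using f by (subst (asm) lborel_complex_eq, subst (asm) integrable_distr_eq)
      (auto simp: case_prod_unfold)
qed

lemma integral_lborel_complex:
  fixes f :: "complex \<Rightarrow> 'a::{banach, second_countable_topology}"
  assumes f: "integrable lborel f"
  shows "(\<integral>z. f z \<partial>lborel) = (\<integral>x. (\<integral>y. f (Complex x y) \<partial>lborel) \<partial>lborel)"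
    and "(\<integral>z. f z \<partial>lborel) = (\<integral>y. (\<integral>x. f (Complex x y) \<partial>lborel) \<partial>lborel)"
proof -
  have [measurable]: "f \<in> borel_measurable borel"
    using f by auto
  have "(\<integral>z. f z \<partial>lborel) = (\<integral>p. (case p of (x, y) \<Rightarrow> f (Complex x y)) \<partial>(lborel \<Otimes>\<^sub>M lborel))"
    by (subst lborel_complex_eq, subst integral_distr) (auto simp: case_prod_unfold)
  then show "(\<integral>z. f z \<partial>lborel) = (\<integral>x. (\<integral>y. f (Complex x y) \<partial>lborel) \<partial>lborel)"
    "(\<integral>z. f z \<partial>lborel) = (\<integral>y. (\<integral>x. f (Complex x y) \<partial>lborel) \<partial>lborel)"
    using lborel_pair.integral_fst[OF integrable_lborel_complex[OF f]]
      lborel_pair.integral_snd[OF integrable_lborel_complex[OF f]] by simp_all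
qed

text \<open>Tonelli bounds the double integral by \<open>C\<close> times the norm of
  \<open>F\<close>. Asking for the bound only where \<open>F\<close> is nonzero lets the reflected
  kernel use that \<zeta> lies in the disk.\<close>

lemma (in pair_sigma_finite) integrable_mult_kernel:
  fixes F :: "'a \<Rightarrow> complex"
  assumes F: "integrable M1 F"
    and k [measurable]: "case_prod k \<in> borel_measurable (M1 \<Otimes>\<^sub>M M2)"
    and bound: "\<And>x. F x \<noteq> 0 \<Longrightarrow> (\<integral>\<^sup>+y. norm (k x y) \<partial>M2) \<le> ennreal C"
  shows "integrable (M1 \<Otimes>\<^sub>M M2) (\<lambda>(x, y). F x * k x y)"
proof (rule integrableI_bounded)
  have [measurable]: "F \<in> borel_measurable M1"
    using F by auto
  show "(\<lambda>(x, y). F x * k x y) \<in> borel_measurable (M1 \<Otimes>\<^sub>M M2)"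
    by measurable
  have "(\<integral>\<^sup>+p. norm (case p of (x, y) \<Rightarrow> F x * k x y) \<partial>(M1 \<Otimes>\<^sub>M M2)) =
      (\<integral>\<^sup>+x. ennreal (norm (F x)) * (\<integral>\<^sup>+y. norm (k x y) \<partial>M2) \<partial>M1)"
    by (subst M2.nn_integral_fst[symmetric])
      (auto simp: norm_mult ennreal_mult' nn_integral_cmult intro!: nn_integral_cong)
  also have "\<dots> \<le> (\<integral>\<^sup>+x. ennreal (norm (F x)) * ennreal C \<partial>M1)"
    using bound by (intro nn_integral_mono) (metis mult_left_mono norm_zero ennreal_0 mult_zero_left order_refl zero_le)
  also have "\<dots> = (\<integral>\<^sup>+x. ennreal (norm (F x)) \<partial>M1) * ennreal C"
    by (rule nn_integral_multc) auto
  also have "\<dots> < \<infinity>"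
    using F by (auto simp: integrable_iff_bounded ennreal_mult_less_top)
  finally show "(\<integral>\<^sup>+p. norm (case p of (x, y) \<Rightarrow> F x * k x y) \<partial>(M1 \<Otimes>\<^sub>M M2)) < \<infinity>" .
qed

text \<open>What matters is that the bound does not depend on the pole \<open>b\<close>: within
  distance 1 of \<open>b\<close> the integral is at most 4, and farther away the integrand is at
  most 1, which costs the length of the interval.\<close>

lemma nn_integral_inverse_sqrt:
  "(\<integral>\<^sup>+t. ennreal (1 / sqrt \<bar>t - b\<bar>) * indicator {a..c} t \<partial>lborel) \<le> ennreal (4 + \<bar>c - a\<bar>)"
proof -
  let ?q = "\<lambda>t. ennreal (1 / sqrt \<bar>t\<bar>)"
  have half: "(\<integral>\<^sup>+t. ?q t * indicator {0..1} t \<partial>lborel) = 2"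
  proof -
    have "(\<integral>\<^sup>+t. ennreal (t powr (-1/2)) * indicator {0..1} t \<partial>lborel) = ennreal 2"
      using nn_integral_has_integral_lebesgue'[OF _ has_integral_powr_from_0[of "-1/2" 1]] by simp
    \<comment> \<open>At \<open>t = 0\<close> both sides are 0, by the conventions for
      \<open>powr\<close> and for division by zero.\<close>
    moreover have "ennreal (t powr (-1/2)) * indicator {0..1} t = ?q t * indicator {0..1} t" for t :: real
      by (auto simp: indicator_def powr_minus powr_half_sqrt field_simps)
    ultimately show ?thesis
      by simp
  qed
  have neg: "(\<integral>\<^sup>+t. ?q t * indicator {-1..0} t \<partial>lborel) = 2"
    using half by (subst nn_integral_real_affine[where c="-1" and t=0])
      (auto intro!: nn_integral_cong simp: indicator_def conj_commute)
  have one: "(\<integral>\<^sup>+t. ?q t * indicator {-1..1} t \<partial>lborel) \<le> 4"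
  proof -
    have "(\<integral>\<^sup>+t. ?q t * indicator {-1..1} t \<partial>lborel) \<le>
        (\<integral>\<^sup>+t. ?q t * indicator {-1..0} t + ?q t * indicator {0..1} t \<partial>lborel)"
      by (intro nn_integral_mono) (auto simp: indicator_def)
    also have "\<dots> = 4"
      by (subst nn_integral_add) (auto simp: half neg)
    finally show ?thesis .
  qed
  have "(\<integral>\<^sup>+t. ?q (t - b) * indicator {a..c} t \<partial>lborel) \<le>
      (\<integral>\<^sup>+t. ?q (t - b) * indicator {-1..1} (t - b) + indicator {a..c} t \<partial>lborel)"
  proof (intro nn_integral_mono)
    fix t :: real
    have "1 / sqrt \<bar>t - b\<bar> \<le> 1" if "t - b \<notin> {-1..1}"
      using that real_sqrt_ge_one[of "\<bar>t - b\<bar>"] by (auto simp: field_simps abs_if split: if_splits)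
    then show "?q (t - b) * indicator {a..c} t \<le>
        ?q (t - b) * indicator {-1..1} (t - b) + indicator {a..c} t"
      by (cases "t - b \<in> {-1..1}"; cases "t \<in> {a..c}")
        (simp_all add: ennreal_le_1 del: atLeastAtMost_iff)
  qed
  also have "\<dots> = (\<integral>\<^sup>+t. ?q (t - b) * indicator {-1..1} (t - b) \<partial>lborel) + emeasure lborel {a..c}"
    by (subst nn_integral_add) auto
  also have "(\<integral>\<^sup>+t. ?q (t - b) * indicator {-1..1} (t - b) \<partial>lborel) =
      (\<integral>\<^sup>+t. ?q t * indicator {-1..1} t \<partial>lborel)"
    by (subst (2) nn_integral_real_affine[where c=1 and t="-b"]) auto
  also have "\<dots> + emeasure lborel {a..c} \<le> 4 + ennreal \<bar>c - a\<bar>"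
    using one by (intro add_mono) (auto simp: emeasure_lborel_Icc_eq)
  finally show ?thesis
    by (simp add: ennreal_plus)
qed

text \<open>The squared modulus dominates the product of the moduli of real and imaginary part, so
  the kernel is at most a product of two one-dimensional inverse square roots. Each factor
  integrates over [-1, 1] to at most 4 + 2 = 6, uniformly in \<zeta>.\<close>

lemma nn_integral_cauchy_kernel:
  "(\<integral>\<^sup>+z. ennreal (norm (1 / (\<zeta> - z))) * indicator unit_disk z \<partial>lborel) \<le> ennreal 36"
proof -
  have [measurable]: "unit_disk \<in> sets borel"
    by simp
  let ?q = "\<lambda>b t. ennreal (1 / sqrt \<bar>t - b\<bar>) * indicator {-1..1} (t :: real)"
  have "(\<integral>\<^sup>+z. ennreal (norm (1 / (\<zeta> - z))) * indicator unit_disk z \<partial>lborel) =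
      (\<integral>\<^sup>+x. \<integral>\<^sup>+y. ennreal (norm (1 / (\<zeta> - Complex x y))) * indicator unit_disk (Complex x y) \<partial>lborel \<partial>lborel)"
    by (rule nn_integral_lborel_complex) measurable
  also have "\<dots> \<le> (\<integral>\<^sup>+x. \<integral>\<^sup>+y. ?q (Re \<zeta>) x * ?q (Im \<zeta>) y \<partial>lborel \<partial>lborel)"
  \<comment> \<open>On the line \<open>x = Re \<zeta>\<close> the majorant is 0, because division by
    zero gives 0; the comparison holds only off this null set. The same happens for \<open>y\<close>
    below.\<close>
  proof (rule nn_integral_mono_AE, rule eventually_mono[OF AE_lborel_singleton[of "Re \<zeta>"]])
    fix x assume x: "x \<noteq> Re \<zeta>"
    show "(\<integral>\<^sup>+y. ennreal (norm (1 / (\<zeta> - Complex x y))) * indicator unit_disk (Complex x y) \<partial>lborel) \<le>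
        (\<integral>\<^sup>+y. ?q (Re \<zeta>) x * ?q (Im \<zeta>) y \<partial>lborel)"
    proof (rule nn_integral_mono_AE, rule eventually_mono[OF AE_lborel_singleton[of "Im \<zeta>"]])
      fix y assume y: "y \<noteq> Im \<zeta>"
      let ?z = "\<zeta> - Complex x y"
      have "1 / norm ?z \<le> 1 / sqrt \<bar>x - Re \<zeta>\<bar> * (1 / sqrt \<bar>y - Im \<zeta>\<bar>)"
      proof -
        have "sqrt (\<bar>x - Re \<zeta>\<bar> * \<bar>y - Im \<zeta>\<bar>) \<le> sqrt (norm ?z * norm ?z)"
          using abs_Re_le_cmod[of ?z] abs_Im_le_cmod[of ?z]
          by (intro real_sqrt_le_mono mult_mono) (auto simp: abs_minus_commute)
        then show ?thesis
          using x y by (auto simp: real_sqrt_mult intro!: divide_left_mono mult_pos_pos)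
      qed
      moreover have "x \<in> {-1..1} \<and> y \<in> {-1..1}" if "Complex x y \<in> unit_disk"
        using that abs_Re_le_cmod[of "Complex x y"] abs_Im_le_cmod[of "Complex x y"] by auto
      ultimately show "ennreal (norm (1 / ?z)) * indicator unit_disk (Complex x y) \<le>
          ?q (Re \<zeta>) x * ?q (Im \<zeta>) y"
        by (auto simp: indicator_def norm_divide ennreal_mult'[symmetric] split: if_splits)
    qed
  qed
  also have "\<dots> = (\<integral>\<^sup>+x. ?q (Re \<zeta>) x \<partial>lborel) * (\<integral>\<^sup>+y. ?q (Im \<zeta>) y \<partial>lborel)"
    by (subst nn_integral_cmult) (auto simp: nn_integral_multc)
  also have "\<dots> \<le> ennreal 6 * ennreal 6"
    using nn_integral_inverse_sqrt[of _ "-1" 1] by (intro mult_mono) auto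
  finally show ?thesis
    by (simp add: ennreal_mult'[symmetric])
qed

lemma dbar_eq:
  assumes "(\<phi> has_derivative D) (at z)"
  shows "dbar \<phi> z = (D 1 + \<i> * D \<i>) / 2"
  using frechet_derivative_at[OF assms] by (simp add: dbar_def)

section \<open>Total mass of the kernel 1/(1 + |u|^2)^2\<close>

lemma nn_integral_even:
  fixes f :: "real \<Rightarrow> ennreal"
  assumes [measurable]: "f \<in> borel_measurable borel" and even: "\<And>x. f (- x) = f x"
  shows "(\<integral>\<^sup>+x. f x \<partial>lborel) = 2 * (\<integral>\<^sup>+x. f x * indicator {0..} x \<partial>lborel)"
proof -
  have "(\<integral>\<^sup>+x. f x \<partial>lborel) = (\<integral>\<^sup>+x. f x * indicator {0..} x + f x * indicator {..0} x \<partial>lborel)"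
    by (rule nn_integral_cong_AE, rule eventually_mono[OF AE_lborel_singleton[of 0]])
      (auto simp: indicator_def)
  also have "\<dots> = (\<integral>\<^sup>+x. f x * indicator {0..} x \<partial>lborel) + (\<integral>\<^sup>+x. f x * indicator {..0} x \<partial>lborel)"
    by (subst nn_integral_add) auto
  also have "(\<integral>\<^sup>+x. f x * indicator {..0} x \<partial>lborel) = (\<integral>\<^sup>+x. f x * indicator {0..} x \<partial>lborel)"
    by (subst nn_integral_real_affine[where c="-1" and t=0])
      (auto simp: even indicator_def intro!: nn_integral_cong)
  finally show ?thesis
    by (simp add: mult_2)
qed

lemma nn_integral_inverse_square_plus:
  fixes a :: real
  assumes a: "a > 0"
  shows "(\<integral>\<^sup>+y. ennreal (1 / (a\<^sup>2 + y\<^sup>2)\<^sup>2) \<partial>lborel) = ennreal (pi / (2 * a ^ 3))"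
proof -
  \<comment> \<open>The antiderivative given by the reduction formula for powers of
    \<open>1 / (a^2 + y^2)\<close>; it vanishes at 0 and tends to \<open>pi / (4 * a^3)\<close>,
    half of the claimed value.\<close>
  define F where "F y = y / (2 * a\<^sup>2 * (a\<^sup>2 + y\<^sup>2)) + arctan (y / a) / (2 * a ^ 3)" for y
  have nz: "a\<^sup>2 + y\<^sup>2 \<noteq> 0" for y
    using a by (metis add_pos_nonneg less_irrefl zero_le_power2 zero_less_power)
  have "DERIV F y :> 1 / (a\<^sup>2 + y\<^sup>2)\<^sup>2" for y
  proof -
    have nz': "1 + (y / a)\<^sup>2 \<noteq> 0"
      by (metis add_pos_nonneg less_irrefl zero_le_power2 zero_less_one)
    have "DERIV F y :> (1 * (2 * a\<^sup>2 * (a\<^sup>2 + y\<^sup>2)) - y * (2 * a\<^sup>2 * (2 * y))) / (2 * a\<^sup>2 * (a\<^sup>2 + y\<^sup>2))\<^sup>2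
        + (1 / a) * inverse (1 + (y / a)\<^sup>2) / (2 * a ^ 3)"
      unfolding F_def
    proof (intro DERIV_add DERIV_divide DERIV_cdivide)
      show "DERIV (\<lambda>y. y / (2 * a\<^sup>2 * (a\<^sup>2 + y\<^sup>2))) y :>
          (1 * (2 * a\<^sup>2 * (a\<^sup>2 + y\<^sup>2)) - y * (2 * a\<^sup>2 * (2 * y))) / (2 * a\<^sup>2 * (a\<^sup>2 + y\<^sup>2))\<^sup>2"
        unfolding power2_eq_square[of "2 * a\<^sup>2 * (a\<^sup>2 + y\<^sup>2)"] using a nz[of y]
        by (intro DERIV_divide) (auto intro!: derivative_eq_intros)
      show "DERIV (\<lambda>y. arctan (y / a)) y :> 1 / a * inverse (1 + (y / a)\<^sup>2)"
        by (rule DERIV_chain'[THEN DERIV_cong, OF DERIV_cdivide[OF DERIV_ident] DERIV_arctan]) simp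
    qed
    moreover have "(1 / a) * inverse (1 + (y / a)\<^sup>2) / (2 * a ^ 3) = 1 / (2 * a\<^sup>2 * (a\<^sup>2 + y\<^sup>2))"
      using a nz[of y] nz' by (simp add: divide_simps) (simp add: algebra_simps power_numeral_reduce)
    moreover have "(1 * (2 * a\<^sup>2 * (a\<^sup>2 + y\<^sup>2)) - y * (2 * a\<^sup>2 * (2 * y))) / (2 * a\<^sup>2 * (a\<^sup>2 + y\<^sup>2))\<^sup>2
        + 1 / (2 * a\<^sup>2 * (a\<^sup>2 + y\<^sup>2)) = 1 / (a\<^sup>2 + y\<^sup>2)\<^sup>2"
      using a nz[of y] by (simp add: divide_simps) (simp add: algebra_simps power_numeral_reduce)
    ultimately show ?thesis
      by simp
  qed
  moreover have "(F \<longlongrightarrow> pi / (4 * a ^ 3)) at_top"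
  proof -
    have "((\<lambda>y. y / (2 * a\<^sup>2 * (a\<^sup>2 + y\<^sup>2))) \<longlongrightarrow> 0) at_top" "((\<lambda>y. arctan (y / a)) \<longlongrightarrow> pi / 2) at_top"
      using a by real_asymp+
    then have "(F \<longlongrightarrow> 0 + pi / 2 / (2 * a ^ 3)) at_top"
      unfolding F_def using a by (intro tendsto_intros) auto
    then show ?thesis
      by simp
  qed
  ultimately have "(\<integral>\<^sup>+y. ennreal (1 / (a\<^sup>2 + y\<^sup>2)\<^sup>2) * indicator {0..} y \<partial>lborel) = ennreal (pi / (4 * a ^ 3) - F 0)"
    by (intro nn_integral_FTC_atLeast) auto
  then show ?thesis
    by (subst nn_integral_even) (auto simp: F_def ennreal_mult'[symmetric] simp flip: ennreal_numeral)
qed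

text \<open>With \<open>s = sqrt (1 + x^2)\<close> the inner Cartesian integral is
  \<open>pi / (2 * s^3)\<close>, and \<open>x / s\<close> is an antiderivative of
  \<open>1 / s^3\<close>. The value is the origin of the factor pi in the Cauchy-Pompeiu
  formula.\<close>

lemma nn_integral_one_plus_norm_square:
  "(\<integral>\<^sup>+u. ennreal (1 / (1 + (norm (u::complex))\<^sup>2)\<^sup>2) \<partial>lborel) = ennreal pi"
proof -
  define s where "s x = sqrt (1 + x\<^sup>2)" for x :: real
  have s: "s x > 0" "(s x)\<^sup>2 = 1 + x\<^sup>2" for x
    by (auto simp: s_def add_pos_nonneg)
  have [measurable]: "s \<in> borel_measurable borel"
    unfolding s_def by measurable
  have "(\<integral>\<^sup>+u. ennreal (1 / (1 + (norm (u::complex))\<^sup>2)\<^sup>2) \<partial>lborel) =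
      (\<integral>\<^sup>+x. \<integral>\<^sup>+y. ennreal (1 / ((s x)\<^sup>2 + y\<^sup>2)\<^sup>2) \<partial>lborel \<partial>lborel)"
    by (subst nn_integral_lborel_complex) (auto simp: s cmod_power2 add.assoc)
  also have "\<dots> = (\<integral>\<^sup>+x. ennreal (pi / 2) * ennreal (1 / s x ^ 3) \<partial>lborel)"
    using s(1) by (simp add: nn_integral_inverse_square_plus ennreal_mult'[symmetric])
  also have "\<dots> = ennreal (pi / 2) * (2 * (\<integral>\<^sup>+x. ennreal (1 / s x ^ 3) * indicator {0..} x \<partial>lborel))"
    by (subst nn_integral_cmult, simp, subst nn_integral_even) (auto simp: s_def)
  also have "(\<integral>\<^sup>+x. ennreal (1 / s x ^ 3) * indicator {0..} x \<partial>lborel) = ennreal (1 - 0 / s 0)"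
  proof (rule nn_integral_FTC_atLeast)
    show "DERIV (\<lambda>x. x / s x) x :> 1 / s x ^ 3" for x
    proof -
      have ds: "DERIV s x :> x / s x"
        unfolding s_def using s(1)[of x] unfolding s_def
        by (auto intro!: derivative_eq_intros simp: field_simps)
      have "DERIV (\<lambda>x. x / s x) x :> (1 * s x - x * (x / s x)) / (s x * s x)"
        using s(1)[of x] by (intro DERIV_divide DERIV_ident ds) auto
      moreover have "(1 * s x - x * (x / s x)) / (s x * s x) = ((s x)\<^sup>2 - x\<^sup>2) / s x ^ 3"
        using s(1)[of x] by (simp add: field_simps power2_eq_square power3_eq_cube)
      ultimately show ?thesis
        by (simp add: s(2))
    qed
    show "((\<lambda>x. x / s x) \<longlongrightarrow> 1) at_top"
      unfolding s_def by real_asymp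
  qed (use s in \<open>auto simp: less_imp_le\<close>)
  finally show ?thesis
    by (simp add: ennreal_mult'[symmetric] flip: ennreal_numeral)
qed

lemma integral_one_plus_norm_square:
  "integrable lborel (\<lambda>u::complex. 1 / (1 + (norm u)\<^sup>2)\<^sup>2)"
  "(\<integral>u. 1 / (1 + (norm (u::complex))\<^sup>2)\<^sup>2 \<partial>lborel) = pi"
  using nn_integral_one_plus_norm_square
  by (auto intro!: integrableI_nn_integral_finite simp: integral_eq_nn_integral)

text \<open>Stokes for compact support in its simplest form: each partial derivative is integrated
  first along its own direction, where the fundamental theorem leaves two end values outside the
  support.\<close>

lemma integral_dbar_eq_0:
  fixes \<psi> :: "complex \<Rightarrow> complex"
  assumes diff: "\<And>z. \<psi> differentiable (at z)"
    and cont: "\<And>v. continuous_on UNIV (\<lambda>z. frechet_derivative \<psi> (at z) v)"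
    and zero: "\<And>z. norm z \<ge> R \<Longrightarrow> \<psi> z = 0"
  shows "(\<integral>z. dbar \<psi> z \<partial>lborel) = 0"
proof -
  define g where "g v z = frechet_derivative \<psi> (at z) v" for v z
  have deriv: "(\<psi> has_derivative (\<lambda>v. g v z)) (at z)" for z
    using diff[of z] unfolding g_def frechet_derivative_works by simp
  have g_zero: "g v z = 0" if "norm z > R" for v z
  proof -
    have "((\<lambda>_. 0) has_derivative (\<lambda>_. 0)) (at z)"
      by simp
    then have "(\<psi> has_derivative (\<lambda>_. 0)) (at z)"
      by (rule has_derivative_transform_within_open[of _ _ _ _ "- cball 0 R"])
        (use that zero in \<open>auto simp: open_Compl\<close>)
    then show ?thesis
      using has_derivative_unique[OF deriv] by metis
  qed
  have int: "integrable lborel (g v)" for v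
  proof -
    have "integrable lborel (\<lambda>z. indicator (cball 0 R) z *\<^sub>R g v z)"
      using cont[of v] by (intro borel_integrable_compact)
        (auto simp: g_def intro: continuous_on_subset)
    also have "(\<lambda>z. indicator (cball 0 R) z *\<^sub>R g v z) = g v"
      using g_zero by (auto simp: indicator_def fun_eq_iff)
    finally show ?thesis .
  qed
  define S where "S = \<bar>R\<bar> + 1"
  \<comment> \<open>The premise says that the point with parameter \<open>t\<close> lies at distance
    at least \<open>\<bar>t\<bar>\<close> from 0, so the end points at parameters \<open>S\<close>
    and \<open>-S\<close> are outside the support. It holds for horizontal lines based on the
    imaginary axis and for vertical lines based on the real axis.\<close>
  have line: "(\<integral>t. g v (p + t *\<^sub>R v) \<partial>lborel) = 0"
    if v: "\<And>t. \<bar>t\<bar> \<le> norm (p + t *\<^sub>R v)" for p v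
  proof -
    have "(\<integral>t. g v (p + t *\<^sub>R v) \<partial>lborel) = (\<integral>t. indicator {-S..S} t *\<^sub>R g v (p + t *\<^sub>R v) \<partial>lborel)"
    proof (intro Bochner_Integration.integral_cong refl)
      fix t
      show "g v (p + t *\<^sub>R v) = indicator {-S..S} t *\<^sub>R g v (p + t *\<^sub>R v)"
        using v[of t] g_zero[of "p + t *\<^sub>R v" v]
        by (cases "t \<in> {-S..S}") (auto simp: S_def)
    qed
    also have "\<dots> = \<psi> (p + S *\<^sub>R v) - \<psi> (p + (- S) *\<^sub>R v)"
    proof (rule integral_FTC_atLeastAtMost)
      fix t
      have "((\<lambda>t. \<psi> (p + t *\<^sub>R v)) has_derivative (\<lambda>h. g (h *\<^sub>R v) (p + t *\<^sub>R v))) (at t within {-S..S})"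
        by (rule has_derivative_compose[OF _ deriv]) (auto intro!: derivative_eq_intros)
      moreover have "g (h *\<^sub>R v) z = h *\<^sub>R g v z" for h z
        using linear_frechet_derivative[OF diff[of z]] by (simp add: g_def linear_cmul)
      ultimately show "((\<lambda>t. \<psi> (p + t *\<^sub>R v)) has_vector_derivative g v (p + t *\<^sub>R v)) (at t within {-S..S})"
        by (simp add: has_vector_derivative_def)
    next
      show "continuous_on {-S..S} (\<lambda>t. g v (p + t *\<^sub>R v))"
        unfolding g_def by (intro continuous_on_compose2[OF cont]) (auto intro!: continuous_intros)
    qed (simp add: S_def)
    also have "\<dots> = 0"
      using v[of S] v[of "-S"] zero[of "p + S *\<^sub>R v"] zero[of "p + (- S) *\<^sub>R v"] by (simp add: S_def)
    finally show ?thesis .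
  qed
  have "(\<integral>z. g 1 z \<partial>lborel) = (\<integral>y. (\<integral>x. g 1 (Complex 0 y + x *\<^sub>R 1) \<partial>lborel) \<partial>lborel)"
    by (subst integral_lborel_complex(2)[OF int]) (simp add: Complex_eq algebra_simps scaleR_conv_of_real)
  also have "\<dots> = 0"
    using abs_Re_le_cmod[of "Complex 0 y + t *\<^sub>R 1" for y t] by (subst line) auto
  finally have x: "(\<integral>z. g 1 z \<partial>lborel) = 0" .
  have "(\<integral>z. g \<i> z \<partial>lborel) = (\<integral>x. (\<integral>y. g \<i> (Complex x 0 + y *\<^sub>R \<i>) \<partial>lborel) \<partial>lborel)"
    by (subst integral_lborel_complex(1)[OF int]) (simp add: Complex_eq algebra_simps scaleR_conv_of_real)
  also have "\<dots> = 0"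
    using abs_Im_le_cmod[of "Complex x 0 + t *\<^sub>R \<i>" for x t] by (subst line) auto
  finally have y: "(\<integral>z. g \<i> z \<partial>lborel) = 0" .
  have "(\<integral>z. dbar \<psi> z \<partial>lborel) = (\<integral>z. (g 1 z + \<i> * g \<i> z) / 2 \<partial>lborel)"
    by (simp add: dbar_def g_def)
  also have "\<dots> = 0"
    using int by (simp add: x y)
  finally show ?thesis .
qed

section \<open>The Cauchy-Pompeiu formula for test functions\<close>

lemma smooth_differentiable: "smooth g \<Longrightarrow> g differentiable (at x)"
  by (erule smooth.cases) simp

lemma smooth_frechet_derivative: "smooth g \<Longrightarrow> smooth (\<lambda>x. frechet_derivative g (at x) v)"
  by (erule smooth.cases) simp

lemma smooth_continuous_on: "smooth g \<Longrightarrow> continuous_on S g"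
  by (meson smooth_differentiable differentiable_imp_continuous_within continuous_at_imp_continuous_on)

text \<open>Differentiation commutes with a bounded linear map, so the functions of the form
  \<open>L\<close> after a smooth function are closed under directional derivatives, which is what
  coinduction asks for. Applied later to conjugation and to real and imaginary parts.\<close>

lemma smooth_bounded_linear:
  assumes L: "bounded_linear L" and g: "smooth g"
  shows "smooth (\<lambda>x. L (g x))"
proof -
  have "(\<exists>g. smooth g \<and> f = (\<lambda>x. L (g x))) \<Longrightarrow> smooth f" for f
  proof (coinduction arbitrary: f)
    case smooth
    then obtain g where g: "smooth g" and f: "f = (\<lambda>x. L (g x))"
      by blast
    have d: "(f has_derivative (\<lambda>h. L (frechet_derivative g (at x) h))) (at x)" for x
      unfolding f by (rule bounded_linear.has_derivative[OF L])
        (use smooth_differentiable[OF g] frechet_derivative_works in blast)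
    have "f differentiable (at x)" for x
      using d by (rule differentiableI)
    moreover have "(\<lambda>x. frechet_derivative f (at x) v) = (\<lambda>x. L (frechet_derivative g (at x) v))" for v
      using frechet_derivative_at[OF d] by (simp add: fun_eq_iff)
    ultimately show ?case
      using smooth_frechet_derivative[OF g] by blast
  qed
  then show ?thesis
    using g by blast
qed

lemma compact_subset_unit_disk:
  fixes K :: "complex set"
  assumes "compact K" "K \<subseteq> unit_disk"
  obtains R where "0 \<le> R" "R < 1" "K \<subseteq> cball 0 R"
proof (cases "K = {}")
  case True
  then show ?thesis
    using that[of 0] by auto
next
  case False
  then obtain x where x: "x \<in> K" "\<And>y. y \<in> K \<Longrightarrow> norm y \<le> norm x"
    using continuous_attains_sup[OF assms(1), of norm] by (auto intro: continuous_intros)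
  moreover have "norm x < 1"
    using x(1) assms(2) by auto
  ultimately show ?thesis
    by (intro that[of "norm x"]) auto
qed

lemma disk_testsE:
  assumes "\<phi> \<in> disk_tests"
  obtains R where "0 \<le> R" "R < 1" "\<And>z. R \<le> norm z \<Longrightarrow> \<phi> z = 0"
proof -
  obtain K where K: "compact K" "K \<subseteq> unit_disk" "\<And>z. z \<notin> K \<Longrightarrow> \<phi> z = 0"
    using assms by (auto simp: disk_tests_def)
  obtain R where R: "0 \<le> R" "R < 1" "K \<subseteq> cball 0 R"
    using K(1,2) by (rule compact_subset_unit_disk)
  \<comment> \<open>The compact set may touch the circle of radius \<open>R\<close>; a radius
    strictly between \<open>R\<close> and 1 gives vanishing under a non-strict inequality.\<close>
  have "\<phi> z = 0" if "(1 + R) / 2 \<le> norm z" for z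
    using that R K(3)[of z] by force
  then show ?thesis
    using R by (intro that[of "(1 + R) / 2"]) auto
qed

text \<open>Integration by parts: the product rule for \<open>dbar\<close> applied to
  \<open>\<phi> * G\<close>. As \<open>G\<close> is controlled only inside the disk, the product has
  to be continued across the circle by its vanishing outside the support of \<phi>.\<close>

lemma integral_dbar_mult:
  fixes \<phi> G :: "complex \<Rightarrow> complex"
  assumes \<phi>: "\<phi> \<in> disk_tests"
    and G: "\<And>z. z \<in> unit_disk \<Longrightarrow> (G has_derivative D z) (at z)"
    and D: "\<And>v. continuous_on unit_disk (\<lambda>z. D z v)"
  shows "(\<integral>z. dbar \<phi> z * G z + \<phi> z * ((D z 1 + \<i> * D z \<i>) / 2) \<partial>lborel) = 0"
proof -
  obtain R where R: "0 \<le> R" "R < 1" "\<And>z. R \<le> norm z \<Longrightarrow> \<phi> z = 0"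
    using disk_testsE[OF \<phi>] by blast
  have sm: "smooth \<phi>"
    using \<phi> by (simp add: disk_tests_def)
  define \<psi> where "\<psi> z = \<phi> z * G z" for z
  define d where "d z v = \<phi> z * D z v + frechet_derivative \<phi> (at z) v * G z" for z v
  have \<phi>': "(\<phi> has_derivative frechet_derivative \<phi> (at z)) (at z)" for z
    using smooth_differentiable[OF sm] frechet_derivative_works by blast
  \<comment> \<open>Off the support the product is zero on an open set, whatever \<open>G\<close>
    does there, and the formal product-rule derivative \<open>d z\<close> is zero as well since
    \<phi> and its derivative vanish.\<close>
  have out: "(\<psi> has_derivative (\<lambda>_. 0)) (at z) \<and> d z = (\<lambda>_. 0)" if "norm z > R" for z
  proof -
    have 0: "((\<lambda>_. 0 :: complex) has_derivative (\<lambda>_. 0)) (at z)"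
      by simp
    have "(f has_derivative (\<lambda>_. 0)) (at z)" if "\<And>z. norm z > R \<Longrightarrow> f z = 0" for f :: "complex \<Rightarrow> complex"
      using has_derivative_transform_within_open[OF 0, of "- cball 0 R" f] that \<open>norm z > R\<close>
      by (simp add: open_Compl)
    from this[of \<phi>] this[of \<psi>] show ?thesis
      using R(3) has_derivative_unique[OF \<phi>'] that
      by (fastforce simp: \<psi>_def d_def fun_eq_iff)
  qed
  have \<psi>': "(\<psi> has_derivative d z) (at z)" for z
  proof (cases "norm z < 1")
    case True
    then have "(G has_derivative D z) (at z)"
      by (intro G) simp
    then show ?thesis
      unfolding \<psi>_def d_def[abs_def] by (rule has_derivative_mult[OF \<phi>'])
  next
    case False
    then show ?thesis
      using out[of z] R(2) by auto
  qed
  have fd: "frechet_derivative \<psi> (at z) = d z" for z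
    using frechet_derivative_at[OF \<psi>'] by simp
  \<comment> \<open>Continuity of \<open>d\<close> on the whole plane is glued from two open sets,
    the disk and the exterior of \<open>cball 0 R\<close>; they cover because
    \<open>R < 1\<close>.\<close>
  have "continuous_on unit_disk (\<lambda>z. d z v)" for v
  proof -
    have "continuous_on unit_disk G"
      using G by (intro differentiable_imp_continuous_on)
        (auto simp: differentiable_on_def differentiable_def; metis G has_derivative_at_withinI mem_ball_0)
    then show ?thesis
      unfolding d_def
      by (intro continuous_on_add continuous_on_mult D smooth_continuous_on[OF sm]
          smooth_continuous_on[OF smooth_frechet_derivative[OF sm]])
  qed
  moreover have "continuous_on (- cball 0 R) (\<lambda>z. d z v)" for v
    by (rule continuous_on_eq[of _ "\<lambda>_. 0"]) (use out in auto)
  ultimately have "continuous_on (unit_disk \<union> - cball 0 R) (\<lambda>z. d z v)" for v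
    by (intro continuous_on_open_Un) auto
  moreover have "unit_disk \<union> - cball 0 R = (UNIV :: complex set)"
    using R(2) by auto
  ultimately have "(\<integral>z. dbar \<psi> z \<partial>lborel) = 0"
    using \<psi>' R(3) by (intro integral_dbar_eq_0[where R=R])
      (auto simp: fd differentiable_def \<psi>_def)
  moreover have "dbar \<psi> z = dbar \<phi> z * G z + \<phi> z * ((D z 1 + \<i> * D z \<i>) / 2)" for z
    by (simp add: dbar_def fd d_def algebra_simps add_divide_distrib)
  ultimately show ?thesis
    by simp
qed

lemma dbar_disk_test:
  assumes "\<phi> \<in> disk_tests"
  shows "continuous_on S (dbar \<phi>)"
    and "\<exists>R. 0 \<le> R \<and> R < 1 \<and> (\<forall>z. R < norm z \<longrightarrow> dbar \<phi> z = 0)"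
    and "\<exists>B. \<forall>z. norm (dbar \<phi> z) \<le> B"
proof -
  have sm: "smooth \<phi>"
    using assms by (simp add: disk_tests_def)
  show c: "continuous_on S (dbar \<phi>)" for S
    unfolding dbar_def by (intro continuous_intros smooth_continuous_on[OF smooth_frechet_derivative[OF sm]]) auto
  obtain R where R: "0 \<le> R" "R < 1" "\<And>z. R \<le> norm z \<Longrightarrow> \<phi> z = 0"
    using disk_testsE[OF assms] by blast
  have z: "dbar \<phi> z = 0" if "R < norm z" for z
  proof -
    have "((\<lambda>_. 0) has_derivative (\<lambda>_. 0)) (at z)"
      by simp
    then have "(\<phi> has_derivative (\<lambda>_. 0)) (at z)"
      by (rule has_derivative_transform_within_open[of _ _ _ _ "- cball 0 R"])
        (use that R in \<open>auto simp: open_Compl\<close>)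
    then show ?thesis
      by (simp add: dbar_eq)
  qed
  then show "\<exists>R. 0 \<le> R \<and> R < 1 \<and> (\<forall>z. R < norm z \<longrightarrow> dbar \<phi> z = 0)"
    using R by blast
  have "bounded (dbar \<phi> ` cball 0 R)"
    using c by (intro compact_imp_bounded compact_continuous_image) auto
  then obtain B where B: "\<And>z. z \<in> cball 0 R \<Longrightarrow> norm (dbar \<phi> z) \<le> B"
    unfolding bounded_iff by blast
  have "norm (dbar \<phi> z) \<le> max B 0" for z
    using B[of z] z[of z] by (cases "norm z \<le> R") auto
  then show "\<exists>B. \<forall>z. norm (dbar \<phi> z) \<le> B"
    by blast
qed

text \<open>A complex-linear derivative \<open>D\<close> satisfies
  \<open>D 1 + \<i> * D \<i> = 0\<close>, so integration by parts leaves no second term. Used for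
  the holomorphic summand of \<open>w\<close> and for the reflected kernel.\<close>

lemma integral_dbar_mult_holomorphic:
  assumes \<phi>: "\<phi> \<in> disk_tests" and g: "g holomorphic_on unit_disk"
  shows "(\<integral>z. dbar \<phi> z * g z \<partial>lborel) = 0"
proof -
  have "(g has_derivative (\<lambda>h. deriv g z * h)) (at z)" if "z \<in> unit_disk" for z
    using holomorphic_derivI[OF g _ that] by (simp add: has_field_derivative_def)
  moreover have "continuous_on unit_disk (\<lambda>z. deriv g z * v)" for v
    using g by (intro continuous_intros holomorphic_on_imp_continuous_on holomorphic_deriv) auto
  ultimately have "(\<integral>z. dbar \<phi> z * g z +
      \<phi> z * ((deriv g z * 1 + \<i> * (deriv g z * \<i>)) / 2) \<partial>lborel) = 0"
    by (rule integral_dbar_mult[OF \<phi>])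
  moreover have "deriv g z * 1 + \<i> * (deriv g z * \<i>) = 0" for z
    by (simp add: algebra_simps)
  ultimately show ?thesis
    by simp
qed

lemma integrable_dbar_cauchy_kernel:
  assumes \<phi>: "\<phi> \<in> disk_tests"
  shows "integrable lborel (\<lambda>z. dbar \<phi> z * (1 / (\<zeta> - z)))"
    and "\<exists>B. \<forall>\<zeta>. (\<integral>\<^sup>+z. norm (dbar \<phi> z * (1 / (\<zeta> - z))) \<partial>lborel) \<le> ennreal B"
proof -
  obtain B where B: "\<And>z. norm (dbar \<phi> z) \<le> B"
    using dbar_disk_test(3)[OF \<phi>] by blast
  then have B0: "0 \<le> B"
    using norm_ge_zero order_trans by blast
  obtain R where R: "R < 1" "\<And>z. R < norm z \<Longrightarrow> dbar \<phi> z = 0"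
    using dbar_disk_test(2)[OF \<phi>] by blast
  have [measurable]: "dbar \<phi> \<in> borel_measurable borel"
    by (intro borel_measurable_continuous_onI dbar_disk_test(1)[OF \<phi>])
  have [measurable]: "unit_disk \<in> sets borel"
    by simp
  have le: "(\<integral>\<^sup>+z. norm (dbar \<phi> z * (1 / (\<zeta> - z))) \<partial>lborel) \<le> ennreal (B * 36)" for \<zeta>
  proof -
    have "(\<integral>\<^sup>+z. norm (dbar \<phi> z * (1 / (\<zeta> - z))) \<partial>lborel) \<le>
        (\<integral>\<^sup>+z. ennreal B * (ennreal (norm (1 / (\<zeta> - z))) * indicator unit_disk z) \<partial>lborel)"
    proof (rule nn_integral_mono)
      fix z
      have "norm (dbar \<phi> z * (1 / (\<zeta> - z))) \<le> B * norm (1 / (\<zeta> - z))"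
        unfolding norm_mult by (intro mult_right_mono B) auto
      then show "ennreal (norm (dbar \<phi> z * (1 / (\<zeta> - z)))) \<le>
          ennreal B * (ennreal (norm (1 / (\<zeta> - z))) * indicator unit_disk z)"
        using B0 R by (cases "z \<in> unit_disk") (auto simp: ennreal_mult'[symmetric] intro!: ennreal_leI)
    qed
    also have "\<dots> \<le> ennreal B * ennreal 36"
      by (subst nn_integral_cmult) (auto simp del: ennreal_numeral intro!: mult_left_mono nn_integral_cauchy_kernel)
    finally show ?thesis
      using B0 by (simp add: ennreal_mult')
  qed
  then show "\<exists>B. \<forall>\<zeta>. (\<integral>\<^sup>+z. norm (dbar \<phi> z * (1 / (\<zeta> - z))) \<partial>lborel) \<le> ennreal B"
    by blast
  show "integrable lborel (\<lambda>z. dbar \<phi> z * (1 / (\<zeta> - z)))"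
    using le[of \<zeta>] by (intro integrableI_bounded) (auto intro: order.strict_trans1)
qed

text \<open>The kernel \<open>1/(z - \<zeta>)\<close> is approximated by the smooth functions
  \<open>cnj (z - \<zeta>) / (\<bar>z - \<zeta>\<bar>\<^sup>2 + e\<^sup>2)\<close>, whose \<open>\<partial>/\<partial>z\<bar>\<close> is \<open>e\<^sup>2 / (\<bar>z - \<zeta>\<bar>\<^sup>2 + e\<^sup>2)\<^sup>2\<close>, an approximate identity
  of total mass \<open>\<pi>\<close>.\<close>

lemma integral_dbar_regularized_kernel:
  assumes \<phi>: "\<phi> \<in> disk_tests" and e: "e > 0"
  shows "(\<integral>z. dbar \<phi> z * (cnj (z - \<zeta>) / of_real ((norm (z - \<zeta>))\<^sup>2 + e\<^sup>2)) \<partial>lborel) =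
    - (\<integral>u. \<phi> (\<zeta> + e *\<^sub>R u) * of_real (1 / (1 + (norm u)\<^sup>2)\<^sup>2) \<partial>lborel)"
    (is "(\<integral>z. dbar \<phi> z * ?G z \<partial>lborel) = - ?I")
proof -
  define den where "den z = complex_of_real ((norm (z - \<zeta>))\<^sup>2 + e\<^sup>2)" for z
  have den_eq: "den z = (z - \<zeta>) * cnj (z - \<zeta>) + of_real (e\<^sup>2)" for z
    unfolding den_def of_real_add complex_norm_square by simp
  have den_nz: "den z \<noteq> 0" for z
    unfolding den_def using e by (metis add_nonneg_pos less_irrefl of_real_eq_0_iff zero_le_power2 zero_less_power)
  define D where "D z h = (cnj h * den z - cnj (z - \<zeta>) * (h * cnj (z - \<zeta>) + (z - \<zeta>) * cnj h)) / (den z)\<^sup>2" for z h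
  have G': "(?G has_derivative D z) (at z)" for z
  proof -
    have "(den has_derivative (\<lambda>h. h * cnj (z - \<zeta>) + (z - \<zeta>) * cnj h)) (at z)"
      unfolding den_eq by (auto intro!: derivative_eq_intros simp: algebra_simps)
    moreover have "((\<lambda>z. cnj (z - \<zeta>)) has_derivative cnj) (at z)"
      by (auto intro!: derivative_eq_intros)
    ultimately have "((\<lambda>z. cnj (z - \<zeta>) / den z) has_derivative
       (\<lambda>h. (cnj h * den z - cnj (z - \<zeta>) * (h * cnj (z - \<zeta>) + (z - \<zeta>) * cnj h)) / (den z * den z))) (at z)"
      using den_nz by (intro has_derivative_divide') auto
    then show ?thesis
      by (simp add: D_def[abs_def] den_def power2_eq_square)
  qed
  have "continuous_on unit_disk (\<lambda>z. D z v)" for v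
    unfolding D_def using den_nz by (auto simp: den_def intro!: continuous_intros)
  then have 0: "(\<integral>z. dbar \<phi> z * ?G z + \<phi> z * ((D z 1 + \<i> * D z \<i>) / 2) \<partial>lborel) = 0"
    by (intro integral_dbar_mult \<phi> G')
  have D: "(D z 1 + \<i> * D z \<i>) / 2 = of_real (e\<^sup>2 / ((norm (z - \<zeta>))\<^sup>2 + e\<^sup>2)\<^sup>2)" for z
  proof -
    have "D z 1 + \<i> * D z \<i> = (2 * den z - 2 * ((z - \<zeta>) * cnj (z - \<zeta>))) / (den z)\<^sup>2"
      unfolding D_def by (simp add: add_divide_distrib[symmetric] algebra_simps)
    also have "\<dots> = 2 * of_real (e\<^sup>2) / (den z)\<^sup>2"
      by (simp add: den_eq)
    finally show ?thesis
      by (simp add: den_def)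
  qed
  obtain R where R: "R < 1" "\<And>z. R \<le> norm z \<Longrightarrow> \<phi> z = 0" "\<And>z. R < norm z \<Longrightarrow> dbar \<phi> z = 0"
  proof -
    obtain R1 R2 where "R1 < 1" "\<And>z. R1 \<le> norm z \<Longrightarrow> \<phi> z = 0"
      and "R2 < 1" "\<And>z. R2 < norm z \<Longrightarrow> dbar \<phi> z = 0"
      using disk_testsE[OF \<phi>] dbar_disk_test(2)[OF \<phi>] by metis
    then show ?thesis
      by (intro that[of "max R1 R2"]) auto
  qed
  have sm: "smooth \<phi>"
    using \<phi> by (simp add: disk_tests_def)
  have [measurable]: "\<phi> \<in> borel_measurable borel"
    by (intro borel_measurable_continuous_onI smooth_continuous_on sm)
  have int: "integrable lborel f"
    if "continuous_on UNIV f" "\<And>z. R < norm z \<Longrightarrow> f z = 0" for f :: "complex \<Rightarrow> complex"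
  proof -
    have "integrable lborel (\<lambda>z. indicator (cball 0 R) z *\<^sub>R f z)"
      using that(1) by (intro borel_integrable_compact) (auto intro: continuous_on_subset)
    also have "(\<lambda>z. indicator (cball 0 R) z *\<^sub>R f z) = f"
      using that(2) by (auto simp: fun_eq_iff indicator_def)
    finally show ?thesis .
  qed
  let ?P = "\<lambda>z. \<phi> z * of_real (e\<^sup>2 / ((norm (z - \<zeta>))\<^sup>2 + e\<^sup>2)\<^sup>2)"
  have nz: "(norm (z - \<zeta>))\<^sup>2 + e\<^sup>2 \<noteq> 0" for z
    using den_nz[of z] unfolding den_def by (metis of_real_0)
  have "integrable lborel (\<lambda>z. dbar \<phi> z * ?G z)"
  proof (rule int)
    have "continuous_on UNIV ?G"
      using nz by (intro continuous_intros) (metis of_real_eq_0_iff)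
    then show "continuous_on UNIV (\<lambda>z. dbar \<phi> z * ?G z)"
      by (intro continuous_on_mult dbar_disk_test(1)[OF \<phi>])
  qed (use R in auto)
  moreover have "integrable lborel ?P"
  proof (rule int)
    show "continuous_on UNIV ?P"
      using nz by (intro continuous_intros smooth_continuous_on sm) auto
  qed (use R in auto)
  ultimately have "(\<integral>z. dbar \<phi> z * ?G z \<partial>lborel) = - (\<integral>z. ?P z \<partial>lborel)"
    using 0 unfolding D by (simp add: Bochner_Integration.integral_add eq_neg_iff_add_eq_0)
  \<comment> \<open>The substitution \<open>z = \<zeta> + e *\<^sub>R u\<close> has Jacobian
    \<open>e^2\<close>, the plane having real dimension 2; this turns the approximate identity into
    a fixed weight of mass pi.\<close>
  also have "(\<integral>z. ?P z \<partial>lborel) = (\<integral>u. e\<^sup>2 *\<^sub>R ?P (\<zeta> + e *\<^sub>R u) \<partial>lborel)"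
    using e by (subst lborel_affine[of e \<zeta>]) (simp_all add: integral_density integral_distr)
  also have "\<dots> = ?I"
  proof (rule Bochner_Integration.integral_cong[OF refl])
    fix u :: complex
    have nz: "1 + (norm u)\<^sup>2 \<noteq> 0"
      by (metis add_pos_nonneg less_irrefl zero_le_power2 zero_less_one)
    have "e\<^sup>2 * (e\<^sup>2 / ((e * norm u)\<^sup>2 + e\<^sup>2)\<^sup>2) = e\<^sup>2 * e\<^sup>2 / (e\<^sup>2 * e\<^sup>2 * (1 + (norm u)\<^sup>2)\<^sup>2)"
      by (simp add: power2_eq_square algebra_simps)
    also have "\<dots> = 1 / (1 + (norm u)\<^sup>2)\<^sup>2"
      using e nz by simp
    finally have "of_real (e\<^sup>2 * (e\<^sup>2 / ((e * norm u)\<^sup>2 + e\<^sup>2)\<^sup>2)) = (of_real (1 / (1 + (norm u)\<^sup>2)\<^sup>2) :: complex)"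
      by simp
    moreover have "e\<^sup>2 *\<^sub>R ?P (\<zeta> + e *\<^sub>R u) = \<phi> (\<zeta> + e *\<^sub>R u) *
        of_real (e\<^sup>2 * (e\<^sup>2 / ((norm (\<zeta> + e *\<^sub>R u - \<zeta>))\<^sup>2 + e\<^sup>2)\<^sup>2))"
      by (simp only: scaleR_conv_of_real of_real_mult mult.left_commute)
    moreover have "norm (\<zeta> + e *\<^sub>R u - \<zeta>) = e * norm u"
      using e by simp
    ultimately show "e\<^sup>2 *\<^sub>R ?P (\<zeta> + e *\<^sub>R u) = \<phi> (\<zeta> + e *\<^sub>R u) * of_real (1 / (1 + (norm u)\<^sup>2)\<^sup>2)"
      by (simp only:)
  qed
  finally show ?thesis .
qed

text \<open>The regularized identity is passed to the limit on both sides. On the left the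
  regularized kernels are dominated by the Cauchy kernel itself, on the right by a bound of \<phi>
  times the fixed weight; the minus signs come from \<open>1 / (z - \<zeta>)\<close> against
  \<open>1 / (\<zeta> - z)\<close>.\<close>

theorem cauchy_pompeiu_disk_test:
  assumes \<phi>: "\<phi> \<in> disk_tests"
  shows "(\<integral>z. dbar \<phi> z * (1 / (\<zeta> - z)) \<partial>lborel) = of_real pi * \<phi> \<zeta>"
proof -
  let ?G = "\<lambda>e z. cnj (z - \<zeta>) / of_real ((norm (z - \<zeta>))\<^sup>2 + e\<^sup>2)"
  let ?J = "\<lambda>u. of_real (1 / (1 + (norm (u::complex))\<^sup>2)\<^sup>2) :: complex"
  define e where "e n = 1 / real (Suc n)" for n
  have e: "e n > 0" for n
    by (simp add: e_def)
  have e0: "e \<longlonglongrightarrow> 0"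
    unfolding e_def by (rule LIMSEQ_Suc[OF lim_1_over_n])
  have sm: "smooth \<phi>"
    using \<phi> by (simp add: disk_tests_def)
  have [measurable]: "\<phi> \<in> borel_measurable borel" "dbar \<phi> \<in> borel_measurable borel"
    by (intro borel_measurable_continuous_onI smooth_continuous_on sm dbar_disk_test(1)[OF \<phi>])+
  obtain R where R: "0 \<le> R" "\<And>z. R \<le> norm z \<Longrightarrow> \<phi> z = 0"
    using disk_testsE[OF \<phi>] by metis
  have "bounded (\<phi> ` cball 0 R)"
    by (intro compact_imp_bounded compact_continuous_image smooth_continuous_on sm) auto
  then obtain B where B: "\<And>z. z \<in> cball 0 R \<Longrightarrow> norm (\<phi> z) \<le> B"
    unfolding bounded_iff by blast
  then have B: "norm (\<phi> z) \<le> max B 0" for z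
  proof (cases "norm z \<le> R")
    case True
    then show ?thesis
      using B[of z] by (simp add: le_max_iff_disj)
  next
    case False
    then show ?thesis
      using R(2)[of z] by simp
  qed
  have lim: "(\<lambda>n. \<integral>z. dbar \<phi> z * ?G (e n) z \<partial>lborel) \<longlonglongrightarrow> (\<integral>z. - (dbar \<phi> z * (1 / (\<zeta> - z))) \<partial>lborel)"
  proof (rule integral_dominated_convergence[where w="\<lambda>z. norm (dbar \<phi> z * (1 / (\<zeta> - z)))"])
    show "integrable lborel (\<lambda>z. norm (dbar \<phi> z * (1 / (\<zeta> - z))))"
      by (intro integrable_norm integrable_dbar_cauchy_kernel \<phi>)
    show "AE z in lborel. (\<lambda>n. dbar \<phi> z * ?G (e n) z) \<longlonglongrightarrow> - (dbar \<phi> z * (1 / (\<zeta> - z)))"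
    proof (rule eventually_mono[OF AE_lborel_singleton[of \<zeta>]])
      fix z assume z: "z \<noteq> \<zeta>"
      have "(\<lambda>n. dbar \<phi> z * ?G (e n) z) \<longlonglongrightarrow> dbar \<phi> z * ?G 0 z"
        using z by (intro tendsto_intros e0) auto
      moreover have "?G 0 z = - (1 / (\<zeta> - z))"
      proof -
        have "of_real ((norm (z - \<zeta>))\<^sup>2 + 0\<^sup>2) = (z - \<zeta>) * cnj (z - \<zeta>)"
          using complex_norm_square[of "z - \<zeta>"] by simp
        then show ?thesis
          using z by (simp add: divide_simps)
      qed
      ultimately show "(\<lambda>n. dbar \<phi> z * ?G (e n) z) \<longlonglongrightarrow> - (dbar \<phi> z * (1 / (\<zeta> - z)))"
        by (simp only: mult_minus_right)
    qed
    show "AE z in lborel. norm (dbar \<phi> z * ?G (e n) z) \<le> norm (dbar \<phi> z * (1 / (\<zeta> - z)))" for n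
    proof (rule AE_I2)
      fix z
      have "norm (?G (e n) z) \<le> norm (1 / (\<zeta> - z))"
      proof (cases "z = \<zeta>")
        case False
        have "norm (?G (e n) z) = norm (z - \<zeta>) / ((norm (z - \<zeta>))\<^sup>2 + (e n)\<^sup>2)"
          unfolding norm_divide norm_of_real by (subst abs_of_nonneg) (auto simp flip: complex_cnj_diff)
        also have "\<dots> \<le> norm (z - \<zeta>) / (norm (z - \<zeta>))\<^sup>2"
          using False by (intro divide_left_mono mult_pos_pos add_pos_nonneg) auto
        also have "\<dots> = norm (1 / (\<zeta> - z))"
          using False by (simp add: norm_divide power2_eq_square norm_minus_commute)
        finally show ?thesis .
      qed simp
      then show "norm (dbar \<phi> z * ?G (e n) z) \<le> norm (dbar \<phi> z * (1 / (\<zeta> - z)))"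
        unfolding norm_mult by (rule mult_left_mono) simp
    qed
  qed measurable
  have lim': "(\<lambda>n. - (\<integral>u. \<phi> (\<zeta> + e n *\<^sub>R u) * ?J u \<partial>lborel)) \<longlonglongrightarrow> - (\<integral>u. \<phi> \<zeta> * ?J u \<partial>lborel)"
  proof (rule tendsto_minus, rule integral_dominated_convergence[where w="\<lambda>u::complex. max B 0 * (1 / (1 + (norm u)\<^sup>2)\<^sup>2)"])
    show "integrable lborel (\<lambda>u::complex. max B 0 * (1 / (1 + (norm u)\<^sup>2)\<^sup>2))"
      by (intro integrable_mult_right integral_one_plus_norm_square)
    show "AE u in lborel. (\<lambda>n. \<phi> (\<zeta> + e n *\<^sub>R u) * ?J u) \<longlonglongrightarrow> \<phi> \<zeta> * ?J u"
    proof (intro AE_I2 tendsto_mult tendsto_const)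
      fix u
      have "(\<lambda>n. \<zeta> + e n *\<^sub>R u) \<longlonglongrightarrow> \<zeta> + 0 *\<^sub>R u"
        by (intro tendsto_intros e0)
      then show "(\<lambda>n. \<phi> (\<zeta> + e n *\<^sub>R u)) \<longlonglongrightarrow> \<phi> \<zeta>"
        using continuous_on_tendsto_compose[OF smooth_continuous_on[OF sm, of UNIV]] by simp
    qed
    show "AE u in lborel. norm (\<phi> (\<zeta> + e n *\<^sub>R u) * ?J u) \<le> max B 0 * (1 / (1 + (norm u)\<^sup>2)\<^sup>2)" for n
      unfolding norm_mult norm_of_real by (intro AE_I2 mult_mono B) auto
  qed measurable
  have "(\<integral>z. - (dbar \<phi> z * (1 / (\<zeta> - z))) \<partial>lborel) = - (\<integral>u. \<phi> \<zeta> * ?J u \<partial>lborel)"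
    using lim unfolding integral_dbar_regularized_kernel[OF \<phi> e] by (rule LIMSEQ_unique[OF _ lim'])
  also have "(\<integral>u. \<phi> \<zeta> * ?J u \<partial>lborel) = of_real pi * \<phi> \<zeta>"
    by (simp only: integral_mult_right_zero integral_complex_of_real
        integral_one_plus_norm_square mult.commute)
  finally show ?thesis
    by simp
qed

section \<open>Test functions on the circle and the Poisson integral\<close>

lemma norm_cis_minus_1_ge:
  assumes "\<bar>x\<bar> \<le> pi"
  shows "\<bar>x\<bar> \<le> 2 * norm (cis x - 1)"
proof -
  define y where "y = x / 2"
  \<comment> \<open>1.6 exceeds pi/2, and 1.6^2 / 6 is below 1/2, so the cubic Taylor remainder of
    the sine takes away at most half of \<open>\<bar>y\<bar>\<close>.\<close>
  have y: "\<bar>y\<bar> \<le> 1.6"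
    using assms pi_approx by (simp add: y_def)
  have "\<bar>sin y - y\<bar> \<le> \<bar>y\<bar> ^ 3 / 6"
    using Maclaurin_sin_bound[of y 3] by (simp add: eval_nat_numeral sin_coeff_def field_simps)
  also have "\<dots> = \<bar>y\<bar> * \<bar>y\<bar>\<^sup>2 / 6"
    by (simp add: eval_nat_numeral)
  also have "\<dots> \<le> \<bar>y\<bar> * 1.6\<^sup>2 / 6"
    using y by (intro divide_right_mono mult_left_mono power_mono) auto
  also have "\<dots> \<le> \<bar>y\<bar> / 2"
    by (simp add: power2_eq_square)
  finally have "\<bar>y\<bar> / 2 \<le> \<bar>sin y\<bar>"
    by linarith
  moreover have "norm (cis x - 1) = 2 * \<bar>sin y\<bar>"
    using dist_exp_i_1[of x] by (simp add: cis_conv_exp y_def)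
  ultimately show ?thesis
    by (simp add: y_def)
qed

text \<open>Subtracting the nearest multiple of 2 pi leaves an angle of at most a half turn, where
  arc and chord are comparable. The first estimate alone also serves to reduce periodic functions to
  one period.\<close>

lemma cis_chord:
  obtains k :: int where "\<bar>x - 2 * pi * k\<bar> \<le> pi" "\<bar>x - 2 * pi * k\<bar> \<le> 2 * norm (cis x - 1)"
proof -
  define k where "k = round (x / (2 * pi))"
  have "\<bar>x / (2 * pi) - k\<bar> \<le> 1 / 2"
    using of_int_round_abs_le[of "x / (2 * pi)"] by (simp add: k_def abs_minus_commute)
  then have "\<bar>x / (2 * pi) - k\<bar> * (2 * pi) \<le> 1 / 2 * (2 * pi)"
    by (intro mult_right_mono) auto
  also have "\<bar>x / (2 * pi) - k\<bar> * (2 * pi) = \<bar>x - 2 * pi * k\<bar>"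
    using abs_mult[of "x / (2 * pi) - k" "2 * pi"] by (simp add: algebra_simps)
  finally have le: "\<bar>x - 2 * pi * k\<bar> \<le> pi"
    by simp
  moreover have "cis (x - 2 * pi * k) = cis x"
    by (simp add: cis_divide[symmetric] cis_multiple_2pi)
  ultimately show ?thesis
    using norm_cis_minus_1_ge[OF le] that by metis
qed

lemma norm_cis_diff: "norm (cis s - cis t) = norm (cis (s - t) - 1)"
proof -
  have "cis s - cis t = cis t * (cis (s - t) - 1)"
    by (simp add: algebra_simps cis_mult)
  then show ?thesis
    by (simp add: norm_mult)
qed

lemma circle_test_periodic:
  assumes "\<phi> \<in> circle_tests"
  shows "\<phi> (t + 2 * pi * of_int k) = \<phi> t"
proof -
  interpret periodic_fun_simple \<phi> "2 * pi"
    using assms by unfold_locales (simp add: circle_tests_def)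
  show ?thesis
    using plus_of_int[of t k] by (simp add: mult.commute)
qed

lemma circle_test_continuous: "\<phi> \<in> circle_tests \<Longrightarrow> continuous_on S \<phi>"
  by (simp add: circle_tests_def smooth_continuous_on)

lemma circle_test_bounded:
  assumes \<phi>: "\<phi> \<in> circle_tests"
  obtains B where "0 \<le> B" "\<And>t. norm (\<phi> t) \<le> B"
proof -
  have "bounded (\<phi> ` {-pi..pi})"
    by (intro compact_imp_bounded compact_continuous_image circle_test_continuous \<phi>) auto
  then obtain B where B: "\<And>t. t \<in> {-pi..pi} \<Longrightarrow> norm (\<phi> t) \<le> B"
    unfolding bounded_iff by blast
  have le: "norm (\<phi> t) \<le> B" for t
  proof -
    obtain k :: int where "\<bar>t - 2 * pi * k\<bar> \<le> pi"
      using cis_chord by metis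
    then show ?thesis
      using B[of "t - 2 * pi * k"] circle_test_periodic[OF \<phi>, of "t - 2 * pi * k" k]
      by (auto simp: abs_le_iff)
  qed
  then show ?thesis
    using that[of B] order_trans[OF norm_ge_zero le[of 0]] by blast
qed

text \<open>The estimate is in the chord and not in the angle, since the Cauchy kernel sees an angle
  only through \<open>cis\<close>. The factor 2 between arc and chord doubles the bound of the
  derivative.\<close>

lemma circle_test_lipschitz:
  assumes \<phi>: "\<phi> \<in> circle_tests"
  obtains L where "0 \<le> L" "\<And>s t. norm (\<phi> s - \<phi> t) \<le> L * norm (cis s - cis t)"
proof -
  have sm: "smooth \<phi>"
    using \<phi> by (simp add: circle_tests_def)
  let ?d = "\<lambda>x. frechet_derivative \<phi> (at x)"
  \<comment> \<open>Below, \<open>b\<close> is reduced to [-pi, pi] and \<open>a\<close> is within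
    pi of \<open>b\<close>, so two periods around 0 contain both points.\<close>
  have "bounded ((\<lambda>x. ?d x 1) ` {-2*pi..2*pi})"
    by (intro compact_imp_bounded compact_continuous_image smooth_continuous_on smooth_frechet_derivative sm) auto
  then obtain M where M: "\<And>x. x \<in> {-2*pi..2*pi} \<Longrightarrow> norm (?d x 1) \<le> M"
    unfolding bounded_iff by blast
  have M0: "0 \<le> M"
    using M[of 0] by (intro order_trans[OF norm_ge_zero]) auto
  have lip: "norm (\<phi> a - \<phi> b) \<le> M * norm (a - b)" if "a \<in> {-2*pi..2*pi}" "b \<in> {-2*pi..2*pi}" for a b
  proof (rule differentiable_bound[where f' = ?d, OF _ _ _ that])
    fix x assume x: "x \<in> {-2*pi..2*pi}"
    have d: "(\<phi> has_derivative ?d x) (at x)"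
      using smooth_differentiable[OF sm] frechet_derivative_works by blast
    then show "(\<phi> has_derivative ?d x) (at x within {-2*pi..2*pi})"
      by (rule has_derivative_at_withinI)
    have "?d x h = h *\<^sub>R ?d x 1" for h
      using linear_cmul[OF has_derivative_linear[OF d], of h 1] by simp
    then show "onorm (?d x) \<le> M"
      using M[OF x] by (intro onorm_le) (metis mult.commute mult_right_mono norm_ge_zero norm_scaleR real_norm_def)
  qed auto
  have "norm (\<phi> s - \<phi> t) \<le> (2 * M) * norm (cis s - cis t)" for s t
  proof -
    obtain k :: int where k: "\<bar>s - t - 2 * pi * k\<bar> \<le> pi" "\<bar>s - t - 2 * pi * k\<bar> \<le> 2 * norm (cis (s - t) - 1)"
      using cis_chord by metis
    obtain m :: int where m: "\<bar>t - 2 * pi * m\<bar> \<le> pi"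
      using cis_chord by metis
    define b where "b = t - 2 * pi * m"
    define a where "a = b + (s - t - 2 * pi * k)"
    have "\<phi> t = \<phi> b"
      using circle_test_periodic[OF \<phi>, of b m] by (simp add: b_def)
    moreover have "\<phi> s = \<phi> a"
      using circle_test_periodic[OF \<phi>, of a "m + k"] by (simp add: a_def b_def algebra_simps)
    moreover have "norm (\<phi> a - \<phi> b) \<le> M * norm (a - b)"
      using m k by (intro lip) (auto simp: a_def b_def abs_le_iff)
    moreover have "M * norm (a - b) \<le> M * (2 * norm (cis (s - t) - 1))"
      using M0 k(2) by (intro mult_left_mono) (auto simp: a_def)
    ultimately show ?thesis
      by (simp add: norm_cis_diff)
  qed
  then show ?thesis
    using that[of "2 * M"] M0 by simp
qed

section \<open>Mean values and Poisson integrals of holomorphic functions\<close>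

lemma set_integral_continuous:
  fixes f :: "real \<Rightarrow> 'a::euclidean_space"
  assumes "continuous_on {a..b} f"
  shows "set_integrable lebesgue {a..b} f"
    and "(LINT t:{a..b}|lebesgue. f t) = integral {a..b} f"
proof -
  have "set_integrable lborel {a..b} f"
    by (rule borel_integrable_atLeastAtMost'[OF assms])
  then show i: "set_integrable lebesgue {a..b} f"
    by (auto simp: set_integrable_def integrable_completion)
  show "(LINT t:{a..b}|lebesgue. f t) = integral {a..b} f"
    using set_lebesgue_integral_eq_integral(2)[OF i] .
qed

lemma mean_value_circle:
  fixes F :: "complex \<Rightarrow> complex"
  assumes F: "F holomorphic_on cball 0 1"
  shows "((\<lambda>t. F (cis t)) has_integral 2 * pi * F 0) {0..2*pi}"
proof -
  have "((\<lambda>u. F u / (u - 0)) has_contour_integral (2 * of_real pi * \<i> * F 0)) (circlepath 0 1)"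
    using F by (intro Cauchy_integral_circlepath_simple) auto
  then have "((\<lambda>t. F (cis t) / cis t * \<i> * cis t) has_integral 2 * of_real pi * \<i> * F 0) {0..2*pi}"
    unfolding circlepath_def by (subst (asm) has_contour_integral_part_circlepath_iff) auto
  then have "((\<lambda>t. - \<i> * (\<i> * F (cis t))) has_integral - \<i> * (2 * of_real pi * \<i> * F 0)) {0..2*pi}"
    by (intro has_integral_mult_right) (simp add: mult.commute)
  then show ?thesis
    by (simp add: algebra_simps)
qed

text \<open>The first summand is the Cauchy kernel on the circle. The second, as a function of
  \<open>u = cis t\<close>, is holomorphic near the closed disk and vanishes at
  \<open>u = 0\<close>, so it integrates to 0 against holomorphic functions.\<close>

lemma poisson_cis:
  assumes z: "norm z < 1"
  shows "of_real (poisson (norm z) (Arg z - t)) = cis t / (cis t - z) + cnj z * cis t / (1 - cnj z * cis t)"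
proof -
  define u where "u = cis t"
  have uu: "u * cnj u = 1" "norm u = 1" and u0: "u \<noteq> 0"
    by (auto simp: u_def simp flip: complex_norm_square)
  then have nz: "u - z \<noteq> 0" "cnj u - cnj z \<noteq> 0"
    using z by (auto simp flip: complex_cnj_diff)
  have "1 - cnj z * u = u * (cnj u - cnj z)"
    using uu(1) by (simp add: algebra_simps)
  then have "u / (u - z) + cnj z * u / (1 - cnj z * u) = u / (u - z) + cnj z / (cnj u - cnj z)"
    using u0 by simp
  also have "\<dots> = (u * cnj u - z * cnj z) / ((u - z) * (cnj u - cnj z))"
    using nz by (simp add: divide_simps) (simp add: algebra_simps)
  also have "\<dots> = of_real (1 - (norm z)\<^sup>2) / of_real ((norm (u - z))\<^sup>2)"
    using uu(1) unfolding of_real_diff complex_norm_square by simp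
  also have "(norm (u - z))\<^sup>2 = 1 - 2 * norm z * cos (Arg z - t) + (norm z)\<^sup>2"
  proof -
    have "Re z = norm z * cos (Arg z)" "Im z = norm z * sin (Arg z)"
      using Re_rcis[of "norm z" "Arg z"] Im_rcis[of "norm z" "Arg z"] by (simp_all add: rcis_cmod_Arg)
    then have "norm z * cos (Arg z - t) = Re z * cos t + Im z * sin t"
      unfolding cos_diff by (simp only: distrib_left mult.assoc)
    moreover have "(norm (u - z))\<^sup>2 = (cos t - Re z)\<^sup>2 + (sin t - Im z)\<^sup>2"
      by (simp add: cmod_power2 u_def)
    moreover have "(cos t)\<^sup>2 + (sin t)\<^sup>2 = 1"
      by simp
    ultimately show ?thesis
      using cmod_power2[of z] by algebra
  qed
  finally show ?thesis
    by (simp add: poisson_def u_def)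
qed

lemma poisson_integral_holomorphic:
  fixes g :: "complex \<Rightarrow> complex"
  assumes g: "g holomorphic_on cball 0 1" and z: "norm z < 1"
  shows "(LINT t:{0..2*pi}|lebesgue. g (cis t) * of_real (poisson (norm z) (Arg z - t))) = 2 * pi * g z"
proof -
  have "((\<lambda>u. g u / (u - z)) has_contour_integral (2 * of_real pi * \<i> * g z)) (circlepath 0 1)"
    using g z by (intro Cauchy_integral_circlepath_simple) auto
  then have "((\<lambda>t. g (cis t) / (cis t - z) * \<i> * cis t) has_integral 2 * of_real pi * \<i> * g z) {0..2*pi}"
    unfolding circlepath_def by (subst (asm) has_contour_integral_part_circlepath_iff) auto
  then have "((\<lambda>t. - \<i> * (\<i> * (g (cis t) * (cis t / (cis t - z))))) has_integral - \<i> * (2 * of_real pi * \<i> * g z)) {0..2*pi}"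
    by (intro has_integral_mult_right) (simp add: algebra_simps)
  then have 1: "((\<lambda>t. g (cis t) * (cis t / (cis t - z))) has_integral 2 * pi * g z) {0..2*pi}"
    by (simp add: algebra_simps)
  have nz: "1 - cnj z * u \<noteq> 0" if "norm u \<le> 1" for u
  proof
    assume "1 - cnj z * u = 0"
    then have "norm z * norm u = 1"
      by (metis complex_mod_cnj norm_mult norm_one right_minus_eq)
    moreover have "norm z * norm u \<le> norm z * 1"
      using that by (intro mult_left_mono) auto
    ultimately show False
      using z by simp
  qed
  have 2: "((\<lambda>t. g (cis t) * (cnj z * cis t / (1 - cnj z * cis t))) has_integral 0) {0..2*pi}"
  proof -
    have "(\<lambda>u. g u * (cnj z * u / (1 - cnj z * u))) holomorphic_on cball 0 1"
      using nz by (intro holomorphic_intros g) auto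
    from mean_value_circle[OF this] show ?thesis
      by simp
  qed
  have "((\<lambda>t. g (cis t) * of_real (poisson (norm z) (Arg z - t))) has_integral 2 * pi * g z) {0..2*pi}"
    using has_integral_add[OF 1 2] by (simp add: poisson_cis[OF z] distrib_left)
  moreover have "continuous_on {0..2*pi} (\<lambda>t. g (cis t) * of_real (poisson (norm z) (Arg z - t)))"
  proof -
    have "continuous_on {0..2*pi} (\<lambda>t. g (cis t))"
      by (rule continuous_on_compose2[OF holomorphic_on_imp_continuous_on[OF g]])
        (auto intro!: continuous_intros)
    moreover have "cis t - z \<noteq> 0" for t
      using z by auto
    ultimately show ?thesis
      unfolding poisson_cis[OF z] using nz by (intro continuous_intros) auto
  qed
  ultimately show ?thesis
    by (simp add: set_integral_continuous(2) integral_unique)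
qed

text \<open>The dilate \<open>h (of_real \<rho> * u)\<close> is holomorphic on the closed disk, so
  its pairing with the Poisson kernel is exactly \<open>2 * pi * h (of_real \<rho> * z)\<close>;
  continuity of \<open>h\<close> at \<open>z\<close> gives the limit.\<close>

lemma boundary_value_poisson:
  fixes h :: "complex \<Rightarrow> complex"
  assumes h: "h holomorphic_on unit_disk" and z: "norm z < 1"
  shows "boundary_value {} h (\<lambda>t. of_real (poisson (norm z) (Arg z - t))) = 2 * pi * h z"
proof -
  have "circle_pairing h (\<lambda>t. of_real (poisson (norm z) (Arg z - t))) \<rho> = 2 * pi * h (of_real \<rho> * z)"
    if "\<rho> \<in> {0<..<1}" for \<rho>
  proof -
    have "(\<lambda>u. h (of_real \<rho> * u)) holomorphic_on cball 0 1"
    proof (rule holomorphic_on_compose_gen[OF _ h, unfolded o_def])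
      show "(*) (complex_of_real \<rho>) ` cball 0 1 \<subseteq> unit_disk"
        using that by (auto simp: norm_mult intro!: le_less_trans[OF mult_left_le])
    qed (intro holomorphic_intros)
    from poisson_integral_holomorphic[OF this z] show ?thesis
      by (simp add: circle_pairing_def)
  qed
  then have ev: "\<forall>\<^sub>F \<rho> in at 1 within {0<..<1} - {}. 2 * pi * h (of_real \<rho> * z) =
      circle_pairing h (\<lambda>t. of_real (poisson (norm z) (Arg z - t))) \<rho>"
    by (auto simp: eventually_at_filter)
  have lim: "((\<lambda>\<rho>. 2 * pi * h (of_real \<rho> * z)) \<longlongrightarrow> 2 * pi * h (of_real 1 * z)) (at 1 within {0<..<1} - {})"
  proof (intro tendsto_intros)
    have "isCont h z"
      using z holomorphic_on_imp_continuous_on[OF h] by (simp add: continuous_on_eq_continuous_at)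
    moreover have "((\<lambda>\<rho>. of_real \<rho> * z) \<longlongrightarrow> of_real 1 * z) (at 1 within {0<..<1} - {})"
      by (intro tendsto_intros)
    ultimately show "((\<lambda>\<rho>. h (of_real \<rho> * z)) \<longlongrightarrow> h (of_real 1 * z)) (at 1 within {0<..<1} - {})"
      by (intro isCont_tendsto_compose[of _ h]) auto
  qed
  have "(circle_pairing h (\<lambda>t. of_real (poisson (norm z) (Arg z - t))) \<longlongrightarrow> 2 * pi * h z)
      (at 1 within {0<..<1} - {})"
    using Lim_transform_eventually[OF lim ev] by simp
  moreover have "at 1 within {0<..<1} - {} \<noteq> (bot :: real filter)"
    by (simp add: at_within_eq_bot_iff)
  ultimately show ?thesis
    unfolding boundary_value_def by (intro tendsto_Lim) auto
qed

section \<open>The Cauchy kernel on circles\<close>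

text \<open>What Fubini puts beside \<open>F\<close> when the Cauchy transform is paired with \<phi>
  on the circle of radius \<rho>. Radii above 1 are meaningful too: the reflected part needs
  \<open>1 / r\<close>.\<close>

definition circle_kernel :: "(real \<Rightarrow> complex) \<Rightarrow> real \<Rightarrow> complex \<Rightarrow> complex"
  where "circle_kernel \<phi> \<rho> \<zeta> = (\<integral>\<theta>. indicator {0..2*pi} \<theta> *\<^sub>R (\<phi> \<theta> * (1 / (\<zeta> - of_real \<rho> * cis \<theta>))) \<partial>lborel)"

text \<open>For \<zeta> outside the circle this is the mean value property of a function holomorphic
  in \<open>u = cis \<theta>\<close>; for \<zeta> inside, the integrand is the conjugate of such a
  function with value 0 at the centre.\<close>

lemma integral_inverse_circle:
  fixes \<zeta> :: complex
  assumes \<rho>: "\<rho> > 0" and ne: "norm \<zeta> \<noteq> \<rho>"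
  shows "((\<lambda>\<theta>. 1 / (\<zeta> - of_real \<rho> * cis \<theta>)) has_integral
    (if norm \<zeta> > \<rho> then 2 * pi / \<zeta> else 0)) {0..2*pi}"
proof (cases "norm \<zeta> > \<rho>")
  case True
  have "\<zeta> - of_real \<rho> * u \<noteq> 0" if "norm u \<le> 1" for u
  proof
    assume "\<zeta> - of_real \<rho> * u = 0"
    then have "norm \<zeta> = \<rho> * norm u"
      using \<rho> by (simp add: norm_mult)
    also have "\<dots> \<le> \<rho> * 1"
      using \<rho> that by (intro mult_left_mono) auto
    finally show False
      using True by simp
  qed
  then have "(\<lambda>u. 1 / (\<zeta> - of_real \<rho> * u)) holomorphic_on cball 0 1"
    by (intro holomorphic_intros) auto
  from mean_value_circle[OF this] show ?thesis
    using True by simp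
next
  case False
  then have less: "norm \<zeta> < \<rho>"
    using ne by simp
  have nz: "cnj \<zeta> * u - of_real \<rho> \<noteq> 0" if "norm u \<le> 1" for u
  proof
    assume "cnj \<zeta> * u - of_real \<rho> = 0"
    then have "norm (cnj \<zeta> * u) = \<rho>"
      using \<rho> by simp
    then have "\<rho> = norm \<zeta> * norm u"
      by (simp add: norm_mult)
    also have "\<dots> \<le> norm \<zeta> * 1"
      using that by (intro mult_left_mono) auto
    finally show False
      using less by simp
  qed
  \<comment> \<open>On the unit circle \<open>cnj u = 1 / u\<close>, so conjugating
    \<open>1 / (\<zeta> - of_real \<rho> * u)\<close> and multiplying through by \<open>u\<close>
    gives this function, whose pole lies outside the closed disk.\<close>
  then have "(\<lambda>u. u / (cnj \<zeta> * u - of_real \<rho>)) holomorphic_on cball 0 1"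
    by (intro holomorphic_intros) auto
  from has_integral_linear[OF mean_value_circle[OF this] bounded_linear_cnj]
  have "((\<lambda>\<theta>. cnj (cis \<theta> / (cnj \<zeta> * cis \<theta> - of_real \<rho>))) has_integral 0) {0..2*pi}"
    by (simp add: o_def)
  moreover have "cnj (cis \<theta> / (cnj \<zeta> * cis \<theta> - of_real \<rho>)) = 1 / (\<zeta> - of_real \<rho> * cis \<theta>)" for \<theta>
  proof -
    have u: "cis \<theta> * cnj (cis \<theta>) = 1"
      using complex_norm_square[of "cis \<theta>"] by simp
    then have "\<zeta> - of_real \<rho> * cis \<theta> = cis \<theta> * (\<zeta> * cnj (cis \<theta>) - of_real \<rho>)"
      by (simp add: algebra_simps)
    then have "1 / (\<zeta> - of_real \<rho> * cis \<theta>) =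
        cis \<theta> * cnj (cis \<theta>) / (cis \<theta> * (\<zeta> * cnj (cis \<theta>) - of_real \<rho>))"
      unfolding u by simp
    also have "\<dots> = cnj (cis \<theta>) / (\<zeta> * cnj (cis \<theta>) - of_real \<rho>)"
      by simp
    finally show ?thesis
      by simp
  qed
  ultimately show ?thesis
    using False by simp
qed

text \<open>Move from the circle point to \<zeta> and then radially to the circle: the radial gap is
  itself at most the distance to \<zeta>, hence the factor 2. Angular separation is thus controlled
  by the denominator of the Cauchy kernel.\<close>

lemma norm_circle_diff_le:
  assumes \<rho>: "\<rho> > 0"
  shows "\<rho> * norm (cis \<theta> - cis (Arg \<zeta>)) \<le> 2 * norm (\<zeta> - of_real \<rho> * cis \<theta>)"
proof -
  let ?u = "of_real \<rho> * cis \<theta>"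
  have \<zeta>: "\<zeta> = of_real (norm \<zeta>) * cis (Arg \<zeta>)"
    using rcis_cmod_Arg[of \<zeta>] by (simp add: rcis_def)
  have "of_real \<rho> * (cis \<theta> - cis (Arg \<zeta>)) = (?u - \<zeta>) + of_real (norm \<zeta> - \<rho>) * cis (Arg \<zeta>)"
    by (subst (2) \<zeta>) (simp add: algebra_simps)
  then have "norm (of_real \<rho> * (cis \<theta> - cis (Arg \<zeta>))) \<le> norm (?u - \<zeta>) + \<bar>norm \<zeta> - \<rho>\<bar>"
    using norm_triangle_ineq[of "?u - \<zeta>" "of_real (norm \<zeta> - \<rho>) * cis (Arg \<zeta>)"]
    by (simp add: norm_mult del: of_real_diff)
  moreover have "\<bar>norm \<zeta> - \<rho>\<bar> \<le> norm (\<zeta> - ?u)"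
    using norm_triangle_ineq3[of \<zeta> ?u] \<rho> by (simp add: norm_mult)
  ultimately show ?thesis
    using \<rho> by (simp add: norm_mult norm_minus_commute)
qed

lemma circle_kernel_continuous_on:
  assumes \<phi>: "\<phi> \<in> circle_tests" and \<rho>: "\<rho> > 0" and ne: "norm \<zeta> \<noteq> \<rho>"
  shows "continuous_on S (\<lambda>\<theta>. \<phi> \<theta> * (1 / (\<zeta> - of_real \<rho> * cis \<theta>)))"
proof -
  have "\<zeta> - of_real \<rho> * cis \<theta> \<noteq> 0" for \<theta>
    using ne \<rho> by (auto simp: norm_mult)
  then show ?thesis
    by (intro continuous_intros circle_test_continuous \<phi>) auto
qed

lemma circle_kernel_eq_integral:
  assumes "\<phi> \<in> circle_tests" and "\<rho> > 0" and "norm \<zeta> \<noteq> \<rho>"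
  shows "circle_kernel \<phi> \<rho> \<zeta> = integral {0..2*pi} (\<lambda>\<theta>. \<phi> \<theta> * (1 / (\<zeta> - of_real \<rho> * cis \<theta>)))"
  using set_borel_integral_eq_integral(2)[OF borel_integrable_atLeastAtMost'[OF circle_kernel_continuous_on[OF assms]]]
  by (simp add: circle_kernel_def set_lebesgue_integral_def)

text \<open>The mean of \<open>1/(\<zeta> - \<rho> cis \<theta>)\<close> is explicit, and subtracting from \<open>\<phi>\<close> its
  value at the argument of \<open>\<zeta>\<close> cancels the singularity.\<close>

lemma circle_kernel_bounded:
  assumes \<phi>: "\<phi> \<in> circle_tests"
  obtains C where "\<And>\<rho> \<zeta>. 1 / 2 \<le> \<rho> \<Longrightarrow> norm \<zeta> \<noteq> \<rho> \<Longrightarrow> norm (circle_kernel \<phi> \<rho> \<zeta>) \<le> C"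
proof -
  obtain B where B: "0 \<le> B" "\<And>t. norm (\<phi> t) \<le> B"
    using circle_test_bounded[OF \<phi>] by blast
  obtain L where L: "0 \<le> L" "\<And>s t. norm (\<phi> s - \<phi> t) \<le> L * norm (cis s - cis t)"
    using circle_test_lipschitz[OF \<phi>] by blast
  \<comment> \<open>The mean \<open>m\<close> of the kernel is 0 or \<open>2 * pi / \<zeta>\<close>
    with \<open>norm \<zeta> > 1/2\<close>, hence the bound 4 pi. In the remainder the Lipschitz
    bound cancels the denominator; 4 is the factor 2 of \<open>norm_circle_diff_le\<close> divided
    by the least radius 1/2, and 2 pi is the length of the interval.\<close>
  have "norm (circle_kernel \<phi> \<rho> \<zeta>) \<le> B * (4 * pi) + 4 * L * (2 * pi)"
    if \<rho>: "1 / 2 \<le> \<rho>" and ne: "norm \<zeta> \<noteq> \<rho>" for \<rho> \<zeta>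
  proof -
    have \<rho>0: "\<rho> > 0"
      using \<rho> by simp
    define \<alpha> where "\<alpha> = Arg \<zeta>"
    define d where "d \<theta> = \<zeta> - of_real \<rho> * cis \<theta>" for \<theta>
    have d: "d \<theta> \<noteq> 0" for \<theta>
      using ne \<rho>0 by (auto simp: d_def norm_mult)
    define m where "m = (if norm \<zeta> > \<rho> then 2 * pi / \<zeta> else 0)"
    have m: "((\<lambda>\<theta>. 1 / d \<theta>) has_integral m) {0..2*pi}"
      using integral_inverse_circle[OF \<rho>0 ne] by (simp add: d_def m_def)
    have "norm m \<le> 4 * pi"
    proof (cases "norm \<zeta> > \<rho>")
      case True
      then have "norm \<zeta> \<ge> 1 / 2"
        using \<rho> by simp
      then have "2 * pi / norm \<zeta> \<le> 2 * pi / (1 / 2)"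
        by (intro divide_left_mono) auto
      then show ?thesis
        using True by (simp add: m_def norm_divide norm_mult)
    qed (simp add: m_def)
    have cont: "continuous_on {0..2*pi} (\<lambda>\<theta>. (\<phi> \<theta> - \<phi> \<alpha>) * (1 / d \<theta>))"
      using d unfolding d_def by (intro continuous_intros circle_test_continuous \<phi>) auto
    then obtain I where I: "((\<lambda>\<theta>. (\<phi> \<theta> - \<phi> \<alpha>) * (1 / d \<theta>)) has_integral I) {0..2*pi}"
      using integrable_continuous_real by (metis integrable_on_def)
    have "norm I \<le> 4 * L * Henstock_Kurzweil_Integration.content {0..2*pi}"
    proof (rule has_integral_bound_real[OF _ _ I])
      fix \<theta>
      have "norm ((\<phi> \<theta> - \<phi> \<alpha>) * (1 / d \<theta>)) \<le> L * norm (cis \<theta> - cis \<alpha>) / norm (d \<theta>)"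
        using L(2) by (simp add: norm_mult norm_divide divide_right_mono)
      also have "\<dots> \<le> L * (4 * norm (d \<theta>)) / norm (d \<theta>)"
      proof (intro divide_right_mono mult_left_mono L)
        have "1 / 2 * norm (cis \<theta> - cis \<alpha>) \<le> \<rho> * norm (cis \<theta> - cis \<alpha>)"
          using \<rho> by (intro mult_right_mono) auto
        also have "\<dots> \<le> 2 * norm (d \<theta>)"
          unfolding d_def \<alpha>_def by (rule norm_circle_diff_le[OF \<rho>0])
        finally show "norm (cis \<theta> - cis \<alpha>) \<le> 4 * norm (d \<theta>)"
          by simp
      qed auto
      also have "\<dots> = 4 * L"
        using d by simp
      finally show "norm ((\<phi> \<theta> - \<phi> \<alpha>) * (1 / d \<theta>)) \<le> 4 * L" .
    qed (use L in auto)
    moreover have "((\<lambda>\<theta>. \<phi> \<theta> * (1 / d \<theta>)) has_integral \<phi> \<alpha> * m + I) {0..2*pi}"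
      using has_integral_add[OF has_integral_mult_right[OF m, of "\<phi> \<alpha>"] I]
      by (simp add: algebra_simps diff_divide_distrib)
    then have "circle_kernel \<phi> \<rho> \<zeta> = \<phi> \<alpha> * m + I"
      unfolding circle_kernel_eq_integral[OF \<phi> \<rho>0 ne] by (auto simp: d_def dest: integral_unique)
    moreover have "norm (\<phi> \<alpha> * m) \<le> B * (4 * pi)"
      unfolding norm_mult using B \<open>norm m \<le> 4 * pi\<close> by (intro mult_mono) auto
    ultimately show ?thesis
      using norm_triangle_ineq[of "\<phi> \<alpha> * m" I] by simp
  qed
  then show ?thesis
    using that by blast
qed

text \<open>For fixed \<zeta> in the open disk the circles of radius above
  \<open>norm \<zeta>\<close> stay clear of the pole, so the kernel is continuous in the radius
  across 1. Approach from below and from above gives the same limit, which the cancellation of real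
  parts relies on.\<close>

lemma circle_kernel_tendsto:
  assumes \<phi>: "\<phi> \<in> circle_tests" and \<zeta>: "norm \<zeta> < 1" and X: "X \<longlonglongrightarrow> 1"
  shows "(\<lambda>n. circle_kernel \<phi> (X n) \<zeta>) \<longlonglongrightarrow> circle_kernel \<phi> 1 \<zeta>"
proof -
  let ?I = "\<lambda>\<rho>. integral (cbox 0 (2*pi)) (\<lambda>\<theta>. \<phi> \<theta> * (1 / (\<zeta> - of_real \<rho> * cis \<theta>)))"
  have pos: "\<rho> > 0" if "\<rho> \<in> {norm \<zeta><..}" for \<rho>
    using that norm_ge_zero[of \<zeta>] by (simp del: norm_ge_zero)
  have nz: "\<zeta> - of_real \<rho> * cis \<theta> \<noteq> 0" if "\<rho> \<in> {norm \<zeta><..}" for \<rho> \<theta>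
    using pos[OF that] that by (auto simp: norm_mult)
  have "continuous_on ({norm \<zeta><..} \<times> cbox 0 (2*pi)) (\<lambda>(\<rho>, \<theta>). \<phi> \<theta> * (1 / (\<zeta> - of_real \<rho> * cis \<theta>)))"
    unfolding case_prod_unfold using nz
    by (intro continuous_intros continuous_on_compose2[OF circle_test_continuous[OF \<phi>, of UNIV]]) auto
  then have "continuous_on {norm \<zeta><..} ?I"
    by (rule integral_continuous_on_param)
  then have "isCont ?I 1"
    using \<zeta> by (simp add: continuous_on_eq_continuous_at)
  then have "(\<lambda>n. ?I (X n)) \<longlonglongrightarrow> ?I 1"
    by (rule isCont_tendsto_compose[OF _ X])
  moreover have eq: "circle_kernel \<phi> \<rho> \<zeta> = ?I \<rho>" if "\<rho> \<in> {norm \<zeta><..}" for \<rho>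
    using that pos[OF that] by (subst circle_kernel_eq_integral[OF \<phi>]) auto
  moreover have "\<forall>\<^sub>F n in sequentially. ?I (X n) = circle_kernel \<phi> (X n) \<zeta>"
    using order_tendstoD(1)[OF X \<zeta>] by eventually_elim (simp add: eq)
  ultimately show ?thesis
    using \<zeta> Lim_transform_eventually by fastforce
qed

lemma circle_kernel_measurable [measurable]:
  assumes "\<phi> \<in> circle_tests"
  shows "circle_kernel \<phi> \<rho> \<in> borel_measurable borel"
proof -
  have [measurable]: "\<phi> \<in> borel_measurable borel"
    using assms by (intro borel_measurable_continuous_onI circle_test_continuous)
  show ?thesis
    unfolding circle_kernel_def by measurable
qed

lemma integral_circle_kernel_tendsto:
  assumes \<phi>: "\<phi> \<in> circle_tests" and F: "integrable lborel F"
    and zero: "\<And>\<zeta>. norm \<zeta> \<ge> 1 \<Longrightarrow> F \<zeta> = 0"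
    and X: "X \<longlonglongrightarrow> 1" "\<And>n. X n \<ge> 1 / 2"
  shows "(\<lambda>n. \<integral>\<zeta>. F \<zeta> * circle_kernel \<phi> (X n) \<zeta> \<partial>lborel) \<longlonglongrightarrow> (\<integral>\<zeta>. F \<zeta> * circle_kernel \<phi> 1 \<zeta> \<partial>lborel)"
proof -
  obtain C where C: "\<And>\<rho> \<zeta>. 1 / 2 \<le> \<rho> \<Longrightarrow> norm \<zeta> \<noteq> \<rho> \<Longrightarrow> norm (circle_kernel \<phi> \<rho> \<zeta>) \<le> C"
    using circle_kernel_bounded[OF \<phi>] by blast
  have [measurable]: "F \<in> borel_measurable borel"
    using F by auto
  note [measurable] = circle_kernel_measurable[OF \<phi>]
  show ?thesis
  proof (rule integral_dominated_convergence[where w="\<lambda>\<zeta>. norm (F \<zeta>) * C"])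
    show "integrable lborel (\<lambda>\<zeta>. norm (F \<zeta>) * C)"
      using F by simp
    show "AE \<zeta> in lborel. (\<lambda>n. F \<zeta> * circle_kernel \<phi> (X n) \<zeta>) \<longlonglongrightarrow> F \<zeta> * circle_kernel \<phi> 1 \<zeta>"
    proof (rule AE_I2)
      fix \<zeta>
      show "(\<lambda>n. F \<zeta> * circle_kernel \<phi> (X n) \<zeta>) \<longlonglongrightarrow> F \<zeta> * circle_kernel \<phi> 1 \<zeta>"
        using zero[of \<zeta>] by (cases "norm \<zeta> < 1") (auto intro!: tendsto_intros circle_kernel_tendsto \<phi> X)
    qed
    show "AE \<zeta> in lborel. norm (F \<zeta> * circle_kernel \<phi> (X n) \<zeta>) \<le> norm (F \<zeta>) * C" for n
    proof -
      \<comment> \<open>The uniform bound is available only off the circle that carries the kernel,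
        which is null in the plane.\<close>
      have "sphere (0::complex) (X n) \<in> null_sets lborel"
        using negligible_sphere[of "0::complex" "X n"]
        by (simp add: negligible_iff_null_sets null_sets_completion_iff)
      then have "AE \<zeta> in lborel. \<zeta> \<notin> sphere (0 :: complex) (X n)"
        by (rule AE_not_in)
      then show ?thesis
        by eventually_elim (use C[OF X(2)] in \<open>auto simp: norm_mult intro!: mult_left_mono\<close>)
    qed
  qed measurable
qed

lemma integral_circle_kernel_tendsto_at:
  assumes \<phi>: "\<phi> \<in> circle_tests" and F: "integrable lborel F"
    and zero: "\<And>\<zeta>. norm \<zeta> \<ge> 1 \<Longrightarrow> F \<zeta> = 0"
  shows "((\<lambda>\<rho>. \<integral>\<zeta>. F \<zeta> * circle_kernel \<phi> \<rho> \<zeta> \<partial>lborel) \<longlongrightarrow>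
    (\<integral>\<zeta>. F \<zeta> * circle_kernel \<phi> 1 \<zeta> \<partial>lborel)) (at 1)"
  unfolding tendsto_at_iff_sequentially comp_def
proof safe
  fix X :: "nat \<Rightarrow> real" assume X: "X \<longlonglongrightarrow> 1"
  then have "\<forall>\<^sub>F n in sequentially. X n > 1 / 2"
    by (rule order_tendstoD) simp
  then obtain n0 where n0: "\<And>n. n \<ge> n0 \<Longrightarrow> X n > 1 / 2"
    by (auto simp: eventually_sequentially)
  show "(\<lambda>n. \<integral>\<zeta>. F \<zeta> * circle_kernel \<phi> (X n) \<zeta> \<partial>lborel) \<longlonglongrightarrow> (\<integral>\<zeta>. F \<zeta> * circle_kernel \<phi> 1 \<zeta> \<partial>lborel)"
  \<comment> \<open>The uniform bound needs radii of at least 1/2, so an initial segment of the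
    sequence is dropped.\<close>
  proof (rule LIMSEQ_offset[of _ n0], rule integral_circle_kernel_tendsto[OF \<phi> F zero])
    show "(\<lambda>n. X (n + n0)) \<longlonglongrightarrow> 1"
      by (rule LIMSEQ_ignore_initial_segment[OF X])
    show "X (n + n0) \<ge> 1 / 2" for n
      using n0[of "n + n0"] by simp
  qed
qed

text \<open>With the area weight \<open>r\<close>, the kernel is at most twice the product of an
  inverse square root in the radius and one in the angle. The constants: 2 is pointwise, 5 = 4 + 1
  bounds the radial integral over [0, 1], and 3 counts the possible angular poles, each costing 4 +
  2 pi.\<close>

lemma nn_integral_polar_kernel:
  "(\<integral>\<^sup>+r. (\<integral>\<^sup>+\<theta>. ennreal (norm (1 / (\<zeta> - of_real r * cis \<theta>))) * indicator {0..2*pi} \<theta> \<partial>lborel) *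
    (ennreal r * indicator {0<..<1} r) \<partial>lborel) \<le> ennreal (2 * (5 * (3 * (4 + 2 * pi))))"
proof -
  define q where "q b t = 1 / sqrt \<bar>t - b\<bar>" for b t :: real
  have q0: "q b t \<ge> 0" for b t
    by (simp add: q_def)
  have [measurable]: "q b \<in> borel_measurable borel" for b
    unfolding q_def by measurable
  \<comment> \<open>The angle runs over [0, 2 pi] while \<open>Arg\<close> takes values in (-pi,
    pi], so the angle of \<zeta> nearest to it is one of three translates of
    \<open>Arg \<zeta>\<close>.\<close>
  define \<alpha> where "\<alpha> k = Arg \<zeta> + 2 * pi * of_int k" for k :: int
  define Q where "Q \<theta> = q (\<alpha> (-1)) \<theta> + q (\<alpha> 0) \<theta> + q (\<alpha> 1) \<theta>" for \<theta>
  have [measurable]: "Q \<in> borel_measurable borel"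
    unfolding Q_def by measurable
  have Q: "(\<integral>\<^sup>+\<theta>. ennreal (Q \<theta>) * indicator {0..2*pi} \<theta> \<partial>lborel) \<le> ennreal (3 * (4 + 2 * pi))"
  proof -
    have "(\<integral>\<^sup>+\<theta>. ennreal (Q \<theta>) * indicator {0..2*pi} \<theta> \<partial>lborel) =
        (\<integral>\<^sup>+\<theta>. ennreal (q (\<alpha> (-1)) \<theta>) * indicator {0..2*pi} \<theta> \<partial>lborel) +
        (\<integral>\<^sup>+\<theta>. ennreal (q (\<alpha> 0) \<theta>) * indicator {0..2*pi} \<theta> \<partial>lborel) +
        (\<integral>\<^sup>+\<theta>. ennreal (q (\<alpha> 1) \<theta>) * indicator {0..2*pi} \<theta> \<partial>lborel)"
      unfolding Q_def using q0
      by (simp add: ennreal_plus distrib_right nn_integral_add)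
    also have "\<dots> \<le> ennreal (4 + 2 * pi) + ennreal (4 + 2 * pi) + ennreal (4 + 2 * pi)"
      using nn_integral_inverse_sqrt[of _ 0 "2 * pi"] by (intro add_mono) (simp_all add: q_def)
    finally show ?thesis
      by (simp add: ennreal_plus[symmetric] del: ennreal_plus)
  qed
  have pt: "norm (1 / (\<zeta> - of_real r * cis \<theta>)) * r \<le> 2 * (q (norm \<zeta>) r * Q \<theta>)"
    if r: "0 < r" "r < 1" "r \<noteq> norm \<zeta>" and \<theta>: "0 \<le> \<theta>" "\<theta> \<le> 2 * pi"
      "\<theta> \<noteq> \<alpha> (-1)" "\<theta> \<noteq> \<alpha> 0" "\<theta> \<noteq> \<alpha> 1" for r \<theta>
  proof -
    define N where "N = norm (\<zeta> - of_real r * cis \<theta>)"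
    obtain k :: int where k: "\<bar>\<theta> - Arg \<zeta> - 2 * pi * k\<bar> \<le> pi"
      "\<bar>\<theta> - Arg \<zeta> - 2 * pi * k\<bar> \<le> 2 * norm (cis (\<theta> - Arg \<zeta>) - 1)"
      using cis_chord by blast
    have "k \<in> {-1, 0, 1}"
    proof -
      have "2 * pi * k < 2 * pi * 2" "2 * pi * (-2) < 2 * pi * k"
        using k(1)[unfolded abs_le_iff] \<theta>(1,2) Arg_bounded[of \<zeta>] pi_gt_zero by linarith+
      then have "real_of_int k < 2" "-2 < real_of_int k"
        using mult_less_cancel_left_pos[of "2 * pi" k 2] mult_less_cancel_left_pos[of "2 * pi" "-2" k]
        by (simp_all only: pi_gt_zero mult_pos_pos zero_less_numeral)
      then show ?thesis
        by auto
    qed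
    then have qQ: "q (\<alpha> k) \<theta> \<le> Q \<theta>" and ne: "\<theta> \<noteq> \<alpha> k"
      using q0 \<theta> by (auto simp: Q_def add_increasing add_increasing2)
    define s t where "s = \<bar>r - norm \<zeta>\<bar>" and "t = \<bar>\<theta> - \<alpha> k\<bar>"
    have st: "s > 0" "t > 0"
      using r ne by (auto simp: s_def t_def)
    have sN: "s \<le> N"
      using norm_triangle_ineq3[of \<zeta> "of_real r * cis \<theta>"] r
      by (simp add: s_def N_def norm_mult abs_minus_commute)
    have "r * t \<le> r * (2 * norm (cis \<theta> - cis (Arg \<zeta>)))"
      using k(2) r by (intro mult_left_mono) (auto simp: t_def \<alpha>_def norm_cis_diff algebra_simps)
    also have "\<dots> \<le> 4 * N"
      using norm_circle_diff_le[OF r(1), of \<theta> \<zeta>] by (simp add: N_def)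
    finally have tN: "r * t \<le> 4 * N" .
    \<comment> \<open>A further factor \<open>r \<le> 1\<close> is spent so that the square root of
      \<open>s * r^2 * t\<close> carries the full weight \<open>r\<close>.\<close>
    have "r * (r * t) \<le> 1 * (r * t)"
      using r st by (intro mult_right_mono) auto
    then have "r * (r * t) \<le> 4 * N"
      using tN by simp
    then have "s * (r * (r * t)) \<le> N * (4 * N)"
      using sN st r by (intro mult_mono[of s N]) auto
    then have "sqrt (s * (r * (r * t))) \<le> sqrt ((2 * N) * (2 * N))"
      by simp
    moreover have "sqrt (s * (r * (r * t))) = sqrt s * (r * sqrt t)"
      using r by (simp add: real_sqrt_mult)
    moreover have "sqrt ((2 * N) * (2 * N)) = 2 * N"
      using st sN by (simp only: real_sqrt_abs2)
    ultimately have "sqrt s * (r * sqrt t) \<le> 2 * N"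
      by (simp only:)
    then have "r / N \<le> 2 * (1 / sqrt s * (1 / sqrt t))"
      using st sN by (simp add: field_simps)
    also have "\<dots> = 2 * (q (norm \<zeta>) r * q (\<alpha> k) \<theta>)"
      by (simp add: q_def s_def t_def)
    also have "\<dots> \<le> 2 * (q (norm \<zeta>) r * Q \<theta>)"
      using q0 qQ by (intro mult_left_mono) auto
    finally show ?thesis
      by (simp add: N_def norm_divide)
  qed
  have "(\<integral>\<^sup>+r. (\<integral>\<^sup>+\<theta>. ennreal (norm (1 / (\<zeta> - of_real r * cis \<theta>))) * indicator {0..2*pi} \<theta> \<partial>lborel) *
      (ennreal r * indicator {0<..<1} r) \<partial>lborel) \<le>
    (\<integral>\<^sup>+r. 2 * (ennreal (q (norm \<zeta>) r) * indicator {0..1} r) *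
      (\<integral>\<^sup>+\<theta>. ennreal (Q \<theta>) * indicator {0..2*pi} \<theta> \<partial>lborel) \<partial>lborel)"
  proof (rule nn_integral_mono_AE, rule eventually_mono[OF AE_lborel_singleton[of "norm \<zeta>"]])
    fix r assume r: "r \<noteq> norm \<zeta>"
    have "(\<integral>\<^sup>+\<theta>. ennreal (norm (1 / (\<zeta> - of_real r * cis \<theta>))) * indicator {0..2*pi} \<theta> \<partial>lborel) *
        (ennreal r * indicator {0<..<1} r) =
      (\<integral>\<^sup>+\<theta>. ennreal (norm (1 / (\<zeta> - of_real r * cis \<theta>))) * indicator {0..2*pi} \<theta> *
        (ennreal r * indicator {0<..<1} r) \<partial>lborel)"
      by (rule nn_integral_multc[symmetric]) measurable
    also have "\<dots> \<le> (\<integral>\<^sup>+\<theta>. 2 * (ennreal (q (norm \<zeta>) r) * indicator {0..1} r) *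
        (ennreal (Q \<theta>) * indicator {0..2*pi} \<theta>) \<partial>lborel)"
    proof (rule nn_integral_mono_AE)
      have "AE \<theta> in lborel. \<theta> \<noteq> \<alpha> (-1) \<and> \<theta> \<noteq> \<alpha> 0 \<and> \<theta> \<noteq> \<alpha> 1"
        by (intro AE_conjI AE_lborel_singleton)
      then show "AE \<theta> in lborel. ennreal (norm (1 / (\<zeta> - of_real r * cis \<theta>))) * indicator {0..2*pi} \<theta> *
          (ennreal r * indicator {0<..<1} r) \<le>
        2 * (ennreal (q (norm \<zeta>) r) * indicator {0..1} r) * (ennreal (Q \<theta>) * indicator {0..2*pi} \<theta>)"
      proof eventually_elim
        case (elim \<theta>)
        show ?case
        proof (cases "r \<in> {0<..<1} \<and> \<theta> \<in> {0..2*pi}")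
          case True
          then have "ennreal (norm (1 / (\<zeta> - of_real r * cis \<theta>)) * r) \<le> ennreal (2 * (q (norm \<zeta>) r * Q \<theta>))"
            using elim r by (intro ennreal_leI pt) auto
          then show ?thesis
            using True q0 by (simp add: ennreal_mult' ennreal_mult Q_def mult.assoc less_imp_le)
        qed (auto simp: indicator_def)
      qed
    qed
    also have "\<dots> = 2 * (ennreal (q (norm \<zeta>) r) * indicator {0..1} r) *
        (\<integral>\<^sup>+\<theta>. ennreal (Q \<theta>) * indicator {0..2*pi} \<theta> \<partial>lborel)"
      by (rule nn_integral_cmult) measurable
    finally show "(\<integral>\<^sup>+\<theta>. ennreal (norm (1 / (\<zeta> - of_real r * cis \<theta>))) * indicator {0..2*pi} \<theta> \<partial>lborel) *
        (ennreal r * indicator {0<..<1} r) \<le> \<dots>" .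
  qed
  also have "\<dots> = 2 * (\<integral>\<^sup>+r. ennreal (q (norm \<zeta>) r) * indicator {0..1} r \<partial>lborel) *
      (\<integral>\<^sup>+\<theta>. ennreal (Q \<theta>) * indicator {0..2*pi} \<theta> \<partial>lborel)"
    by (simp add: nn_integral_multc nn_integral_cmult)
  also have "\<dots> \<le> ennreal 2 * ennreal 5 * ennreal (3 * (4 + 2 * pi))"
    using nn_integral_inverse_sqrt[of "norm \<zeta>" 0 1] Q by (intro mult_mono) (auto simp: q_def)
  also have "\<dots> = ennreal (2 * (5 * (3 * (4 + 2 * pi))))"
    by (subst ennreal_mult'[symmetric], simp)+ (simp add: mult.assoc)
  finally show ?thesis .
qed

text \<open>Integrated over \<open>r\<close> with weight \<open>r\<close>, the iterated integral is
  finite by the polar estimate, so it is finite for almost every \<open>r\<close>, and the positive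
  weight can be divided off. Without a test function in the kernel, the exceptional set serves all
  of them at once.\<close>

lemma AE_radius_integrable:
  fixes F :: "complex \<Rightarrow> complex"
  assumes F: "integrable lborel F"
  shows "AE r in lborel. r \<in> {0<..<1} \<longrightarrow>
    integrable (lborel \<Otimes>\<^sub>M lborel) (\<lambda>(\<zeta>, \<theta>). F \<zeta> * (indicator {0..2*pi} \<theta> *\<^sub>R (1 / (\<zeta> - of_real r * cis \<theta>))))"
proof -
  have [measurable]: "F \<in> borel_measurable borel"
    using F by auto
  let ?k = "\<lambda>\<zeta> r. \<integral>\<^sup>+\<theta>. ennreal (norm (1 / (\<zeta> - of_real r * cis \<theta>))) * indicator {0..2*pi} \<theta> \<partial>lborel"
  let ?C = "ennreal (2 * (5 * (3 * (4 + 2 * pi))))"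
  have "(\<integral>\<^sup>+r. \<integral>\<^sup>+\<zeta>. ennreal (norm (F \<zeta>)) * (?k \<zeta> r * (ennreal r * indicator {0<..<1} r)) \<partial>lborel \<partial>lborel) =
      (\<integral>\<^sup>+\<zeta>. \<integral>\<^sup>+r. ennreal (norm (F \<zeta>)) * (?k \<zeta> r * (ennreal r * indicator {0<..<1} r)) \<partial>lborel \<partial>lborel)"
    by (rule lborel_pair.Fubini') measurable
  also have "\<dots> = (\<integral>\<^sup>+\<zeta>. ennreal (norm (F \<zeta>)) * (\<integral>\<^sup>+r. ?k \<zeta> r * (ennreal r * indicator {0<..<1} r) \<partial>lborel) \<partial>lborel)"
    by (intro nn_integral_cong nn_integral_cmult) measurable
  also have "\<dots> \<le> (\<integral>\<^sup>+\<zeta>. ennreal (norm (F \<zeta>)) * ?C \<partial>lborel)"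
    by (intro nn_integral_mono mult_left_mono nn_integral_polar_kernel) auto
  also have "\<dots> = (\<integral>\<^sup>+\<zeta>. ennreal (norm (F \<zeta>)) \<partial>lborel) * ?C"
    by (rule nn_integral_multc) measurable
  also have "\<dots> < \<infinity>"
    using F by (auto simp: integrable_iff_bounded ennreal_mult_less_top)
  finally have fin: "(\<integral>\<^sup>+r. \<integral>\<^sup>+\<zeta>. ennreal (norm (F \<zeta>)) * (?k \<zeta> r * (ennreal r * indicator {0<..<1} r)) \<partial>lborel \<partial>lborel) \<noteq> \<infinity>"
    by simp
  have "AE r in lborel. (\<integral>\<^sup>+\<zeta>. ennreal (norm (F \<zeta>)) * (?k \<zeta> r * (ennreal r * indicator {0<..<1} r)) \<partial>lborel) \<noteq> \<infinity>"
    by (rule nn_integral_PInf_AE[OF _ fin]) measurable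
  then show ?thesis
  proof eventually_elim
    case (elim r)
    show ?case
    proof
      assume r: "r \<in> {0<..<1}"
      let ?g = "\<lambda>\<zeta> \<theta>. F \<zeta> * (indicator {0..2*pi} \<theta> *\<^sub>R (1 / (\<zeta> - of_real r * cis \<theta>)))"
      have "(\<integral>\<^sup>+\<zeta>. ennreal (norm (F \<zeta>)) * (?k \<zeta> r * (ennreal r * indicator {0<..<1} r)) \<partial>lborel) =
          (\<integral>\<^sup>+\<zeta>. ennreal r * (ennreal (norm (F \<zeta>)) * ?k \<zeta> r) \<partial>lborel)"
        using r by (simp add: mult_ac)
      also have "\<dots> = ennreal r * (\<integral>\<^sup>+\<zeta>. ennreal (norm (F \<zeta>)) * ?k \<zeta> r \<partial>lborel)"
        by (rule nn_integral_cmult) measurable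
      finally have fin: "(\<integral>\<^sup>+\<zeta>. ennreal (norm (F \<zeta>)) * ?k \<zeta> r \<partial>lborel) < \<infinity>"
        using elim r by (auto simp: ennreal_mult_eq_top_iff less_top)
      have "(\<integral>\<^sup>+p. norm (case p of (\<zeta>, \<theta>) \<Rightarrow> ?g \<zeta> \<theta>) \<partial>(lborel \<Otimes>\<^sub>M lborel)) =
          (\<integral>\<^sup>+\<zeta>. \<integral>\<^sup>+\<theta>. ennreal (norm (F \<zeta>)) * (ennreal (norm (1 / (\<zeta> - of_real r * cis \<theta>))) * indicator {0..2*pi} \<theta>) \<partial>lborel \<partial>lborel)"
        by (subst lborel.nn_integral_fst[symmetric])
          (auto simp: norm_mult norm_divide ennreal_mult'[symmetric] indicator_def intro!: nn_integral_cong)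
      also have "\<dots> = (\<integral>\<^sup>+\<zeta>. ennreal (norm (F \<zeta>)) * ?k \<zeta> r \<partial>lborel)"
        by (intro nn_integral_cong nn_integral_cmult) measurable
      finally show "integrable (lborel \<Otimes>\<^sub>M lborel) (\<lambda>(\<zeta>, \<theta>). ?g \<zeta> \<theta>)"
        using fin by (intro integrableI_bounded) auto
    qed
  qed
qed

section \<open>The two potentials\<close>

text \<open>The bridge between the definitions, stated for \<open>lebesgue\<close>, and Fubini,
  carried out over \<open>lborel\<close>. Completeness makes \<open>g\<close> measurable from its
  agreement with a Borel function alone.\<close>

lemma lebesgue_AE_eq_borel:
  fixes g G :: "'a::euclidean_space \<Rightarrow> 'b::{banach, second_countable_topology}"
  assumes G: "G \<in> borel_measurable borel" and ae: "AE x in lborel. g x = G x"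
  shows "g \<in> borel_measurable lebesgue"
    and "integrable lebesgue g \<longleftrightarrow> integrable lborel G"
    and "integral\<^sup>L lebesgue g = integral\<^sup>L lborel G"
proof -
  have G': "G \<in> borel_measurable lborel" "G \<in> borel_measurable lebesgue"
    using G by (auto intro: measurable_completion)
  have ae': "AE x in lebesgue. g x = G x"
    by (rule AE_completion[OF ae])
  show g: "g \<in> borel_measurable lebesgue"
  proof (rule measurableI)
    fix A :: "'b set" assume A: "A \<in> sets borel"
    show "g -` A \<inter> space lebesgue \<in> sets lebesgue"
    proof (rule completion.in_sets_AE)
      show "AE x in lebesgue. x \<in> G -` A \<inter> space lebesgue \<longleftrightarrow> x \<in> g -` A \<inter> space lebesgue"
        using ae' by eventually_elim simp
      show "G -` A \<inter> space lebesgue \<in> sets lebesgue"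
        using G'(2) A by (rule measurable_sets)
    qed simp
  qed simp
  show "integrable lebesgue g \<longleftrightarrow> integrable lborel G"
    using integrable_cong_AE[OF g G'(2) ae'] integrable_completion[OF G'(1)] by simp
  show "integral\<^sup>L lebesgue g = integral\<^sup>L lborel G"
    using integral_cong_AE[OF g G'(2) ae'] integral_completion[OF G'(1)] by simp
qed

lemma lebesgue_complex_borel_representative:
  fixes g :: "'a::euclidean_space \<Rightarrow> complex"
  assumes "g \<in> borel_measurable lebesgue"
  obtains G where "G \<in> borel_measurable borel" "AE x in lborel. g x = G x"
proof -
  have "(\<lambda>x. Re (g x)) \<in> borel_measurable lebesgue" "(\<lambda>x. Im (g x)) \<in> borel_measurable lebesgue"
    using assms by measurable
  from this[THEN completion_ex_borel_measurable_real]
  obtain a b where ab: "a \<in> borel_measurable lborel" "b \<in> borel_measurable lborel"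
    "AE x in lborel. Re (g x) = a x" "AE x in lborel. Im (g x) = b x"
    by blast
  have "AE x in lborel. g x = Complex (a x) (b x)"
    using ab(3,4) by eventually_elim (simp add: complex_eq_iff)
  moreover have "(\<lambda>x. Complex (a x) (b x)) \<in> borel_measurable borel"
    using ab(1,2) by measurable
  ultimately show ?thesis
    using that by blast
qed

lemma AE_unit_disk_witness:
  assumes "AE z in lborel. z \<in> unit_disk \<longrightarrow> P z"
  obtains z where "z \<in> unit_disk" "P z"
proof (rule ccontr)
  assume "\<not> thesis"
  then have "AE z in lebesgue. z \<notin> unit_disk"
    using that AE_completion[OF assms] by (auto elim!: eventually_mono)
  then have "unit_disk \<in> null_sets lebesgue"
    by (simp add: completion.null_sets_iff_AE)
  then show False
    using open_not_negligible[of unit_disk] by (simp add: negligible_iff_null_sets)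
qed

text \<open>A total function: where the integrand is not integrable the Bochner integral is 0.
  Pointwise formulas for \<open>w\<close> therefore carry convergence at \<open>z\<close> as a
  separate premise.\<close>

definition cauchy_part :: "(complex \<Rightarrow> complex) \<Rightarrow> complex \<Rightarrow> complex"
  where "cauchy_part F z = (\<integral>\<zeta>. F \<zeta> * (1 / (\<zeta> - z)) \<partial>lborel)"

definition reflected_part :: "(complex \<Rightarrow> complex) \<Rightarrow> complex \<Rightarrow> complex"
  where "reflected_part F z = (\<integral>\<zeta>. cnj (F \<zeta>) * (z / (1 - z * cnj \<zeta>)) \<partial>lborel)"

lemma norm_one_minus_mult_cnj_ge:
  assumes "norm \<zeta> < 1"
  shows "1 - norm z \<le> norm (1 - z * cnj \<zeta>)"
proof -
  have "norm (z * cnj \<zeta>) \<le> norm z"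
    using assms by (simp add: norm_mult mult_left_le)
  then show ?thesis
    using norm_triangle_ineq2[of 1 "z * cnj \<zeta>"] by simp
qed

lemma norm_reflected_kernel_le:
  assumes "norm \<zeta> < 1" "norm z \<le> R" "R < 1"
  shows "norm (z / (1 - z * cnj \<zeta>)) \<le> 1 / (1 - R)"
  unfolding norm_divide using assms norm_one_minus_mult_cnj_ge[of \<zeta> z]
  by (intro frac_le) auto

text \<open>The Cauchy kernel has bounded mass over the disk, uniformly in \<zeta>, so an integrable
  \<open>F\<close> and a bounded \<open>g\<close> suffice. With an indicator as \<open>g\<close>,
  the last conclusion is convergence of the Cauchy integral almost everywhere on that set.\<close>

lemma cauchy_part_Fubini:
  assumes F: "integrable lborel F"
    and g [measurable]: "g \<in> borel_measurable borel"
    and B: "\<And>z. norm (g z) \<le> B" and zero: "\<And>z. z \<notin> unit_disk \<Longrightarrow> g z = 0"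
  shows "integrable lborel (\<lambda>z. g z * cauchy_part F z)"
    and "(\<integral>z. g z * cauchy_part F z \<partial>lborel) =
      (\<integral>\<zeta>. F \<zeta> * (\<integral>z. g z * (1 / (\<zeta> - z)) \<partial>lborel) \<partial>lborel)"
    and "AE z in lborel. g z \<noteq> 0 \<longrightarrow> integrable lborel (\<lambda>\<zeta>. F \<zeta> * (1 / (\<zeta> - z)))"
proof -
  have [measurable]: "F \<in> borel_measurable borel"
    using F by auto
  have [measurable]: "unit_disk \<in> sets borel"
    by simp
  have B0: "0 \<le> B"
    using order_trans[OF norm_ge_zero B[of 0]] .
  let ?k = "\<lambda>\<zeta> z. F \<zeta> * (g z * (1 / (\<zeta> - z)))"
  have int: "integrable (lborel \<Otimes>\<^sub>M lborel) (case_prod ?k)"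
  proof (rule lborel_pair.integrable_mult_kernel[OF F])
    fix \<zeta>
    have "(\<integral>\<^sup>+z. norm (g z * (1 / (\<zeta> - z))) \<partial>lborel) \<le>
        (\<integral>\<^sup>+z. ennreal B * (ennreal (norm (1 / (\<zeta> - z))) * indicator unit_disk z) \<partial>lborel)"
    proof (rule nn_integral_mono)
      fix z
      have "norm (g z * (1 / (\<zeta> - z))) \<le> B * norm (1 / (\<zeta> - z))"
        unfolding norm_mult by (intro mult_right_mono B) auto
      then show "ennreal (norm (g z * (1 / (\<zeta> - z)))) \<le>
          ennreal B * (ennreal (norm (1 / (\<zeta> - z))) * indicator unit_disk z)"
        using B0 zero[of z]
        by (cases "z \<in> unit_disk") (auto simp: ennreal_mult'[symmetric] intro!: ennreal_leI)
    qed
    also have "\<dots> \<le> ennreal B * ennreal 36"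
      by (subst nn_integral_cmult)
        (auto simp del: ennreal_numeral intro!: mult_left_mono nn_integral_cauchy_kernel)
    finally show "(\<integral>\<^sup>+z. norm (g z * (1 / (\<zeta> - z))) \<partial>lborel) \<le> ennreal (B * 36)"
      using B0 by (simp add: ennreal_mult')
  qed measurable
  have eq: "(\<integral>\<zeta>. ?k \<zeta> z \<partial>lborel) = g z * cauchy_part F z" for z
    unfolding cauchy_part_def by (subst integral_mult_right_zero[symmetric]) (simp add: mult_ac)
  show "integrable lborel (\<lambda>z. g z * cauchy_part F z)"
    using lborel_pair.integrable_snd[OF int] by (simp only: eq)
  show "(\<integral>z. g z * cauchy_part F z \<partial>lborel) =
      (\<integral>\<zeta>. F \<zeta> * (\<integral>z. g z * (1 / (\<zeta> - z)) \<partial>lborel) \<partial>lborel)"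
    using lborel_pair.Fubini_integral[OF int] by (simp only: eq integral_mult_right_zero)
  show "AE z in lborel. g z \<noteq> 0 \<longrightarrow> integrable lborel (\<lambda>\<zeta>. F \<zeta> * (1 / (\<zeta> - z)))"
    using lborel_pair.AE_integrable_snd[OF int]
  proof eventually_elim
    case (elim z)
    show ?case
    proof
      assume "g z \<noteq> 0"
      then have "(\<lambda>\<zeta>. F \<zeta> * (1 / (\<zeta> - z))) = (\<lambda>\<zeta>. inverse (g z) * ?k \<zeta> z)"
        by (simp add: fun_eq_iff)
      then show "integrable lborel (\<lambda>\<zeta>. F \<zeta> * (1 / (\<zeta> - z)))"
        using integrable_mult_right[OF elim, of "inverse (g z)"] by (simp only:)
    qed
  qed
qed

text \<open>The denominator \<open>1 - z * cnj \<zeta>\<close> degenerates only when both points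
  approach the circle; the support of \<open>g\<close> in radius \<open>R < 1\<close> keeps it at
  least \<open>1 - R\<close>.\<close>

lemma reflected_part_Fubini:
  assumes F: "integrable lborel F" and F0: "\<And>\<zeta>. norm \<zeta> \<ge> 1 \<Longrightarrow> F \<zeta> = 0"
    and g [measurable]: "g \<in> borel_measurable borel" and int_g: "integrable lborel g"
    and R: "R < 1" and zero: "\<And>z. norm z > R \<Longrightarrow> g z = 0"
  shows "integrable lborel (\<lambda>z. g z * reflected_part F z)"
    and "(\<integral>z. g z * reflected_part F z \<partial>lborel) =
      (\<integral>\<zeta>. cnj (F \<zeta>) * (\<integral>z. g z * (z / (1 - z * cnj \<zeta>)) \<partial>lborel) \<partial>lborel)"
proof -
  have [measurable]: "F \<in> borel_measurable borel"
    using F by auto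
  let ?k = "\<lambda>\<zeta> z. cnj (F \<zeta>) * (g z * (z / (1 - z * cnj \<zeta>)))"
  have int: "integrable (lborel \<Otimes>\<^sub>M lborel) (case_prod ?k)"
  proof (rule lborel_pair.integrable_mult_kernel)
    show "integrable lborel (\<lambda>\<zeta>. cnj (F \<zeta>))"
      using F by simp
    fix \<zeta> assume "cnj (F \<zeta>) \<noteq> 0"
    then have \<zeta>: "norm \<zeta> < 1"
      using F0[of \<zeta>] by force
    have "(\<integral>\<^sup>+z. norm (g z * (z / (1 - z * cnj \<zeta>))) \<partial>lborel) \<le>
        (\<integral>\<^sup>+z. norm (g z * of_real (1 / (1 - R))) \<partial>lborel)"
    proof (intro nn_integral_mono ennreal_leI)
      fix z
      have "norm (z / (1 - z * cnj \<zeta>)) \<le> 1 / (1 - R) \<or> g z = 0"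
        using norm_reflected_kernel_le[OF \<zeta> _ R, of z] zero[of z] by force
      then show "norm (g z * (z / (1 - z * cnj \<zeta>))) \<le> norm (g z * of_real (1 / (1 - R)))"
        using R mult_left_mono[OF _ norm_ge_zero[of "g z"]] unfolding norm_mult norm_of_real by force
    qed
    also have "\<dots> = ennreal (\<integral>z. norm (g z * of_real (1 / (1 - R))) \<partial>lborel)"
      using int_g by (intro nn_integral_eq_integral) auto
    finally show "(\<integral>\<^sup>+z. norm (g z * (z / (1 - z * cnj \<zeta>))) \<partial>lborel) \<le> \<dots>" .
  qed measurable
  have eq: "(\<integral>\<zeta>. ?k \<zeta> z \<partial>lborel) = g z * reflected_part F z" for z
    unfolding reflected_part_def by (subst integral_mult_right_zero[symmetric]) (simp add: mult_ac)
  show "integrable lborel (\<lambda>z. g z * reflected_part F z)"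
    using lborel_pair.integrable_snd[OF int] by (simp only: eq)
  show "(\<integral>z. g z * reflected_part F z \<partial>lborel) =
      (\<integral>\<zeta>. cnj (F \<zeta>) * (\<integral>z. g z * (z / (1 - z * cnj \<zeta>)) \<partial>lborel) \<partial>lborel)"
    using lborel_pair.Fubini_integral[OF int] by (simp only: eq integral_mult_right_zero)
qed

lemma schwarz_integrand_split:
  assumes "\<zeta> \<noteq> 0" "\<zeta> \<noteq> z" "norm \<zeta> < 1" "norm z < 1"
  shows "schwarz_integrand f z \<zeta> = - 2 * \<i> * of_real (Im (f \<zeta> / \<zeta>)) + 2 * (f \<zeta> * (1 / (\<zeta> - z)))
    + 2 * (cnj (f \<zeta>) * (z / (1 - z * cnj \<zeta>)))"
proof -
  have nz: "1 - z * cnj \<zeta> \<noteq> 0"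
    using norm_one_minus_mult_cnj_ge[of \<zeta> z] assms by auto
  \<comment> \<open>Splitting off the constants -1 and 1 leaves numerators divisible by \<zeta> and
    \<open>cnj \<zeta>\<close>, which cancel the poles at 0; the constants themselves collect into
    \<open>-q + cnj q\<close> with \<open>q = f \<zeta> / \<zeta>\<close>.\<close>
  have "(\<zeta> + z) / (\<zeta> - z) = - 1 + 2 * \<zeta> / (\<zeta> - z)"
    using assms(2) by (simp add: field_simps)
  then have 1: "f \<zeta> / \<zeta> * ((\<zeta> + z) / (\<zeta> - z)) = - (f \<zeta> / \<zeta>) + 2 * (f \<zeta> * (1 / (\<zeta> - z)))"
    using assms(1) by (simp only: distrib_left) simp
  have "(1 + z * cnj \<zeta>) / (1 - z * cnj \<zeta>) = 1 + 2 * z * cnj \<zeta> / (1 - z * cnj \<zeta>)"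
    using nz by (simp add: field_simps)
  then have 2: "cnj (f \<zeta>) / cnj \<zeta> * ((1 + z * cnj \<zeta>) / (1 - z * cnj \<zeta>)) =
      cnj (f \<zeta>) / cnj \<zeta> + 2 * (cnj (f \<zeta>) * (z / (1 - z * cnj \<zeta>)))"
    using assms(1) by (simp only: distrib_left) simp
  have "- q + cnj q = - 2 * \<i> * of_real (Im q)" for q
    by (simp add: complex_eq_iff)
  from this[of "f \<zeta> / \<zeta>"] show ?thesis
    unfolding schwarz_integrand_def 1 2 by (simp add: algebra_simps)
qed

text \<open>Convergence of the formula at a single \<open>z\<close> where the Cauchy transform converges forces
  \<open>Im (f/\<zeta>)\<close> to be integrable; \<open>J\<close> is its integral.\<close>

lemma schwarz_integral_representation:
  assumes f: "set_integrable lebesgue unit_disk f" and def: "schwarz_formula_defined f"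
  obtains F J where "integrable lborel F" "\<forall>\<zeta>. norm \<zeta> \<ge> 1 \<longrightarrow> F \<zeta> = 0"
    "AE \<zeta> in lborel. indicator unit_disk \<zeta> *\<^sub>R f \<zeta> = F \<zeta>"
    "\<forall>z\<in>unit_disk. integrable lborel (\<lambda>\<zeta>. F \<zeta> * (1 / (\<zeta> - z))) \<longrightarrow>
      (LINT \<zeta>:unit_disk|lebesgue. schwarz_integrand f z \<zeta>) =
      - 2 * \<i> * of_real J + 2 * cauchy_part F z + 2 * reflected_part F z"
proof -
  have "(\<lambda>\<zeta>. indicator unit_disk \<zeta> *\<^sub>R f \<zeta>) \<in> borel_measurable lebesgue"
    using f by (auto simp: set_integrable_def)
  then obtain G where G [measurable]: "G \<in> borel_measurable borel"
    and aeG: "AE \<zeta> in lborel. indicator unit_disk \<zeta> *\<^sub>R f \<zeta> = G \<zeta>"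
    using lebesgue_complex_borel_representative by blast
  have [measurable]: "unit_disk \<in> sets borel"
    by simp
  define F where "F \<zeta> = indicator unit_disk \<zeta> *\<^sub>R G \<zeta>" for \<zeta>
  have [measurable]: "F \<in> borel_measurable borel"
    unfolding F_def by measurable
  have aeF: "AE \<zeta> in lborel. indicator unit_disk \<zeta> *\<^sub>R f \<zeta> = F \<zeta>"
    using aeG by eventually_elim (auto simp: F_def indicator_def)
  have F: "integrable lborel F"
    using f lebesgue_AE_eq_borel(2)[OF _ aeF] by (simp add: set_integrable_def)
  have F0: "F \<zeta> = 0" if "norm \<zeta> \<ge> 1" for \<zeta>
    using that by (simp add: F_def)
  define S where "S z \<zeta> = - 2 * \<i> * of_real (Im (F \<zeta> / \<zeta>)) + 2 * (F \<zeta> * (1 / (\<zeta> - z)))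
    + 2 * (cnj (F \<zeta>) * (z / (1 - z * cnj \<zeta>)))" for z \<zeta>
  have [measurable]: "S z \<in> borel_measurable borel" for z
    unfolding S_def by measurable
  have aeS: "AE \<zeta> in lborel. indicator unit_disk \<zeta> *\<^sub>R schwarz_integrand f z \<zeta> = S z \<zeta>"
    if z: "z \<in> unit_disk" for z
    using aeF AE_lborel_singleton[of 0] AE_lborel_singleton[of z]
  proof eventually_elim
    case (elim \<zeta>)
    show ?case
    proof (cases "\<zeta> \<in> unit_disk")
      case True
      then have "f \<zeta> = F \<zeta>"
        using elim(1) by simp
      then show ?thesis
        using schwarz_integrand_split[of \<zeta> z f] elim(2,3) True z by (simp add: S_def)
    next
      case False
      then show ?thesis
        using F0[of \<zeta>] by (simp add: S_def)
    qed
  qed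
  have refl: "integrable lborel (\<lambda>\<zeta>. cnj (F \<zeta>) * (z / (1 - z * cnj \<zeta>)))" if z: "z \<in> unit_disk" for z
  proof (rule Bochner_Integration.integrable_bound)
    show "integrable lborel (\<lambda>\<zeta>. F \<zeta> * of_real (1 / (1 - norm z)))"
      using F by simp
    show "AE \<zeta> in lborel. norm (cnj (F \<zeta>) * (z / (1 - z * cnj \<zeta>))) \<le> norm (F \<zeta> * of_real (1 / (1 - norm z)))"
    proof (rule AE_I2)
      fix \<zeta>
      have "norm (z / (1 - z * cnj \<zeta>)) \<le> 1 / (1 - norm z) \<or> F \<zeta> = 0"
        using norm_reflected_kernel_le[of \<zeta> z "norm z"] F0[of \<zeta>] z by force
      then show "norm (cnj (F \<zeta>) * (z / (1 - z * cnj \<zeta>))) \<le> norm (F \<zeta> * of_real (1 / (1 - norm z)))"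
        using z mult_left_mono[OF _ norm_ge_zero[of "F \<zeta>"]] unfolding norm_mult norm_of_real by force
    qed
  qed measurable
  have "AE z in lborel. indicat_real unit_disk z \<noteq> 0 \<longrightarrow> integrable lborel (\<lambda>\<zeta>. F \<zeta> * (1 / (\<zeta> - z)))"
    using cauchy_part_Fubini(3)[OF F, of "\<lambda>z. of_real (indicat_real unit_disk z)" 1] by (auto simp: indicator_def)
  moreover have "AE z in lborel. z \<in> unit_disk \<longrightarrow> set_integrable lebesgue unit_disk (schwarz_integrand f z)"
    using def by (simp add: schwarz_formula_defined_def AE_completion_iff)
  ultimately have "AE z in lborel. z \<in> unit_disk \<longrightarrow> integrable lborel (\<lambda>\<zeta>. F \<zeta> * (1 / (\<zeta> - z))) \<and>
      set_integrable lebesgue unit_disk (schwarz_integrand f z)"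
    by eventually_elim auto
  then obtain z0 where "z0 \<in> unit_disk" "integrable lborel (\<lambda>\<zeta>. F \<zeta> * (1 / (\<zeta> - z0))) \<and>
      set_integrable lebesgue unit_disk (schwarz_integrand f z0)"
    by (rule AE_unit_disk_witness)
  then have z0: "z0 \<in> unit_disk" "integrable lborel (\<lambda>\<zeta>. F \<zeta> * (1 / (\<zeta> - z0)))"
    "set_integrable lebesgue unit_disk (schwarz_integrand f z0)"
    by simp_all
  have "integrable lborel (S z0)"
    using z0(3) lebesgue_AE_eq_borel(2)[OF _ aeS[OF z0(1)]] by (simp add: set_integrable_def)
  then have "integrable lborel (\<lambda>\<zeta>. S z0 \<zeta> - 2 * (F \<zeta> * (1 / (\<zeta> - z0))) - 2 * (cnj (F \<zeta>) * (z0 / (1 - z0 * cnj \<zeta>))))"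
    using z0(2) refl[OF z0(1)] by (intro Bochner_Integration.integrable_diff integrable_mult_right)
  \<comment> \<open>This remainder contains no \<open>z\<close>, so its integrability, found at the
    one point \<open>z0\<close>, is available at every other point.\<close>
  then have im: "integrable lborel (\<lambda>\<zeta>. - 2 * \<i> * of_real (Im (F \<zeta> / \<zeta>)))"
    by (simp add: S_def)
  define J where "J = (\<integral>\<zeta>. Im (F \<zeta> / \<zeta>) \<partial>lborel)"
  have "(LINT \<zeta>:unit_disk|lebesgue. schwarz_integrand f z \<zeta>) =
      - 2 * \<i> * of_real J + 2 * cauchy_part F z + 2 * reflected_part F z"
    if z: "z \<in> unit_disk" and int: "integrable lborel (\<lambda>\<zeta>. F \<zeta> * (1 / (\<zeta> - z)))" for z
  proof -
    have "(LINT \<zeta>:unit_disk|lebesgue. schwarz_integrand f z \<zeta>) = (\<integral>\<zeta>. S z \<zeta> \<partial>lborel)"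
      using lebesgue_AE_eq_borel(3)[OF _ aeS[OF z]] by (simp add: set_lebesgue_integral_def)
    also have "\<dots> = (\<integral>\<zeta>. - 2 * \<i> * of_real (Im (F \<zeta> / \<zeta>)) \<partial>lborel) + (\<integral>\<zeta>. 2 * (F \<zeta> * (1 / (\<zeta> - z))) \<partial>lborel)
        + (\<integral>\<zeta>. 2 * (cnj (F \<zeta>) * (z / (1 - z * cnj \<zeta>))) \<partial>lborel)"
    proof -
      have 2: "integrable lborel (\<lambda>\<zeta>. 2 * (F \<zeta> * (1 / (\<zeta> - z))))"
        using int by (intro integrable_mult_right)
      have 3: "integrable lborel (\<lambda>\<zeta>. 2 * (cnj (F \<zeta>) * (z / (1 - z * cnj \<zeta>))))"
        using refl[OF z] by (intro integrable_mult_right)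
      show ?thesis
        unfolding S_def by (simp only: Bochner_Integration.integral_add[OF Bochner_Integration.integrable_add[OF im 2] 3]
            Bochner_Integration.integral_add[OF im 2])
    qed
    also have "\<dots> = - 2 * \<i> * of_real J + 2 * cauchy_part F z + 2 * reflected_part F z"
      by (simp only: integral_mult_right_zero integral_complex_of_real J_def cauchy_part_def reflected_part_def)
    finally show ?thesis .
  qed
  then show ?thesis
    using that[OF F _ aeF] F0 by blast
qed

section \<open>The potentials on a single circle\<close>

lemma circle_tests_bounded_linear:
  assumes "bounded_linear L" "\<phi> \<in> circle_tests"
  shows "(\<lambda>t. L (\<phi> t)) \<in> circle_tests"
  using assms smooth_bounded_linear by (auto simp: circle_tests_def)

text \<open>The premise \<open>int\<close> concerns the bare kernel, and a bounded \<phi> preserves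
  integrability, so one good radius serves every test function. The last conclusion provides
  convergence of the Cauchy integral at almost every point of this particular circle.\<close>

lemma cauchy_part_circle:
  assumes F: "integrable lborel F"
    and int: "integrable (lborel \<Otimes>\<^sub>M lborel)
      (\<lambda>(\<zeta>, \<theta>). F \<zeta> * (indicator {0..2*pi} \<theta> *\<^sub>R (1 / (\<zeta> - of_real r * cis \<theta>))))"
    and \<phi> [measurable]: "\<phi> \<in> borel_measurable borel" and B: "\<And>t. norm (\<phi> t) \<le> B"
  shows "integrable lborel (\<lambda>\<theta>. indicator {0..2*pi} \<theta> *\<^sub>R (cauchy_part F (of_real r * cis \<theta>) * \<phi> \<theta>))"
    and "(\<integral>\<theta>. indicator {0..2*pi} \<theta> *\<^sub>R (cauchy_part F (of_real r * cis \<theta>) * \<phi> \<theta>) \<partial>lborel) =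
      (\<integral>\<zeta>. F \<zeta> * circle_kernel \<phi> r \<zeta> \<partial>lborel)"
    and "AE \<theta> in lborel. \<theta> \<in> {0..2*pi} \<longrightarrow> integrable lborel (\<lambda>\<zeta>. F \<zeta> * (1 / (\<zeta> - of_real r * cis \<theta>)))"
proof -
  have [measurable]: "F \<in> borel_measurable borel"
    using F by auto
  let ?k = "\<lambda>\<zeta> \<theta>. F \<zeta> * (indicator {0..2*pi} \<theta> *\<^sub>R (\<phi> \<theta> * (1 / (\<zeta> - of_real r * cis \<theta>))))"
  have int': "integrable (lborel \<Otimes>\<^sub>M lborel) (case_prod ?k)"
  proof (rule Bochner_Integration.integrable_bound[OF integrable_mult_right[OF int, of "of_real B"]])
    show "AE p in lborel \<Otimes>\<^sub>M lborel. norm (case_prod ?k p) \<le> norm (of_real B *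
        (case p of (\<zeta>, \<theta>) \<Rightarrow> F \<zeta> * (indicator {0..2*pi} \<theta> *\<^sub>R (1 / (\<zeta> - of_real r * cis \<theta>)))))"
    proof (rule AE_I2)
      fix p :: "complex \<times> real"
      obtain \<zeta> \<theta> where p: "p = (\<zeta>, \<theta>)"
        by (cases p)
      have "norm (?k \<zeta> \<theta>) = norm (\<phi> \<theta>) * norm (F \<zeta> * (indicator {0..2*pi} \<theta> *\<^sub>R (1 / (\<zeta> - of_real r * cis \<theta>))))"
        by (simp add: norm_mult norm_divide)
      also have "\<dots> \<le> \<bar>B\<bar> * norm (F \<zeta> * (indicator {0..2*pi} \<theta> *\<^sub>R (1 / (\<zeta> - of_real r * cis \<theta>))))"
        using B[of \<theta>] by (intro mult_right_mono) auto
      finally show "norm (case_prod ?k p) \<le> norm (of_real B *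
          (case p of (\<zeta>, \<theta>) \<Rightarrow> F \<zeta> * (indicator {0..2*pi} \<theta> *\<^sub>R (1 / (\<zeta> - of_real r * cis \<theta>)))))"
        by (simp only: p prod.case norm_mult norm_of_real)
    qed
  qed measurable
  have eq: "(\<integral>\<zeta>. ?k \<zeta> \<theta> \<partial>lborel) = indicator {0..2*pi} \<theta> *\<^sub>R (cauchy_part F (of_real r * cis \<theta>) * \<phi> \<theta>)" for \<theta>
  proof -
    have "(\<integral>\<zeta>. ?k \<zeta> \<theta> \<partial>lborel) = (\<integral>\<zeta>. (of_real (indicator {0..2*pi} \<theta>) * \<phi> \<theta>) * (F \<zeta> * (1 / (\<zeta> - of_real r * cis \<theta>))) \<partial>lborel)"
      by (simp only: scaleR_conv_of_real mult_ac)
    also have "\<dots> = (of_real (indicator {0..2*pi} \<theta>) * \<phi> \<theta>) * cauchy_part F (of_real r * cis \<theta>)"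
      unfolding cauchy_part_def by (rule integral_mult_right_zero)
    finally show ?thesis
      by (simp only: scaleR_conv_of_real mult_ac)
  qed
  show "integrable lborel (\<lambda>\<theta>. indicator {0..2*pi} \<theta> *\<^sub>R (cauchy_part F (of_real r * cis \<theta>) * \<phi> \<theta>))"
    using lborel_pair.integrable_snd[OF int'] by (simp only: eq)
  show "(\<integral>\<theta>. indicator {0..2*pi} \<theta> *\<^sub>R (cauchy_part F (of_real r * cis \<theta>) * \<phi> \<theta>) \<partial>lborel) =
      (\<integral>\<zeta>. F \<zeta> * circle_kernel \<phi> r \<zeta> \<partial>lborel)"
    using lborel_pair.Fubini_integral[OF int'] by (simp only: eq integral_mult_right_zero circle_kernel_def)
  show "AE \<theta> in lborel. \<theta> \<in> {0..2*pi} \<longrightarrow> integrable lborel (\<lambda>\<zeta>. F \<zeta> * (1 / (\<zeta> - of_real r * cis \<theta>)))"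
    using lborel_pair.AE_integrable_snd[OF int] by eventually_elim auto
qed

text \<open>The reflected kernel is the conjugate of the Cauchy kernel at the reflected radius \<open>1/r\<close>.\<close>

lemma reflected_part_circle:
  assumes F: "integrable lborel F" and F0: "\<And>\<zeta>. norm \<zeta> \<ge> 1 \<Longrightarrow> F \<zeta> = 0"
    and r: "0 < r" "r < 1"
    and \<phi> [measurable]: "\<phi> \<in> borel_measurable borel" and B: "\<And>t. norm (\<phi> t) \<le> B"
  shows "integrable lborel (\<lambda>\<theta>. indicator {0..2*pi} \<theta> *\<^sub>R (reflected_part F (of_real r * cis \<theta>) * \<phi> \<theta>))"
    and "(\<integral>\<theta>. indicator {0..2*pi} \<theta> *\<^sub>R (reflected_part F (of_real r * cis \<theta>) * \<phi> \<theta>) \<partial>lborel) =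
      - cnj (\<integral>\<zeta>. F \<zeta> * circle_kernel (\<lambda>t. cnj (\<phi> t)) (1 / r) \<zeta> \<partial>lborel)"
proof -
  have [measurable]: "F \<in> borel_measurable borel"
    using F by auto
  have B0: "0 \<le> B"
    using order_trans[OF norm_ge_zero B[of 0]] .
  define g where "g z \<zeta> = z / (1 - z * cnj \<zeta>)" for z \<zeta> :: complex
  have [measurable]: "case_prod (\<lambda>\<zeta> \<theta>. g (of_real r * cis \<theta>) \<zeta>) \<in> borel_measurable (lborel \<Otimes>\<^sub>M lborel)"
    unfolding g_def by measurable
  let ?k = "\<lambda>\<zeta> \<theta>. cnj (F \<zeta>) * (indicator {0..2*pi} \<theta> *\<^sub>R (\<phi> \<theta> * g (of_real r * cis \<theta>) \<zeta>))"
  have int: "integrable (lborel \<Otimes>\<^sub>M lborel) (case_prod ?k)"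
  proof (rule lborel_pair.integrable_mult_kernel)
    show "integrable lborel (\<lambda>\<zeta>. cnj (F \<zeta>))"
      using F by simp
    fix \<zeta> assume "cnj (F \<zeta>) \<noteq> 0"
    then have \<zeta>: "norm \<zeta> < 1"
      using F0[of \<zeta>] by force
    have "(\<integral>\<^sup>+\<theta>. norm (indicator {0..2*pi} \<theta> *\<^sub>R (\<phi> \<theta> * g (of_real r * cis \<theta>) \<zeta>)) \<partial>lborel) \<le>
        (\<integral>\<^sup>+\<theta>. ennreal (B * (1 / (1 - r))) * indicator {0..2*pi} \<theta> \<partial>lborel)"
    proof (rule nn_integral_mono)
      fix \<theta>
      have "norm (\<phi> \<theta> * g (of_real r * cis \<theta>) \<zeta>) \<le> B * (1 / (1 - r))"
        unfolding norm_mult g_def using r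
        by (intro mult_mono B norm_reflected_kernel_le \<zeta> B0) (auto simp: norm_mult)
      then show "ennreal (norm (indicator {0..2*pi} \<theta> *\<^sub>R (\<phi> \<theta> * g (of_real r * cis \<theta>) \<zeta>))) \<le>
          ennreal (B * (1 / (1 - r))) * indicator {0..2*pi} \<theta>"
        by (auto simp: indicator_def intro!: ennreal_leI)
    qed
    also have "\<dots> = ennreal (B * (1 / (1 - r)) * (2 * pi))"
      using B0 r by (simp add: nn_integral_cmult_indicator ennreal_mult[symmetric])
    finally show "(\<integral>\<^sup>+\<theta>. norm (indicator {0..2*pi} \<theta> *\<^sub>R (\<phi> \<theta> * g (of_real r * cis \<theta>) \<zeta>)) \<partial>lborel) \<le> \<dots>" .
  qed measurable
  have eq: "(\<integral>\<zeta>. ?k \<zeta> \<theta> \<partial>lborel) = indicator {0..2*pi} \<theta> *\<^sub>R (reflected_part F (of_real r * cis \<theta>) * \<phi> \<theta>)" for \<theta>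
  proof -
    have "(\<integral>\<zeta>. ?k \<zeta> \<theta> \<partial>lborel) = (\<integral>\<zeta>. (of_real (indicator {0..2*pi} \<theta>) * \<phi> \<theta>) * (cnj (F \<zeta>) * g (of_real r * cis \<theta>) \<zeta>) \<partial>lborel)"
      by (simp only: scaleR_conv_of_real mult_ac)
    also have "\<dots> = (of_real (indicator {0..2*pi} \<theta>) * \<phi> \<theta>) * reflected_part F (of_real r * cis \<theta>)"
      unfolding reflected_part_def g_def by (rule integral_mult_right_zero)
    finally show ?thesis
      by (simp only: scaleR_conv_of_real mult_ac)
  qed
  have g: "g (of_real r * cis \<theta>) \<zeta> = - cnj (1 / (\<zeta> - of_real (1 / r) * cis \<theta>))" for \<theta> \<zeta>
  proof -
    have u: "cis \<theta> * cnj (cis \<theta>) = 1"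
      using complex_norm_square[of "cis \<theta>"] by simp
    have "1 - of_real r * cis \<theta> * cnj \<zeta> = of_real r * cis \<theta> * (of_real (1 / r) * cnj (cis \<theta>) - cnj \<zeta>)"
      using r u by (simp add: algebra_simps)
    then have "g (of_real r * cis \<theta>) \<zeta> = 1 / (of_real (1 / r) * cnj (cis \<theta>) - cnj \<zeta>)"
      using r by (simp add: g_def)
    also have "\<dots> = - cnj (1 / (\<zeta> - of_real (1 / r) * cis \<theta>))"
      by (simp add: minus_divide_right)
    finally show ?thesis .
  qed
  have "(\<integral>\<theta>. indicator {0..2*pi} \<theta> *\<^sub>R (\<phi> \<theta> * g (of_real r * cis \<theta>) \<zeta>) \<partial>lborel) =
      - cnj (circle_kernel (\<lambda>t. cnj (\<phi> t)) (1 / r) \<zeta>)" for \<zeta>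
  proof -
    have "indicator {0..2*pi} \<theta> *\<^sub>R (\<phi> \<theta> * g (of_real r * cis \<theta>) \<zeta>) =
        - cnj (indicator {0..2*pi} \<theta> *\<^sub>R (cnj (\<phi> \<theta>) * (1 / (\<zeta> - of_real (1 / r) * cis \<theta>))))" for \<theta>
      by (simp add: g)
    then show ?thesis
      unfolding circle_kernel_def by (simp only: integral_minus Bochner_Integration.integral_cnj)
  qed
  then have k: "(\<integral>\<theta>. ?k \<zeta> \<theta> \<partial>lborel) = - cnj (F \<zeta> * circle_kernel (\<lambda>t. cnj (\<phi> t)) (1 / r) \<zeta>)" for \<zeta>
    by (simp only: integral_mult_right_zero complex_cnj_mult mult_minus_right)
  show "integrable lborel (\<lambda>\<theta>. indicator {0..2*pi} \<theta> *\<^sub>R (reflected_part F (of_real r * cis \<theta>) * \<phi> \<theta>))"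
    using lborel_pair.integrable_snd[OF int] by (simp only: eq)
  show "(\<integral>\<theta>. indicator {0..2*pi} \<theta> *\<^sub>R (reflected_part F (of_real r * cis \<theta>) * \<phi> \<theta>) \<partial>lborel) =
      - cnj (\<integral>\<zeta>. F \<zeta> * circle_kernel (\<lambda>t. cnj (\<phi> t)) (1 / r) \<zeta> \<partial>lborel)"
    using lborel_pair.Fubini_integral[OF int] by (simp only: eq k integral_minus Bochner_Integration.integral_cnj)
qed

section \<open>The differential equation and the boundary value\<close>

lemma holomorphic_mult_disk_integrable:
  assumes H: "H holomorphic_on unit_disk" and K: "compact K" "K \<subseteq> unit_disk"
    and g: "continuous_on K g" and zero: "\<And>z. z \<notin> K \<Longrightarrow> g z = 0"
  shows "integrable lborel (\<lambda>z. g z * H z)"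
proof -
  have "integrable lborel (\<lambda>z. indicator K z *\<^sub>R (g z * H z))"
    using K holomorphic_on_imp_continuous_on[OF H]
    by (intro borel_integrable_compact continuous_on_mult g) (auto intro: continuous_on_subset)
  moreover have "(\<lambda>z. indicator K z *\<^sub>R (g z * H z)) = (\<lambda>z. g z * H z)"
    using zero by (auto simp: fun_eq_iff indicator_def)
  ultimately show ?thesis
    by simp
qed

text \<open>Fubini moves \<open>dbar \<phi>\<close> onto the kernels, so the claim is settled for
  each \<zeta> separately: Cauchy-Pompeiu gives \<open>pi * \<phi> \<zeta>\<close> for the Cauchy
  kernel and the reflected kernel gives 0. Dividing by \<open>-pi\<close> yields the right-hand
  side.\<close>

lemma weak_dbar_eq_potential:
  assumes H: "H holomorphic_on unit_disk"
    and F: "integrable lborel F" and F0: "\<And>\<zeta>. norm \<zeta> \<ge> 1 \<Longrightarrow> F \<zeta> = 0"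
    and f: "AE z in lborel. indicator unit_disk z *\<^sub>R f z = F z"
    and w: "AE z in lborel. z \<in> unit_disk \<longrightarrow>
      w z = H z - (cauchy_part F z + reflected_part F z) / of_real pi"
  shows "weak_dbar_eq w f"
  unfolding weak_dbar_eq_def
proof (intro conjI allI impI ballI)
  fix K :: "complex set" assume K: "compact K \<and> K \<subseteq> unit_disk"
  then obtain R where R: "0 \<le> R" "R < 1" "K \<subseteq> cball 0 R"
    by (elim conjE compact_subset_unit_disk)
  have [measurable]: "K \<in> sets borel"
    using K by (simp add: borel_compact)
  let ?g = "indicator K :: complex \<Rightarrow> complex"
  have "integrable lborel (\<lambda>z. indicator K z *\<^sub>R (1 :: complex))"
    using K by (intro borel_integrable_compact) auto
  also have "(\<lambda>z. indicator K z *\<^sub>R (1 :: complex)) = ?g"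
    by (auto simp: indicator_def)
  finally have "integrable lborel (\<lambda>z. ?g z * reflected_part F z)"
    using R by (intro reflected_part_Fubini[OF F F0, of _ R]) (auto simp: indicator_def)
  moreover have "integrable lborel (\<lambda>z. ?g z * cauchy_part F z)"
    using K by (intro cauchy_part_Fubini[OF F, of _ 1]) (auto simp: indicator_def)
  moreover have "integrable lborel (\<lambda>z. ?g z * H z)"
    by (rule holomorphic_mult_disk_integrable[OF H]) (use K in \<open>auto cong: continuous_on_cong\<close>)
  ultimately have int: "integrable lborel (\<lambda>z. ?g z * H z -
      (?g z * cauchy_part F z + ?g z * reflected_part F z) / of_real pi)"
    by (intro Bochner_Integration.integrable_diff Bochner_Integration.integrable_add integrable_divide)
  have "AE z in lborel. indicator K z *\<^sub>R w z = ?g z * H z -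
      (?g z * cauchy_part F z + ?g z * reflected_part F z) / of_real pi"
    using w by eventually_elim (use K in \<open>auto simp: indicator_def\<close>)
  then show "set_integrable lebesgue K w"
    unfolding set_integrable_def using int by (subst lebesgue_AE_eq_borel(2)) auto
next
  fix \<phi> assume \<phi>: "\<phi> \<in> disk_tests"
  have sm: "smooth \<phi>"
    using \<phi> by (simp add: disk_tests_def)
  obtain R where R: "0 \<le> R" "R < 1" "\<And>z. R < norm z \<Longrightarrow> dbar \<phi> z = 0"
    using dbar_disk_test(2)[OF \<phi>] by blast
  obtain B where B: "\<And>z. norm (dbar \<phi> z) \<le> B"
    using dbar_disk_test(3)[OF \<phi>] by blast
  have zero: "dbar \<phi> z = 0" if "z \<notin> unit_disk" for z
    using R that by auto
  have [measurable]: "\<phi> \<in> borel_measurable borel" "dbar \<phi> \<in> borel_measurable borel"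
    by (intro borel_measurable_continuous_onI smooth_continuous_on sm dbar_disk_test(1)[OF \<phi>])+
  have [measurable]: "F \<in> borel_measurable borel"
    using F by auto
  have hol: "integrable lborel (\<lambda>z. dbar \<phi> z * H z)"
    using R by (intro holomorphic_mult_disk_integrable[OF H, of "cball 0 R"] dbar_disk_test(1)[OF \<phi>]) auto
  have "integrable lborel (\<lambda>z. indicator (cball 0 R) z *\<^sub>R dbar \<phi> z)"
    by (intro borel_integrable_compact dbar_disk_test(1)[OF \<phi>]) auto
  also have "(\<lambda>z. indicator (cball 0 R) z *\<^sub>R dbar \<phi> z) = dbar \<phi>"
    using R by (auto simp: fun_eq_iff indicator_def)
  finally have int_dbar: "integrable lborel (dbar \<phi>)" .
  have dbm: "dbar \<phi> \<in> borel_measurable borel"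
    by measurable
  have C: "integrable lborel (\<lambda>z. dbar \<phi> z * cauchy_part F z)"
    and C_eq: "(\<integral>z. dbar \<phi> z * cauchy_part F z \<partial>lborel) =
      (\<integral>\<zeta>. F \<zeta> * (\<integral>z. dbar \<phi> z * (1 / (\<zeta> - z)) \<partial>lborel) \<partial>lborel)"
    and Rf: "integrable lborel (\<lambda>z. dbar \<phi> z * reflected_part F z)"
    and Rf_eq: "(\<integral>z. dbar \<phi> z * reflected_part F z \<partial>lborel) =
      (\<integral>\<zeta>. cnj (F \<zeta>) * (\<integral>z. dbar \<phi> z * (z / (1 - z * cnj \<zeta>)) \<partial>lborel) \<partial>lborel)"
    by (rule cauchy_part_Fubini[OF F dbm B zero] reflected_part_Fubini[OF F F0 dbm int_dbar R(2,3)]; assumption)+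
  have "(\<integral>z. dbar \<phi> z * cauchy_part F z \<partial>lborel) = (\<integral>\<zeta>. F \<zeta> * (of_real pi * \<phi> \<zeta>) \<partial>lborel)"
    unfolding C_eq cauchy_pompeiu_disk_test[OF \<phi>] ..
  also have "\<dots> = of_real pi * (\<integral>\<zeta>. F \<zeta> * \<phi> \<zeta> \<partial>lborel)"
    by (subst integral_mult_right_zero[symmetric]) (simp only: mult_ac)
  finally have cauchy: "(\<integral>z. dbar \<phi> z * cauchy_part F z \<partial>lborel) = of_real pi * (\<integral>\<zeta>. F \<zeta> * \<phi> \<zeta> \<partial>lborel)" .
  have "cnj (F \<zeta>) * (\<integral>z. dbar \<phi> z * (z / (1 - z * cnj \<zeta>)) \<partial>lborel) = 0" for \<zeta>
  proof (cases "norm \<zeta> < 1")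
    case True
    have "1 - z * cnj \<zeta> \<noteq> 0" if "norm z < 1" for z
      using norm_one_minus_mult_cnj_ge[OF True, of z] that by auto
    then have "(\<lambda>z. z / (1 - z * cnj \<zeta>)) holomorphic_on unit_disk"
      by (intro holomorphic_intros) auto
    from integral_dbar_mult_holomorphic[OF \<phi> this] show ?thesis
      by (simp only: mult_zero_right)
  next
    case False
    then show ?thesis
      using F0[of \<zeta>] by simp
  qed
  then have refl: "(\<integral>z. dbar \<phi> z * reflected_part F z \<partial>lborel) = 0"
    by (simp only: Rf_eq Bochner_Integration.integral_zero)
  have "AE z in lborel. indicator unit_disk z *\<^sub>R (w z * dbar \<phi> z) = dbar \<phi> z * H z -
      (dbar \<phi> z * cauchy_part F z + dbar \<phi> z * reflected_part F z) / of_real pi"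
    using w
  proof eventually_elim
    case (elim z)
    show ?case
    proof (cases "z \<in> unit_disk")
      case True
      then have "w z = H z - (cauchy_part F z + reflected_part F z) / of_real pi"
        using elim by blast
      moreover have "indicat_real unit_disk z = 1"
        using True by simp
      ultimately show ?thesis
        by (simp add: right_diff_distrib distrib_left add_divide_distrib mult.commute[of _ "dbar \<phi> z"])
    next
      case False
      then show ?thesis
        using zero[of z] by simp
    qed
  qed
  moreover have int: "integrable lborel (\<lambda>z. dbar \<phi> z * cauchy_part F z + dbar \<phi> z * reflected_part F z)"
    using C Rf by (rule Bochner_Integration.integrable_add)
  have "integrable lborel (\<lambda>z. dbar \<phi> z * H z -
      (dbar \<phi> z * cauchy_part F z + dbar \<phi> z * reflected_part F z) / of_real pi)"
    using hol int by (intro Bochner_Integration.integrable_diff integrable_divide)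
  then have "(\<lambda>z. dbar \<phi> z * H z -
      (dbar \<phi> z * cauchy_part F z + dbar \<phi> z * reflected_part F z) / of_real pi) \<in> borel_measurable borel"
    by auto
  ultimately have "(LINT z:unit_disk|lebesgue. w z * dbar \<phi> z) = (\<integral>z. dbar \<phi> z * H z -
      (dbar \<phi> z * cauchy_part F z + dbar \<phi> z * reflected_part F z) / of_real pi \<partial>lborel)"
    unfolding set_lebesgue_integral_def by (intro lebesgue_AE_eq_borel(3))
  also have "\<dots> = (\<integral>z. dbar \<phi> z * H z \<partial>lborel) -
      ((\<integral>z. dbar \<phi> z * cauchy_part F z \<partial>lborel) + (\<integral>z. dbar \<phi> z * reflected_part F z \<partial>lborel)) / of_real pi"
    by (simp only: Bochner_Integration.integral_diff[OF hol integrable_divide[OF int]]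
        integral_divide_zero Bochner_Integration.integral_add[OF C Rf])
  also have "\<dots> = - (\<integral>\<zeta>. F \<zeta> * \<phi> \<zeta> \<partial>lborel)"
    by (simp only: cauchy refl integral_dbar_mult_holomorphic[OF \<phi> H]) simp
  also have "(\<integral>\<zeta>. F \<zeta> * \<phi> \<zeta> \<partial>lborel) = (LINT z:unit_disk|lebesgue. f z * \<phi> z)"
  proof -
    have "AE z in lborel. indicator unit_disk z *\<^sub>R (f z * \<phi> z) = F z * \<phi> z"
      using f by eventually_elim (metis mult_scaleR_left)
    then show ?thesis
      unfolding set_lebesgue_integral_def by (intro lebesgue_AE_eq_borel(3)[symmetric]) auto
  qed
  finally show "(LINT z:unit_disk|lebesgue. w z * dbar \<phi> z) = - (LINT z:unit_disk|lebesgue. f z * \<phi> z)" .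
qed

text \<open>The premise on \<open>w\<close> is pointwise, at points of convergence, because a
  formula valid almost everywhere in the plane could fail on this whole circle; \<open>int\<close>
  supplies convergence at almost every angle.\<close>

lemma circle_pairing_potential:
  assumes H: "H holomorphic_on unit_disk" and r: "0 < r" "r < 1"
    and F: "integrable lborel F" and F0: "\<And>\<zeta>. norm \<zeta> \<ge> 1 \<Longrightarrow> F \<zeta> = 0"
    and int: "integrable (lborel \<Otimes>\<^sub>M lborel)
      (\<lambda>(\<zeta>, \<theta>). F \<zeta> * (indicator {0..2*pi} \<theta> *\<^sub>R (1 / (\<zeta> - of_real r * cis \<theta>))))"
    and w: "\<And>z. z \<in> unit_disk \<Longrightarrow> integrable lborel (\<lambda>\<zeta>. F \<zeta> * (1 / (\<zeta> - z))) \<Longrightarrow>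
      w z = H z - (cauchy_part F z + reflected_part F z) / of_real pi"
    and \<phi>: "continuous_on UNIV \<phi>" and B: "\<And>t. norm (\<phi> t) \<le> B"
  shows "set_integrable lebesgue {0..2*pi} (\<lambda>\<theta>. w (of_real r * cis \<theta>) * \<phi> \<theta>)"
    and "circle_pairing w \<phi> r = circle_pairing H \<phi> r -
      ((\<integral>\<zeta>. F \<zeta> * circle_kernel \<phi> r \<zeta> \<partial>lborel) -
        cnj (\<integral>\<zeta>. F \<zeta> * circle_kernel (\<lambda>t. cnj (\<phi> t)) (1 / r) \<zeta> \<partial>lborel)) / of_real pi"
proof -
  have \<phi>m: "\<phi> \<in> borel_measurable borel"
    using \<phi> by (rule borel_measurable_continuous_onI)
  let ?z = "\<lambda>\<theta>. of_real r * cis \<theta>" and ?i = "indicat_real {0..2*pi}"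
  note C = cauchy_part_circle[OF F int \<phi>m B]
  have R: "integrable lborel (\<lambda>\<theta>. ?i \<theta> *\<^sub>R (reflected_part F (?z \<theta>) * \<phi> \<theta>))"
    and R_eq: "(\<integral>\<theta>. ?i \<theta> *\<^sub>R (reflected_part F (?z \<theta>) * \<phi> \<theta>) \<partial>lborel) =
      - cnj (\<integral>\<zeta>. F \<zeta> * circle_kernel (\<lambda>t. cnj (\<phi> t)) (1 / r) \<zeta> \<partial>lborel)"
    by (rule reflected_part_circle[OF F F0 r \<phi>m B]; assumption)+
  have "continuous_on {0..2*pi} (\<lambda>\<theta>. H (?z \<theta>))"
    using r by (intro continuous_on_compose2[OF holomorphic_on_imp_continuous_on[OF H]] continuous_intros)
      (auto simp: norm_mult)
  then have cont: "continuous_on {0..2*pi} (\<lambda>\<theta>. H (?z \<theta>) * \<phi> \<theta>)"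
    using \<phi> by (intro continuous_on_mult) (auto intro: continuous_on_subset)
  then have hol: "integrable lborel (\<lambda>\<theta>. ?i \<theta> *\<^sub>R (H (?z \<theta>) * \<phi> \<theta>))"
    using borel_integrable_atLeastAtMost'[OF cont] by (simp add: set_integrable_def)
  let ?W = "\<lambda>\<theta>. ?i \<theta> *\<^sub>R (H (?z \<theta>) * \<phi> \<theta>) -
    (?i \<theta> *\<^sub>R (cauchy_part F (?z \<theta>) * \<phi> \<theta>) + ?i \<theta> *\<^sub>R (reflected_part F (?z \<theta>) * \<phi> \<theta>)) / of_real pi"
  have CR: "integrable lborel (\<lambda>\<theta>. ?i \<theta> *\<^sub>R (cauchy_part F (?z \<theta>) * \<phi> \<theta>) + ?i \<theta> *\<^sub>R (reflected_part F (?z \<theta>) * \<phi> \<theta>))"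
    using C(1) R by (rule Bochner_Integration.integrable_add)
  have W: "integrable lborel ?W"
    using hol CR by (intro Bochner_Integration.integrable_diff integrable_divide)
  then have Wm: "?W \<in> borel_measurable borel"
    by auto
  have ae: "AE \<theta> in lborel. ?i \<theta> *\<^sub>R (w (?z \<theta>) * \<phi> \<theta>) = ?W \<theta>"
    using C(3)
  proof eventually_elim
    case (elim \<theta>)
    show ?case
    proof (cases "\<theta> \<in> {0..2*pi}")
      case True
      then have "w (?z \<theta>) = H (?z \<theta>) - (cauchy_part F (?z \<theta>) + reflected_part F (?z \<theta>)) / of_real pi"
        using elim r by (intro w) (auto simp: norm_mult)
      moreover have "?i \<theta> = 1"
        using True by simp
      ultimately show ?thesis
        by (simp add: left_diff_distrib distrib_right add_divide_distrib)
    next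
      case False
      then have "?i \<theta> = 0"
        by simp
      then show ?thesis
        by simp
    qed
  qed
  show "set_integrable lebesgue {0..2*pi} (\<lambda>\<theta>. w (?z \<theta>) * \<phi> \<theta>)"
    unfolding set_integrable_def using lebesgue_AE_eq_borel(2)[OF Wm ae] W by blast
  have "circle_pairing w \<phi> r = (\<integral>\<theta>. ?W \<theta> \<partial>lborel)"
    unfolding circle_pairing_def set_lebesgue_integral_def by (rule lebesgue_AE_eq_borel(3)[OF Wm ae])
  also have "\<dots> = (\<integral>\<theta>. ?i \<theta> *\<^sub>R (H (?z \<theta>) * \<phi> \<theta>) \<partial>lborel) -
      ((\<integral>\<theta>. ?i \<theta> *\<^sub>R (cauchy_part F (?z \<theta>) * \<phi> \<theta>) \<partial>lborel) +
       (\<integral>\<theta>. ?i \<theta> *\<^sub>R (reflected_part F (?z \<theta>) * \<phi> \<theta>) \<partial>lborel)) / of_real pi"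
    by (simp only: Bochner_Integration.integral_diff[OF hol integrable_divide[OF CR]]
        integral_divide_zero Bochner_Integration.integral_add[OF C(1) R])
  also have "(\<integral>\<theta>. ?i \<theta> *\<^sub>R (H (?z \<theta>) * \<phi> \<theta>) \<partial>lborel) = circle_pairing H \<phi> r"
    unfolding circle_pairing_def set_lebesgue_integral_def
    using hol by (intro integral_completion[symmetric]) auto
  finally show "circle_pairing w \<phi> r = circle_pairing H \<phi> r -
      ((\<integral>\<zeta>. F \<zeta> * circle_kernel \<phi> r \<zeta> \<partial>lborel) -
        cnj (\<integral>\<zeta>. F \<zeta> * circle_kernel (\<lambda>t. cnj (\<phi> t)) (1 / r) \<zeta> \<partial>lborel)) / of_real pi"
    unfolding C(2) R_eq by simp
qed

text \<open>A null set contains no interval ending at 1. This keeps the filter proper, so that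
  \<open>Lim\<close> returns the limit.\<close>

lemma at_left_minus_null_neq_bot:
  fixes N :: "real set"
  assumes N: "N \<in> null_sets lebesgue"
  shows "at 1 within {0<..<1} - N \<noteq> (bot :: real filter)"
proof -
  have "1 islimpt ({0<..<1} - N)"
    unfolding islimpt_approachable
  proof (intro allI impI)
    fix e :: real assume e: "e > 0"
    let ?I = "{max 0 (1 - e)<..<1}"
    have "\<not> ?I \<subseteq> N"
    proof
      assume "?I \<subseteq> N"
      then have "?I \<in> null_sets lebesgue"
        using N by (rule completion.complete2)
      then have "negligible ?I"
        by (simp add: negligible_iff_null_sets)
      then show False
        using open_not_negligible[of ?I] e by simp
    qed
    then obtain x where "x \<in> ?I" "x \<notin> N"
      by blast
    then show "\<exists>x\<in>{0<..<1} - N. x \<noteq> 1 \<and> dist x 1 < e"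
      by (intro bexI[of _ x]) (auto simp: dist_real_def)
  qed
  then show ?thesis
    by (simp add: trivial_limit_within)
qed

lemma circle_pairing_add_const:
  assumes h: "h holomorphic_on unit_disk" and r: "0 < r" "r < 1" and \<phi>: "continuous_on UNIV \<phi>"
  shows "circle_pairing (\<lambda>z. a + h z) \<phi> r = a * (LINT \<theta>:{0..2*pi}|lebesgue. \<phi> \<theta>) + circle_pairing h \<phi> r"
proof -
  have "continuous_on {0..2*pi} (\<lambda>\<theta>. h (of_real r * cis \<theta>) * \<phi> \<theta>)"
    using r \<phi> by (intro continuous_on_mult continuous_on_compose2[OF holomorphic_on_imp_continuous_on[OF h]] continuous_intros)
      (auto simp: norm_mult intro: continuous_on_subset)
  then have 1: "set_integrable lebesgue {0..2*pi} (\<lambda>\<theta>. h (of_real r * cis \<theta>) * \<phi> \<theta>)"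
    by (rule set_integral_continuous)
  have "continuous_on {0..2*pi} (\<lambda>\<theta>. a * \<phi> \<theta>)"
    using \<phi> by (intro continuous_on_mult_left) (auto intro: continuous_on_subset)
  then have 2: "set_integrable lebesgue {0..2*pi} (\<lambda>\<theta>. a * \<phi> \<theta>)"
    by (rule set_integral_continuous)
  show ?thesis
    unfolding circle_pairing_def distrib_right set_integral_add(2)[OF 2 1] by simp
qed

text \<open>The pairing at radius \<open>r\<close> involves the kernel at \<open>r\<close> for
  \<phi> and at \<open>1 / r\<close> for the conjugate of \<phi>. Both reach the kernel at 1, so for
  real \<phi> the potentials contribute a number minus its conjugate, which is imaginary.\<close>

lemma boundary_value_potential:
  assumes h: "h holomorphic_on unit_disk" "has_boundary_value {} h"
    and F: "integrable lborel F" and F0: "\<And>\<zeta>. norm \<zeta> \<ge> 1 \<Longrightarrow> F \<zeta> = 0"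
    and w: "\<And>z. z \<in> unit_disk \<Longrightarrow> integrable lborel (\<lambda>\<zeta>. F \<zeta> * (1 / (\<zeta> - z))) \<Longrightarrow>
      w z = (a + h z) - (cauchy_part F z + reflected_part F z) / of_real pi"
  obtains N where "N \<in> null_sets lebesgue" "has_boundary_value N w"
    "\<forall>\<phi>\<in>circle_tests. boundary_value N w \<phi> =
      a * (LINT \<theta>:{0..2*pi}|lebesgue. \<phi> \<theta>) + boundary_value {} h \<phi> -
      ((\<integral>\<zeta>. F \<zeta> * circle_kernel \<phi> 1 \<zeta> \<partial>lborel) -
        cnj (\<integral>\<zeta>. F \<zeta> * circle_kernel (\<lambda>t. cnj (\<phi> t)) 1 \<zeta> \<partial>lborel)) / of_real pi"
proof -
  define P where "P r \<longleftrightarrow> integrable (lborel \<Otimes>\<^sub>M lborel)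
    (\<lambda>(\<zeta>, \<theta>). F \<zeta> * (indicator {0..2*pi} \<theta> *\<^sub>R (1 / (\<zeta> - of_real r * cis \<theta>))))" for r
  \<comment> \<open>Only radii in (0, 1) can belong to this set, and its definition mentions
    \<open>F\<close> but no test function.\<close>
  define N where "N = {r. \<not> (r \<in> {0<..<1} \<longrightarrow> P r)}"
  have "AE r in lebesgue. r \<in> {0<..<1} \<longrightarrow> P r"
    unfolding P_def by (rule AE_completion[OF AE_radius_integrable[OF F]])
  then have N: "N \<in> null_sets lebesgue"
    by (simp add: completion.AE_iff_null_sets N_def)
  let ?S = "{0<..<1} - N"
  let ?A = "at 1 within ?S"
  have H: "(\<lambda>z. a + h z) holomorphic_on unit_disk"
    by (intro holomorphic_intros h)
  note pot = circle_pairing_potential[OF H _ _ F F0 _ w]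
  define L where "L \<phi> = a * (LINT \<theta>:{0..2*pi}|lebesgue. \<phi> \<theta>) + boundary_value {} h \<phi> -
      ((\<integral>\<zeta>. F \<zeta> * circle_kernel \<phi> 1 \<zeta> \<partial>lborel) -
        cnj (\<integral>\<zeta>. F \<zeta> * circle_kernel (\<lambda>t. cnj (\<phi> t)) 1 \<zeta> \<partial>lborel)) / of_real pi" for \<phi>
  have lim: "(circle_pairing w \<phi> \<longlongrightarrow> L \<phi>) ?A" if \<phi>: "\<phi> \<in> circle_tests" for \<phi>
  proof -
    obtain B where B: "\<And>t. norm (\<phi> t) \<le> B"
      using circle_test_bounded[OF \<phi>] by blast
    have cont: "continuous_on UNIV \<phi>"
      by (rule circle_test_continuous[OF \<phi>])
    have \<phi>c: "(\<lambda>t. cnj (\<phi> t)) \<in> circle_tests"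
      by (rule circle_tests_bounded_linear[OF bounded_linear_cnj \<phi>])
    let ?X = "\<lambda>\<phi> \<rho>. \<integral>\<zeta>. F \<zeta> * circle_kernel \<phi> \<rho> \<zeta> \<partial>lborel"
    let ?p = "\<lambda>r. a * (LINT \<theta>:{0..2*pi}|lebesgue. \<phi> \<theta>) + circle_pairing h \<phi> r -
      (?X \<phi> r - cnj (?X (\<lambda>t. cnj (\<phi> t)) (1 / r))) / of_real pi"
    have "circle_pairing w \<phi> r = ?p r" if "r \<in> ?S" for r
      using that pot(2)[of r \<phi> B] B cont circle_pairing_add_const[OF h(1) _ _ cont, of r a]
      by (simp add: N_def P_def)
    then have ev: "\<forall>\<^sub>F r in ?A. ?p r = circle_pairing w \<phi> r"
      by (auto simp: eventually_at_filter)
    have at: "?A \<le> at 1" "?A \<le> at 1 within {0<..<1} - {}"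
      by (auto intro: at_le)
    obtain l where l: "(circle_pairing h \<phi> \<longlongrightarrow> l) (at 1 within {0<..<1} - {})"
      using h(2) \<phi> by (auto simp: has_boundary_value_def)
    then have bv: "boundary_value {} h \<phi> = l"
      unfolding boundary_value_def using at_left_minus_null_neq_bot[of "{}"] by (intro tendsto_Lim) auto
    have "(circle_pairing h \<phi> \<longlongrightarrow> boundary_value {} h \<phi>) ?A"
      using l at(2) bv tendsto_mono by blast
    moreover have "(?X \<phi> \<longlongrightarrow> ?X \<phi> 1) ?A"
      using integral_circle_kernel_tendsto_at[OF \<phi> F F0] at(1) tendsto_mono by blast
    \<comment> \<open>Here the kernel is approached from outside the unit circle, since
      \<open>1 / r > 1\<close>.\<close>
    moreover have "((\<lambda>r. ?X (\<lambda>t. cnj (\<phi> t)) (1 / r)) \<longlongrightarrow> ?X (\<lambda>t. cnj (\<phi> t)) 1) ?A"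
    proof (rule filterlim_compose[OF integral_circle_kernel_tendsto_at[OF \<phi>c F F0]])
      have "((\<lambda>r. 1 / r) \<longlongrightarrow> 1 / 1) ?A"
        by (intro tendsto_intros) auto
      moreover have "\<forall>\<^sub>F r in ?A. 1 / r \<in> UNIV \<and> 1 / r \<noteq> 1"
        by (auto simp: eventually_at_filter)
      ultimately show "filterlim (\<lambda>r. 1 / r) (at 1) ?A"
        by (simp add: filterlim_at)
    qed
    ultimately have "(?p \<longlongrightarrow> L \<phi>) ?A"
      unfolding L_def by (intro tendsto_intros) auto
    then show ?thesis
      by (rule Lim_transform_eventually[OF _ ev])
  qed
  have bv: "boundary_value N w \<phi> = L \<phi>" if "\<phi> \<in> circle_tests" for \<phi>
    unfolding boundary_value_def by (rule tendsto_Lim[OF at_left_minus_null_neq_bot[OF N] lim[OF that]])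
  \<comment> \<open>Integrability of the trace itself is the case of the constant test function
    1.\<close>
  have "set_integrable lebesgue {0..2*pi} (\<lambda>\<theta>. w (of_real r * cis \<theta>))" if "r \<in> ?S" for r
    using that pot(1)[of r "\<lambda>_. 1" 1] by (simp add: N_def P_def)
  then have "has_boundary_value N w"
    using lim unfolding has_boundary_value_def by blast
  then show ?thesis
    using that N bv unfolding L_def by blast
qed

theorem theorem2p10:
  fixes f h w :: "complex \<Rightarrow> complex" and c :: real
  assumes "set_integrable lebesgue unit_disk f"
    and "h \<in> H_b"
    and "schwarz_formula_defined f"
    and "w = schwarz_solution f h c"
  shows "weak_dbar_eq w f \<and>
    (\<exists>N\<in>null_sets lebesgue. has_boundary_value N w \<and>
      (\<forall>\<phi>\<in>circle_tests.
        Re_distr (boundary_value N w) \<phi> = Re_distr (boundary_value {} h) \<phi>)) \<and>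
    Im (w 0) = c"
proof -
  have h: "h holomorphic_on unit_disk" "has_boundary_value {} h"
    using assms(2) by (auto simp: H_b_def)
  obtain F J where F: "integrable lborel F" and F0': "\<forall>\<zeta>. norm \<zeta> \<ge> 1 \<longrightarrow> F \<zeta> = 0"
    and f: "AE z in lborel. indicator unit_disk z *\<^sub>R f z = F z"
    and S: "\<forall>z\<in>unit_disk. integrable lborel (\<lambda>\<zeta>. F \<zeta> * (1 / (\<zeta> - z))) \<longrightarrow>
      (LINT \<zeta>:unit_disk|lebesgue. schwarz_integrand f z \<zeta>) =
      - 2 * \<i> * of_real J + 2 * cauchy_part F z + 2 * reflected_part F z"
    by (rule schwarz_integral_representation[OF assms(1,3)])
  have F0: "F \<zeta> = 0" if "norm \<zeta> \<ge> 1" for \<zeta>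
    using F0' that by blast
  \<comment> \<open>At \<open>z = 0\<close> the Poisson kernel is the constant 1, so the correction
    term \<open>I\<close> of the formula comes out as \<open>\<i> * Im (h 0)\<close>.\<close>
  have bv1: "boundary_value {} h (\<lambda>_. 1) = 2 * pi * h 0"
    using boundary_value_poisson[OF h(1), of 0] by (simp add: poisson_def)
  have "boundary_value {} h (\<lambda>_. 0) = 0"
  proof -
    have "circle_pairing h (\<lambda>_. 0) = (\<lambda>_. 0)"
      by (simp add: circle_pairing_def fun_eq_iff)
    then show ?thesis
      unfolding boundary_value_def using at_left_minus_null_neq_bot[of "{}"] by (intro tendsto_Lim) auto
  qed
  then have Im1: "Im_distr (boundary_value {} h) (\<lambda>_. 1) = 2 * pi * Im (h 0)"
    using bv1 by (simp add: Im_distr_def)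
  have w: "w z = \<i> * of_real (c - Im (h 0)) + h z -
      1 / of_real (2 * pi) * (LINT \<zeta>:unit_disk|lebesgue. schwarz_integrand f z \<zeta>)" if "z \<in> unit_disk" for z
    using that boundary_value_poisson[OF h(1), of z]
    by (simp add: assms(4) schwarz_solution_def Im1 algebra_simps)
  \<comment> \<open>\<open>J / pi\<close> arises from the factor \<open>-1 / (2 * pi)\<close>
    applied to the term \<open>-2 * \<i> * J\<close> of the integral. The constant is purely
    imaginary, hence invisible in the real part of the boundary value.\<close>
  define a where "a = \<i> * of_real (c - Im (h 0) + J / pi)"
  have pot: "w z = (a + h z) - (cauchy_part F z + reflected_part F z) / of_real pi"
    if "z \<in> unit_disk" "integrable lborel (\<lambda>\<zeta>. F \<zeta> * (1 / (\<zeta> - z)))" for z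
    unfolding w[OF that(1)] S[rule_format, OF that] a_def by (simp add: field_simps)
  have "AE z in lborel. indicator unit_disk z \<noteq> (0::complex) \<longrightarrow> integrable lborel (\<lambda>\<zeta>. F \<zeta> * (1 / (\<zeta> - z)))"
    by (rule cauchy_part_Fubini(3)[OF F, of _ 1]) (auto simp: indicator_def)
  then have "AE z in lborel. z \<in> unit_disk \<longrightarrow>
      w z = (a + h z) - (cauchy_part F z + reflected_part F z) / of_real pi"
    by eventually_elim (use pot in auto)
  moreover have "(\<lambda>z. a + h z) holomorphic_on unit_disk"
    by (intro holomorphic_intros h)
  ultimately have weak: "weak_dbar_eq w f"
    by (intro weak_dbar_eq_potential[OF _ F F0 f])
  obtain N where N: "N \<in> null_sets lebesgue" "has_boundary_value N w"
    and bv: "\<forall>\<phi>\<in>circle_tests. boundary_value N w \<phi> =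
      a * (LINT \<theta>:{0..2*pi}|lebesgue. \<phi> \<theta>) + boundary_value {} h \<phi> -
      ((\<integral>\<zeta>. F \<zeta> * circle_kernel \<phi> 1 \<zeta> \<partial>lborel) -
        cnj (\<integral>\<zeta>. F \<zeta> * circle_kernel (\<lambda>t. cnj (\<phi> t)) 1 \<zeta> \<partial>lborel)) / of_real pi"
    using boundary_value_potential[OF h F F0 pot] .
  \<comment> \<open>For real-valued test functions the multiple of \<open>a\<close> is imaginary,
    and the two kernel integrals are conjugates of each other, so only the term from
    \<open>h\<close> has a real part.\<close>
  have Re_bv: "Re (boundary_value N w (\<lambda>t. of_real (\<psi> t))) = Re (boundary_value {} h (\<lambda>t. of_real (\<psi> t)))"
    if "(\<lambda>t. of_real (\<psi> t)) \<in> circle_tests" for \<psi> :: "real \<Rightarrow> real"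
    by (simp add: bspec[OF bv that] a_def set_integral_complex_of_real)
  have "Re_distr (boundary_value N w) \<phi> = Re_distr (boundary_value {} h) \<phi>" if \<phi>: "\<phi> \<in> circle_tests" for \<phi>
  proof -
    have "bounded_linear (\<lambda>z. complex_of_real (Re z))" "bounded_linear (\<lambda>z. complex_of_real (Im z))"
      by (intro bounded_linear_compose[OF bounded_linear_of_real] bounded_linear_Re bounded_linear_Im)+
    from this[THEN circle_tests_bounded_linear[OF _ \<phi>]] show ?thesis
      unfolding Re_distr_def by (simp only: Re_bv)
  qed
  moreover have "Im (w 0) = c"
  proof -
    \<comment> \<open>At \<open>z = 0\<close> the two summands are conjugate to each other, so the
      integral is real, and it stays real if it diverges, when its value is 0. The representation by
      potentials cannot be used here, as it presupposes convergence of the Cauchy integral at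
      0.\<close>
    have "schwarz_integrand f 0 \<zeta> = of_real (2 * Re (f \<zeta> / \<zeta>))" for \<zeta>
      by (cases "\<zeta> = 0") (simp_all add: schwarz_integrand_def complex_add_cnj flip: complex_cnj_divide)
    then have "(LINT \<zeta>:unit_disk|lebesgue. schwarz_integrand f 0 \<zeta>) =
        of_real (LINT \<zeta>:unit_disk|lebesgue. 2 * Re (f \<zeta> / \<zeta>))"
      by (simp only: set_integral_complex_of_real)
    then show ?thesis
      by (simp add: w)
  qed
  ultimately show ?thesis
    using weak N by blast
qed

end
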